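(* Assume that $f$ and $g$ satisfy: (A$_1$) $f\in C^4(\mathbb{R})$; (A$_2$) $g\in C^3(\mathbb{R})$, $g(0)=g(1)=0$, $g'(0)>0$, $g'(1)<0$, $g(u)>0$ for all $u\in(0,1)$, and $g(u)<0$ for all $u\in(-\infty,0)$; (A$_3$) there exists $u_*\in(-\infty,0)$ such that $\int_{u_*}^0 g(s)\,ds+\int_0^1 g(s)\,ds=0$; and, with $\gamma(u):=\sqrt{2\int_u^1 g(s)\,ds}>0$ for $u\in(u_*,1)$, (A$_5$) $\displaystyle\Big[\int_{u_*}^1\gamma(s)\,ds\Big]\Big[\int_{u_*}^1 f'(s)\sqrt{1+\gamma'(s)^2}\,ds\Big]\neq\Big[\int_{u_*}^1\sqrt{1+\gamma'(s)^2}\,ds\Big]\Big[\int_{u_*}^1 f'(s)\gamma(s)\,ds\Big]$; (A$_6$) $\displaystyle f'(1)\Big[\int_{u_*}^1\gamma(s)\,ds\Big]\neq\int_{u_*}^1 f'(s)\gamma(s)\,ds$. Let $\epsilon_1>0$ and let $u(x,t)=\varphi^\epsilon(x-c(\epsilon)t)$, $0<\epsilon<\epsilon_1$, be the family of large-period periodic traveling wave solutions of $$u_t+f(u)_x=u_{xx}+g(u)$$ described in the context, with fundamental periods $L_\epsilon$. Then there exists $\bar\epsilon_1\in(0,\epsilon_1)$ sufficiently small such that each large period wave $u(x,t)=\varphi^\epsilon(x-c(\epsilon)t)$ with $\epsilon\in(0,\bar\epsilon_1)$ is orbitally unstable in the periodic space $H^2_{\mathrm{per}}([0,L_\epsilon])$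 under the flow of the equation.
   Context: For $L>0$ and $s\in\mathbb{R}$, $H^s_{\mathrm{per}}([0,L])$ is the Sobolev space of $L$-periodic distributions $u$ with $\|u\|_s^2 := L\sum_{k\in\mathbb{Z}}(1+|k|^2)^s|\widehat u(k)|^2<\infty$. The family of large-period waves (a known existence result, obtained from a global homoclinic bifurcation): under (A$_1$)–(A$_3$), (A$_5$), (A$_6$), set $c_1:=\int_{u_*}^1 f'(s)\gamma(s)\,ds\big/\int_{u_*}^1\gamma(s)\,ds$. There exists a traveling pulse solution $u(x,t)=\varphi^0(x-c_1t)$ of $u_t+f(u)_x=u_{xx}+g(u)$ with $\varphi^0\in C^3(\mathbb{R})$, $\varphi^0(x)\to1$ as $x\to\pm\infty$ and $|\varphi^0(x)-1|,|(\varphi^0)'(x)|\le Ce^{-\kappa|x|}$ for all $x\in\mathbb{R}$ and some $\kappa>0$. In addition there is $\epsilon_1>0$ sufficiently small such that for each $0<\epsilon<\epsilon_1$ there exists a unique periodic traveling wave solution $u(x,t)=\varphi^\epsilon(x-c(\epsilon)t)$ with speed $c(\epsilon)=c_1+\epsilon$ if $f'(1)<c_1$, or $c(\epsilon)=c_1-\epsilon$ if $f'(1)>c_1$, with fundamental period $L_\epsilon=O(|\log\epsilon|)\to\infty$ and amplitude $|\varphi^\epsilon(x)|,|(\varphi^\epsilon)'(x)|=O(1)$ as $\epsilon\to0^+$. Moreover (after a suitable reparametrization of $x$), for all $0<\epsilon<\epsilon_1$, with a uniform $C>0$ and the same $\kappa>0$, $$\sup_{x\in[-L_\epsilon/2,L_\epsilon/2]}\big(|\varphi^0(x)-\varphi^\epsilon(x)|+|(\varphi^0)'(x)-(\varphi^\epsilon)'(x)|\big)\le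 Ce^{-\kappa L_\epsilon/2},\qquad |c_1-c(\epsilon)|\le Ce^{-\kappa L_\epsilon}.$$ Orbital (in)stability: with $X=H^2_{\mathrm{per}}([0,L])$, $L$ the fundamental period of the wave, a traveling wave $\varphi\in X$ is orbitally stable in $X$ by the flow of the equation if for each $\varepsilon>0$ there exists $\delta>0$ such that whenever $\psi\in X$ satisfies $\inf_{r\in\mathbb{R}}\|\psi(\cdot)-\varphi(\cdot+r)\|_X<\delta$, the solution $u(x,t)$ with initial condition $u(0)=\psi$ exists globally in time and satisfies $\sup_{t>0}\inf_{r\in\mathbb{R}}\|u(\cdot,t)-\varphi(\cdot+r)\|_X<\varepsilon$. Otherwise $\varphi$ is orbitally unstable in $X$. Solutions with data in $H^2_{\mathrm{per}}([0,L])$ are the unique local solutions in $C([0,T];H^2_{\mathrm{per}}([0,L]))\cap C^1((0,T];L^2_{\mathrm{per}}([0,L]))$. *)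

theory Defs
  imports "HOL-Analysis.Analysis" "HOL-Library.Landau_Symbols"
begin

definition C_k :: "nat \<Rightarrow> (real \<Rightarrow> real) \<Rightarrow> bool" where
  "C_k k h \<longleftrightarrow>
     (\<forall>j<k. \<forall>x. (deriv ^^ j) h differentiable (at x)) \<and> continuous_on UNIV ((deriv ^^ k) h)"

definition periodic :: "real \<Rightarrow> (real \<Rightarrow> 'a) \<Rightarrow> bool" where
  "periodic L h \<longleftrightarrow> (\<forall>x. h (x + L) = h x)"

definition fundamental_period :: "real \<Rightarrow> (real \<Rightarrow> 'a) \<Rightarrow> bool" where
  "fundamental_period L h \<longleftrightarrow>
     0 < L \<and> periodic L h \<and> (\<forall>T. 0 < T \<and> T < L \<longrightarrow> \<not> periodic T h)"

text \<open>
  A real-valued periodic Sobolev function is represented by any Borel measurable member of its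
  almost-everywhere class; nothing below depends on the choice of the representative.
\<close>

definition L1_per :: "real \<Rightarrow> (real \<Rightarrow> real) set" where
  "L1_per L = {u. u \<in> borel_measurable borel \<and> periodic L u \<and> set_integrable lborel {0..L} u}"

definition fourier_coeff :: "real \<Rightarrow> (real \<Rightarrow> real) \<Rightarrow> int \<Rightarrow> complex" where
  "fourier_coeff L u k =
     (LINT x:{0..L}|lborel. complex_of_real (u x) * cis (- (2 * pi * of_int k * x / L))) / of_real L"

text \<open>
  Only exponents \<open>s \<ge> 0\<close> are meant. For these, every periodic distribution with finite norm is a
  square-integrable function, so that ranging over \<^const>\<open>L1_per\<close> loses nothing; \<open>s = 0\<close> gives
  the space of \<open>L\<close>-periodic square-integrable functions with its usual norm.
\<close>

definition Hs_per :: "real \<Rightarrow> real \<Rightarrow> (real \<Rightarrow> real) set" where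
  "Hs_per s L = {u \<in> L1_per L.
     (\<lambda>k::int. (1 + \<bar>of_int k\<bar>\<^sup>2) powr s * (cmod (fourier_coeff L u k))\<^sup>2) summable_on UNIV}"

definition Hs_norm :: "real \<Rightarrow> real \<Rightarrow> (real \<Rightarrow> real) \<Rightarrow> real" where
  "Hs_norm s L u =
     sqrt (L * (\<Sum>\<^sub>\<infinity>k::int. (1 + \<bar>of_int k\<bar>\<^sup>2) powr s * (cmod (fourier_coeff L u k))\<^sup>2))"

definition weak_deriv_per :: "real \<Rightarrow> (real \<Rightarrow> real) \<Rightarrow> (real \<Rightarrow> real) \<Rightarrow> bool" where
  "weak_deriv_per L u w \<longleftrightarrow> u \<in> L1_per L \<and> w \<in> L1_per L \<and>
     (\<forall>\<eta>. (\<forall>k. C_k k \<eta>) \<and> periodic L \<eta> \<longrightarrow>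
        (LINT x:{0..L}|lborel. u x * deriv \<eta> x) = - (LINT x:{0..L}|lborel. w x * \<eta> x))"

text \<open>Functions of space and time take the time variable first.\<close>

definition classical_solution ::
  "(real \<Rightarrow> real) \<Rightarrow> (real \<Rightarrow> real) \<Rightarrow> (real \<Rightarrow> real \<Rightarrow> real) \<Rightarrow> bool" where
  "classical_solution f g u \<longleftrightarrow>
     (\<forall>t. C_k 2 (u t)) \<and> (\<forall>t x. (\<lambda>\<tau>. u \<tau> x) differentiable (at t)) \<and>
     (\<forall>t x. deriv (\<lambda>\<tau>. u \<tau> x) t + deriv (\<lambda>y. f (u t y)) x = deriv (deriv (u t)) x + g (u t x))"

definition traveling_wave ::
  "(real \<Rightarrow> real) \<Rightarrow> (real \<Rightarrow> real) \<Rightarrow> real \<Rightarrow> (real \<Rightarrow> real) \<Rightarrow> bool" where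
  "traveling_wave f g c \<phi> \<longleftrightarrow> classical_solution f g (\<lambda>t x. \<phi> (x - c * t))"

text \<open>
  Solutions in \<open>C([0,T]; H\<^sup>2) \<inter> C\<^sup>1((0,T]; L\<^sup>2)\<close> with initial datum \<open>\<psi>\<close>: \<open>v\<close> is the time derivative
  of \<open>u\<close>, and the equation is an identity in \<open>L\<^sup>2\<close> with
  \<open>p = f(u)\<^sub>x\<close>, \<open>q = u\<^sub>x\<close>, \<open>r = u\<^sub>x\<^sub>x\<close>.
\<close>

definition H2_solution ::
  "(real \<Rightarrow> real) \<Rightarrow> (real \<Rightarrow> real) \<Rightarrow> real \<Rightarrow> real \<Rightarrow> (real \<Rightarrow> real) \<Rightarrow> (real \<Rightarrow> real \<Rightarrow> real) \<Rightarrow> bool"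
  where
  "H2_solution f g L T \<psi> u \<longleftrightarrow>
     (\<forall>t\<in>{0..T}. u t \<in> Hs_per 2 L) \<and>
     (\<forall>t\<in>{0..T}. ((\<lambda>s. Hs_norm 2 L (\<lambda>x. u s x - u t x)) \<longlongrightarrow> 0) (at t within {0..T})) \<and>
     (AE x in lborel. u 0 x = \<psi> x) \<and>
     (\<exists>v.
       (\<forall>t\<in>{0<..T}. v t \<in> Hs_per 0 L) \<and>
       (\<forall>t\<in>{0<..T}. ((\<lambda>s. Hs_norm 0 L (\<lambda>x. (u s x - u t x) / (s - t) - v t x)) \<longlongrightarrow> 0)
                      (at t within {0<..T})) \<and>
       (\<forall>t\<in>{0<..T}. ((\<lambda>s. Hs_norm 0 L (\<lambda>x. v s x - v t x)) \<longlongrightarrow> 0) (at t within {0<..T})) \<and>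
       (\<forall>t\<in>{0<..T}. \<exists>p q r.
          weak_deriv_per L (\<lambda>x. f (u t x)) p \<and> weak_deriv_per L (u t) q \<and> weak_deriv_per L q r \<and>
          (AE x in lborel. v t x + p x = r x + g (u t x))))"

definition H2_global_solution ::
  "(real \<Rightarrow> real) \<Rightarrow> (real \<Rightarrow> real) \<Rightarrow> real \<Rightarrow> (real \<Rightarrow> real) \<Rightarrow> (real \<Rightarrow> real \<Rightarrow> real) \<Rightarrow> bool" where
  "H2_global_solution f g L \<psi> u \<longleftrightarrow> (\<forall>T>0. H2_solution f g L T \<psi> u)"

definition orbit_dist :: "real \<Rightarrow> (real \<Rightarrow> real) \<Rightarrow> (real \<Rightarrow> real) \<Rightarrow> real" where
  "orbit_dist L \<phi> w = (INF r. Hs_norm 2 L (\<lambda>x. w x - \<phi> (x + r)))"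

text \<open>
  The supremum over time is taken in \<^typ>\<open>ennreal\<close> because it may be infinite. Solutions in the class
  \<^const>\<open>H2_solution\<close> are unique, so existence of a global solution with the stated property says
  that the solution starting at \<open>\<psi>\<close> is global and has it.
\<close>

definition orbitally_stable ::
  "(real \<Rightarrow> real) \<Rightarrow> (real \<Rightarrow> real) \<Rightarrow> real \<Rightarrow> (real \<Rightarrow> real) \<Rightarrow> bool" where
  "orbitally_stable f g L \<phi> \<longleftrightarrow> \<phi> \<in> Hs_per 2 L \<and>
     (\<forall>e>0. \<exists>d>0. \<forall>\<psi>\<in>Hs_per 2 L. orbit_dist L \<phi> \<psi> < d \<longrightarrow>
        (\<exists>u. H2_global_solution f g L \<psi> u \<and>
             (SUP t\<in>{0<..}. ennreal (orbit_dist L \<phi> (u t))) < ennreal e))"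

definition orbitally_unstable ::
  "(real \<Rightarrow> real) \<Rightarrow> (real \<Rightarrow> real) \<Rightarrow> real \<Rightarrow> (real \<Rightarrow> real) \<Rightarrow> bool" where
  "orbitally_unstable f g L \<phi> \<longleftrightarrow> \<phi> \<in> Hs_per 2 L \<and> \<not> orbitally_stable f g L \<phi>"

definition gam :: "(real \<Rightarrow> real) \<Rightarrow> real \<Rightarrow> real" where
  "gam g u = sqrt (2 * integral {u..1} g)"

definition homoclinic_speed :: "(real \<Rightarrow> real) \<Rightarrow> (real \<Rightarrow> real) \<Rightarrow> real \<Rightarrow> real" where
  "homoclinic_speed f g us =
     integral {us..1} (\<lambda>s. deriv f s * gam g s) / integral {us..1} (gam g)"

text \<open>
  The second branch is the case \<open>f'(1) > c\<^sub>1\<close>: equality is excluded by the hypothesis that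
  \<open>f'(1) \<integral>\<gamma> \<noteq> \<integral>f' \<gamma>\<close>.
\<close>

definition wave_speed :: "(real \<Rightarrow> real) \<Rightarrow> (real \<Rightarrow> real) \<Rightarrow> real \<Rightarrow> real \<Rightarrow> real" where
  "wave_speed f g us \<epsilon> =
     (if deriv f 1 < homoclinic_speed f g us then homoclinic_speed f g us + \<epsilon>
      else homoclinic_speed f g us - \<epsilon>)"

definition traveling_pulse ::
  "(real \<Rightarrow> real) \<Rightarrow> (real \<Rightarrow> real) \<Rightarrow> real \<Rightarrow> real \<Rightarrow> (real \<Rightarrow> real) \<Rightarrow> bool" where
  "traveling_pulse f g us \<kappa> \<phi>0 \<longleftrightarrow>
     traveling_wave f g (homoclinic_speed f g us) \<phi>0 \<and> C_k 3 \<phi>0 \<and> \<not> \<phi>0 constant_on UNIV \<and>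
     (\<phi>0 \<longlongrightarrow> 1) at_top \<and> (\<phi>0 \<longlongrightarrow> 1) at_bot \<and>
     (\<exists>C>0. \<forall>x. \<bar>\<phi>0 x - 1\<bar> \<le> C * exp (- \<kappa> * \<bar>x\<bar>) \<and> \<bar>deriv \<phi>0 x\<bar> \<le> C * exp (- \<kappa> * \<bar>x\<bar>))"

definition close_to_pulse ::
  "real \<Rightarrow> real \<Rightarrow> (real \<Rightarrow> real) \<Rightarrow> real \<Rightarrow> (real \<Rightarrow> real) \<Rightarrow> bool" where
  "close_to_pulse C \<kappa> \<phi>0 l w \<longleftrightarrow>
     (\<forall>x\<in>{- l / 2..l / 2}.
        \<bar>\<phi>0 x - w x\<bar> + \<bar>deriv \<phi>0 x - deriv w x\<bar> \<le> C * exp (- \<kappa> * l / 2))"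

text \<open>
  The shift \<open>a\<close> is the reparametrization of \<open>x\<close> after which a wave is close to the pulse. The last
  clause is uniqueness up to translation. It is restricted to waves with the same speed, the same
  fundamental period and the same closeness to the pulse, since the equation may have other periodic
  waves of that speed away from the homoclinic loop.
\<close>

definition large_period_family ::
  "(real \<Rightarrow> real) \<Rightarrow> (real \<Rightarrow> real) \<Rightarrow> real \<Rightarrow> real \<Rightarrow> (real \<Rightarrow> real) \<Rightarrow> (real \<Rightarrow> real \<Rightarrow> real) \<Rightarrow> bool"
  where
  "large_period_family f g us \<epsilon>1 L \<phi> \<longleftrightarrow>
     (\<forall>\<epsilon>\<in>{0<..<\<epsilon>1}. traveling_wave f g (wave_speed f g us \<epsilon>) (\<phi> \<epsilon>) \<and>
                      fundamental_period (L \<epsilon>) (\<phi> \<epsilon>)) \<and>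
     L \<in> O[at_right 0](\<lambda>\<epsilon>. \<bar>ln \<epsilon>\<bar>) \<and> filterlim L at_top (at_right 0) \<and>
     (\<exists>M. \<forall>\<^sub>F \<epsilon> in at_right 0. \<forall>x. \<bar>\<phi> \<epsilon> x\<bar> \<le> M \<and> \<bar>deriv (\<phi> \<epsilon>) x\<bar> \<le> M) \<and>
     (\<exists>\<kappa>>0. \<exists>C>0. \<exists>\<phi>0. traveling_pulse f g us \<kappa> \<phi>0 \<and>
       (\<forall>\<epsilon>\<in>{0<..<\<epsilon>1}.
          (\<exists>a. close_to_pulse C \<kappa> \<phi>0 (L \<epsilon>) (\<lambda>x. \<phi> \<epsilon> (x + a))) \<and>
          \<bar>homoclinic_speed f g us - wave_speed f g us \<epsilon>\<bar> \<le> C * exp (- \<kappa> * L \<epsilon>) \<and>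
          (\<forall>w. traveling_wave f g (wave_speed f g us \<epsilon>) w \<and> fundamental_period (L \<epsilon>) w \<and>
               (\<exists>a. close_to_pulse C \<kappa> \<phi>0 (L \<epsilon>) (\<lambda>x. w (x + a))) \<longrightarrow>
               (\<exists>r. \<forall>x. w x = \<phi> \<epsilon> (x + r)))))"

end

theory Submission
  imports Defs "HOL-Library.Nat_Bijection"
begin

text \<open>
  The closeness to the pulse is irrelevant: every nonconstant periodic travelling wave
  \<open>\<phi>(x - c t)\<close> of a scalar equation is unstable in its own period class. Suppose it is stable,
  and follow the solution \<open>u\<close> starting at \<open>\<phi> + \<rho>\<close> with a small constant \<open>\<rho> > 0\<close>. By comparison
  \<open>V = u - \<phi>(x - c t)\<close> stays nonnegative; together with closeness to some translate of \<open>\<phi>\<close> and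
  equality of means this forces \<open>V\<close> to stay uniformly small, so there is no drift along the orbit.
  The derivative \<open>\<phi>'\<close> lies in the kernel of the linearisation and changes sign; a perturbation of its
  positive part, transported to the adjoint problem, gives a periodic weight \<open>Z \<ge> 0\<close> on which
  the adjoint linearisation is at least \<open>\<mu> Z\<close> with \<open>\<mu> > 0\<close>, with room to absorb the nonlinearity.
  Hence \<open>\<integral> Z(x - c t) V dx\<close> grows exponentially, which is a contradiction.
\<close>

section \<open>Trigonometric polynomials on a period\<close>

text \<open>Orbital stability controls only the distance to the set of all translates, so a solution
  might drift along the orbit to places where the linearisation about the original wave says
  nothing. The one-sided perturbation removes this freedom: a function above \<phi>(x - c t) and
  near a translate of \<phi> forces that translate to be almost above the wave. The sign of V is
  used twice. It also lets a pointwise inequality for Z be multiplied by V and integrated, so growth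
  is read off from one integral instead of from a spectrum. The Taylor remainders of f and g are
  small multiples of V, not of V^2; hence Z must be a strict subsolution with a margin in both Z and
  |Z'|. The other obstacle is low regularity. The time derivative exists only in L^2, so every
  statement about time is one about integrals against C^1 periodic functions. This dictates the cube
  in \<open>neg_energy\<close>, whose derivative is then an admissible test function, and the C^2
  smoothing of the positive part. The Fourier analysis translates norms defined by coefficients into
  this pointwise and weak language.\<close>

definition per_exp :: "real \<Rightarrow> int \<Rightarrow> real \<Rightarrow> complex" where
  "per_exp L k x = cis (2 * pi * of_int k * x / L)"

lemma per_exp_0 [simp]: "per_exp L 0 x = 1"
  by (simp add: per_exp_def)

lemma per_exp_at_0 [simp]: "per_exp L k 0 = 1"
  by (simp add: per_exp_def)

lemma per_exp_mult: "per_exp L j x * per_exp L k x = per_exp L (j + k) x"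
  by (simp add: per_exp_def cis_mult add_divide_distrib distrib_left distrib_right)

lemma cnj_per_exp: "cnj (per_exp L k x) = per_exp L (- k) x"
  by (simp add: per_exp_def cis_cnj)

lemma norm_per_exp [simp]: "cmod (per_exp L k x) = 1"
  by (simp add: per_exp_def)

lemma cis_minus_per_exp: "cis (- (2 * pi * of_int k * x / L)) = per_exp L (- k) x"
  by (simp add: per_exp_def)

lemma cis_2pi_int: "cis (2 * pi * of_int k) = 1"
  by (metis cis_multiple_2pi Ints_of_int)

lemma per_exp_at_period: "L > 0 \<Longrightarrow> per_exp L k L = 1"
  by (simp add: per_exp_def cis_2pi_int)

lemma per_exp_has_vector_derivative:
  "(per_exp L k has_vector_derivative (2 * pi * of_int k / L) *\<^sub>R (\<i> * per_exp L k x)) (at x within S)"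
proof -
  have "((\<lambda>x. cis (w * x)) has_vector_derivative w *\<^sub>R (\<i> * cis (w * x))) (at x within S)" for w
    unfolding has_vector_derivative_def
    by (auto intro!: derivative_eq_intros simp: mult_ac)
  from this[of "2 * pi * of_int k / L"] show ?thesis
    by (simp add: per_exp_def[abs_def])
qed

lemma continuous_per_exp [continuous_intros]: "continuous_on S (per_exp L k)"
  by (rule has_derivative_continuous_on[OF per_exp_has_vector_derivative[unfolded has_vector_derivative_def]])

lemma borel_measurable_per_exp [measurable]: "per_exp L k \<in> borel_measurable borel"
  using borel_measurable_continuous_onI continuous_per_exp by blast

definition trig_poly :: "real \<Rightarrow> (real \<Rightarrow> complex) \<Rightarrow> bool" where
  "trig_poly L P \<longleftrightarrow> (\<exists>K c. finite K \<and> P = (\<lambda>x. \<Sum>k\<in>K. c k * per_exp L k x))"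

lemma trig_poly_monomial: "trig_poly L (\<lambda>x. a * per_exp L k x)"
  unfolding trig_poly_def by (intro exI[of _ "{k}"] exI[of _ "\<lambda>_. a"]) auto

lemma trig_poly_const: "trig_poly L (\<lambda>x. a)"
  using trig_poly_monomial[of L a 0] by simp

lemma trig_poly_add:
  assumes "trig_poly L P" "trig_poly L Q"
  shows "trig_poly L (\<lambda>x. P x + Q x)"
proof -
  obtain K c where K: "finite K" "P = (\<lambda>x. \<Sum>k\<in>K. c k * per_exp L k x)"
    using assms(1) unfolding trig_poly_def by blast
  obtain J d where J: "finite J" "Q = (\<lambda>x. \<Sum>k\<in>J. d k * per_exp L k x)"
    using assms(2) unfolding trig_poly_def by blast
  define a where "a k = (if k \<in> K then c k else 0) + (if k \<in> J then d k else 0)" for k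
  have "(\<Sum>k\<in>K \<union> J. a k * per_exp L k x) = P x + Q x" for x
  proof -
    have "(\<Sum>k\<in>K \<union> J. a k * per_exp L k x) =
      (\<Sum>k\<in>K \<union> J. if k \<in> K then c k * per_exp L k x else 0)
      + (\<Sum>k\<in>K \<union> J. if k \<in> J then d k * per_exp L k x else 0)"
      unfolding sum.distrib[symmetric] a_def by (intro sum.cong) (auto simp: distrib_right)
    also have "\<dots> = (\<Sum>k\<in>K. c k * per_exp L k x) + (\<Sum>k\<in>J. d k * per_exp L k x)"
      using K(1) J(1) by (intro arg_cong2[of _ _ _ _ "(+)"] sum.mono_neutral_cong_right) auto
    finally show ?thesis
      using K(2) J(2) by simp
  qed
  then show ?thesis
    unfolding trig_poly_def using K(1) J(1)
    by (intro exI[of _ "K \<union> J"] exI[of _ a]) auto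
qed

lemma trig_poly_sum:
  "finite I \<Longrightarrow> (\<And>i. i \<in> I \<Longrightarrow> trig_poly L (P i)) \<Longrightarrow> trig_poly L (\<lambda>x. \<Sum>i\<in>I. P i x)"
  by (induction I rule: finite_induct) (auto intro: trig_poly_const trig_poly_add)

lemma trig_poly_mult:
  assumes "trig_poly L P" "trig_poly L Q"
  shows "trig_poly L (\<lambda>x. P x * Q x)"
proof -
  obtain K c where K: "finite K" "P = (\<lambda>x. \<Sum>k\<in>K. c k * per_exp L k x)"
    using assms(1) unfolding trig_poly_def by blast
  obtain J d where J: "finite J" "Q = (\<lambda>x. \<Sum>k\<in>J. d k * per_exp L k x)"
    using assms(2) unfolding trig_poly_def by blast
  have "P x * Q x = (\<Sum>j\<in>J. \<Sum>k\<in>K. (c k * d j) * per_exp L (k + j) x)" for x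
    by (simp add: K(2) J(2) sum_product per_exp_mult[symmetric] sum.swap[of _ J K] algebra_simps)
  then show ?thesis
    by (auto intro!: trig_poly_sum trig_poly_monomial K J)
qed

text \<open>A real polynomial on the plane is a polynomial in z and its conjugate, and on the circle
  these are the exponentials with index 1 and -1.\<close>

lemma trig_poly_real_polynomial:
  assumes "real_polynomial_function (p :: complex \<Rightarrow> real)"
  shows "trig_poly L (\<lambda>x. of_real (p (per_exp L 1 x)))"
  using assms
proof (induction p rule: real_polynomial_function.induct)
  case (linear f)
  have f: "f z = Re z * f 1 + Im z * f \<i>" for z
  proof -
    have "z = Re z *\<^sub>R 1 + Im z *\<^sub>R \<i>" by (simp add: complex_eq_iff)
    then have "f z = f (Re z *\<^sub>R 1 + Im z *\<^sub>R \<i>)" by simp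
    then show ?thesis
      using linear by (simp add: linear_simps bounded_linear.linear)
  qed
  have f2: "of_real (f z) = (of_real (f 1) / 2 - \<i> * of_real (f \<i>) / 2) * z
      + (of_real (f 1) / 2 + \<i> * of_real (f \<i>) / 2) * cnj z" for z
    by (subst f) (simp add: complex_eq_iff field_simps)
  have "(\<lambda>x. complex_of_real (f (per_exp L 1 x))) =
      (\<lambda>x. (of_real (f 1) / 2 - \<i> * of_real (f \<i>) / 2) * per_exp L 1 x
      + (of_real (f 1) / 2 + \<i> * of_real (f \<i>) / 2) * per_exp L (-1) x)"
    by (rule ext) (subst f2, simp add: cnj_per_exp)
  then show ?case
    using trig_poly_add[OF trig_poly_monomial trig_poly_monomial] by metis
qed (auto intro: trig_poly_const trig_poly_add trig_poly_mult)

lemma circle_param: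
  assumes "L > 0" "z \<in> sphere (0::complex) 1"
  shows "\<exists>x\<in>{0..<L}. per_exp L 1 x = z"
proof -
  have "z = cis (Arg2pi z)"
    using assms(2) by (metis Arg2pi_eq cis_conv_exp dist_0_norm mem_sphere mult_1 of_real_1)
  moreover have "0 \<le> Arg2pi z" "Arg2pi z < 2 * pi"
    using Arg2pi[of z] by auto
  ultimately show ?thesis
    using assms(1)
    by (intro bexI[of _ "L * Arg2pi z / (2 * pi)"]) (auto simp: per_exp_def field_simps)
qed

lemma per_exp_inj:
  assumes "L > 0" "x \<in> {0..L}" "y \<in> {0..<L}" "per_exp L 1 x = per_exp L 1 y"
  shows "x = y \<or> (x = L \<and> y = 0)"
proof -
  have "sin (2 * pi * x / L) = sin (2 * pi * y / L) \<and> cos (2 * pi * x / L) = cos (2 * pi * y / L)"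
    using assms(4) by (auto simp: per_exp_def complex_eq_iff)
  then obtain n :: int where n: "2 * pi * x / L = 2 * pi * y / L + 2 * pi * n"
    by (metis sin_cos_eq_iff)
  then have "pi * x = pi * (y + n * L)"
    using assms(1) by (simp add: field_simps)
  then have e: "x = y + n * L"
    by simp
  have "-1 * L < n * L" "n * L \<le> 1 * L" using e assms(2,3) by (simp_all only: atLeastAtMost_iff atLeastLessThan_iff) linarith+
  then have "-1 < real_of_int n" "real_of_int n \<le> 1"
    using assms(1) by (metis mult_less_cancel_right_pos mult_le_cancel_right_pos)+
  then have "n = 0 \<or> n = 1" by linarith
  then show ?thesis using e assms(2,3) by auto
qed

text \<open>Equal endpoint values let \<open>Y\<close> descend to a function \<open>F\<close> on the
  circle, where the Stone-Weierstrass theorem applies. Continuity of \<open>F\<close> is checked on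
  closed sets: their preimages are images under \<open>per_exp L 1\<close> of compact subsets of the
  window.\<close>

lemma trig_approx:
  fixes Y :: "real \<Rightarrow> real"
  assumes L: "L > 0" and Y: "continuous_on {0..L} Y" "Y 0 = Y L" and e: "e > 0"
  obtains P where "trig_poly L P" "\<And>x. x \<in> {0..L} \<Longrightarrow> cmod (of_real (Y x) - P x) < e"
proof -
  let ?S = "sphere (0::complex) 1" and ?E = "per_exp L 1"
  define F where "F z = Y (SOME x. x \<in> {0..<L} \<and> ?E x = z)" for z
  have some: "(SOME x. x \<in> {0..<L} \<and> ?E x = z) \<in> {0..<L} \<and> ?E (SOME x. x \<in> {0..<L} \<and> ?E x = z) = z"
    if "z \<in> ?S" for z
    using someI_ex[of "\<lambda>x. x \<in> {0..<L} \<and> ?E x = z"] circle_param[OF L that] by blast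
  have E: "?E x \<in> ?S" for x
    by simp
  have FE: "F (?E x) = Y x" if "x \<in> {0..L}" for x
    using per_exp_inj[OF L that, of "SOME y. y \<in> {0..<L} \<and> ?E y = ?E x"] some[OF E[of x]] Y(2)
    unfolding F_def by force
  have "continuous_on ?S F"
    unfolding continuous_on_closed_invariant
  proof (intro allI impI)
    fix B :: "real set" assume "closed B"
    let ?A = "?E ` ({0..L} \<inter> Y -` B)"
    have "closed ({0..L} \<inter> Y -` B)"
      using \<open>closed B\<close> Y(1) by (simp add: continuous_on_closed_vimage Int_commute)
    then have "compact ({0..L} \<inter> Y -` B)"
      by (metis compact_Icc compact_Int_closed inf.absorb2 inf_le1)
    then have "closed ?A"
      by (intro compact_imp_closed compact_continuous_image continuous_per_exp)
    moreover have "?A \<inter> ?S = F -` B \<inter> ?S"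
    proof (intro set_eqI iffI)
      fix z assume "z \<in> ?A \<inter> ?S" then show "z \<in> F -` B \<inter> ?S" using FE by auto
    next
      fix z assume z: "z \<in> F -` B \<inter> ?S"
      then obtain x where "x \<in> {0..<L}" "?E x = z" using circle_param[OF L] by blast
      then show "z \<in> ?A \<inter> ?S" using z FE[of x] by (auto intro!: image_eqI[of _ _ x])
    qed
    ultimately show "\<exists>A. closed A \<and> A \<inter> ?S = F -` B \<inter> ?S" by blast
  qed
  then obtain p where p: "real_polynomial_function p" "\<And>z. z \<in> ?S \<Longrightarrow> \<bar>F z - p z\<bar> < e"
    using Stone_Weierstrass_real_polynomial_function[OF compact_sphere _ e] by metis
  show ?thesis
  proof
    show "trig_poly L (\<lambda>x. of_real (p (?E x)))"
      by (rule trig_poly_real_polynomial[OF p(1)])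
    show "cmod (of_real (Y x) - of_real (p (?E x))) < e" if "x \<in> {0..L}" for x
      using p(2)[OF E[of x]] FE[OF that] by (simp flip: of_real_diff)
  qed
qed

lemma trig_poly_continuous: "trig_poly L P \<Longrightarrow> continuous_on S P"
  unfolding trig_poly_def by (auto intro!: continuous_intros)

section \<open>Integration over one period\<close>

abbreviation per_M :: "real \<Rightarrow> real measure" where
  "per_M L \<equiv> restrict_space lborel {0..L}"

lemma space_per_M [simp]: "space (per_M L) = {0..L}"
  by (simp add: space_restrict_space)

lemma set_integrable_per_M:
  fixes u :: "real \<Rightarrow> 'a::{banach,second_countable_topology}"
  shows "set_integrable lborel {0..L} u \<longleftrightarrow> integrable (per_M L) u"
  by (simp add: set_integrable_def integrable_restrict_space)

lemma set_integral_per_M: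
  fixes u :: "real \<Rightarrow> 'a::{banach,second_countable_topology}"
  shows "(LINT x:{0..L}|lborel. u x) = (LINT x|per_M L. u x)"
  by (simp add: set_lebesgue_integral_def integral_restrict_space)

lemma AE_per_M: "AE x in lborel. P x \<Longrightarrow> AE x in per_M L. P x"
  by (subst AE_restrict_space_iff) auto

lemma borel_measurable_per_M: "Y \<in> borel_measurable borel \<Longrightarrow> Y \<in> borel_measurable (per_M L)"
  by (simp add: measurable_restrict_space1)

lemma continuous_measurable_per_M:
  "continuous_on {0..L} Y \<Longrightarrow> Y \<in> borel_measurable (per_M L)"
  using borel_measurable_continuous_on_restrict[of "{0..L}" Y]
  by (simp add: measurable_def sets_restrict_space space_restrict_space)

lemma integral_per_M:
  fixes Y :: "real \<Rightarrow> 'a::euclidean_space"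
  assumes "continuous_on {0..L} Y"
  shows "integrable (per_M L) Y" "(LINT x|per_M L. Y x) = integral {0..L} Y"
proof -
  have "set_integrable lborel {0..L} Y"
    by (rule borel_integrable_atLeastAtMost'[OF assms])
  then show "integrable (per_M L) Y" "(LINT x|per_M L. Y x) = integral {0..L} Y"
    using set_borel_integral_eq_integral(2)[of "{0..L}" Y]
    by (simp_all add: set_integrable_per_M set_integral_per_M)
qed

lemma integrable_mult_continuous:
  fixes h Y :: "real \<Rightarrow> 'a::{real_normed_field,banach,second_countable_topology}"
  assumes "integrable (per_M L) h" "continuous_on {0..L} Y"
  shows "integrable (per_M L) (\<lambda>x. h x * Y x)"
proof -
  obtain B where B: "\<And>x. x \<in> {0..L} \<Longrightarrow> norm (Y x) \<le> B"
    using compact_imp_bounded[OF compact_continuous_image[OF assms(2) compact_Icc]]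
    unfolding bounded_iff by (meson image_eqI)
  show ?thesis
  proof (rule Bochner_Integration.integrable_bound)
    show "integrable (per_M L) (\<lambda>x. of_real B * h x)"
      using assms(1) by simp
    show "(\<lambda>x. h x * Y x) \<in> borel_measurable (per_M L)"
      using assms(1) continuous_measurable_per_M[OF assms(2)] by measurable
    show "AE x in per_M L. norm (h x * Y x) \<le> norm (of_real B * h x)"
    proof (rule AE_I2)
      fix x assume "x \<in> space (per_M L)"
      then have "norm (Y x) \<le> \<bar>B\<bar>" using B[of x] by auto
      then show "norm (h x * Y x) \<le> norm (of_real B * h x)"
        by (simp add: norm_mult mult.commute[of "norm (h x)"] mult_right_mono)
    qed
  qed
qed

lemma integral_trig_monomial:
  assumes "L > 0"
  shows "(LINT x|per_M L. per_exp L k x) = (if k = 0 then complex_of_real L else 0)"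
proof (cases "k = 0")
  case True
  then show ?thesis using assms integral_per_M(2)[of L "\<lambda>_. 1::complex"] by (simp add: scaleR_conv_of_real)
next
  case False
  have "((\<lambda>x. (2 * pi * of_int k / L) *\<^sub>R (\<i> * per_exp L k x)) has_integral (per_exp L k L - per_exp L k 0)) {0..L}"
    using assms by (intro fundamental_theorem_of_calculus per_exp_has_vector_derivative) auto
  then have "((\<lambda>x. (2 * pi * of_int k / L) *\<^sub>R (\<i> * per_exp L k x)) has_integral 0) {0..L}"
    using assms by (simp add: per_exp_at_period)
  then have "integral {0..L} (\<lambda>x. (2 * pi * of_int k / L) *\<^sub>R (\<i> * per_exp L k x)) = 0"
    by (rule integral_unique)
  moreover have "integral {0..L} (\<lambda>x. (2 * pi * of_int k / L) *\<^sub>R (\<i> * per_exp L k x))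
      = (2 * pi * of_int k / L) *\<^sub>R (\<i> * integral {0..L} (per_exp L k))"
    by simp
  ultimately show ?thesis using False assms integral_per_M(2)[OF continuous_per_exp, of L L k] by auto
qed

lemma integral_trig_poly_mult:
  assumes "integrable (per_M L) h"
  shows "(LINT x|per_M L. h x * (\<Sum>k\<in>K. c k * per_exp L k x))
    = (\<Sum>k\<in>K. c k * (LINT x|per_M L. h x * per_exp L k x))"
proof -
  have "(LINT x|per_M L. h x * (\<Sum>k\<in>K. c k * per_exp L k x))
     = (LINT x|per_M L. (\<Sum>k\<in>K. c k * (h x * per_exp L k x)))"
    by (simp add: sum_distrib_left mult_ac)
  also have "\<dots> = (\<Sum>k\<in>K. LINT x|per_M L. c k * (h x * per_exp L k x))"
    by (intro Bochner_Integration.integral_sum integrable_mult_right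
        integrable_mult_continuous assms continuous_per_exp)
  finally show ?thesis by simp
qed

section \<open>Fourier uniqueness, duality and Bessel's inequality\<close>

lemma fourier_coeff_per_M:
  "fourier_coeff L u k = (LINT x|per_M L. of_real (u x) * per_exp L (- k) x) / of_real L"
  unfolding fourier_coeff_def set_integral_per_M cis_minus_per_exp ..

lemma measure_per_M: "L > 0 \<Longrightarrow> measure (per_M L) {0..L} = L"
  by (simp add: measure_restrict_space)

text \<open>Continuous functions converging almost everywhere to sgn h turn orthogonality into a
  vanishing integral of |h|, by dominated convergence.\<close>

lemma AE_zero_if_orthogonal:
  fixes h :: "real \<Rightarrow> real"
  assumes L: "L > 0" and h: "integrable (per_M L) h"
    and orth: "\<And>Y. continuous_on {0..L} Y \<Longrightarrow> Y 0 = Y L \<Longrightarrow> (LINT x|per_M L. h x * Y x) = 0"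
  shows "AE x in per_M L. h x = 0"
proof -
  let ?s = "\<lambda>x. indicator {0..L} x *\<^sub>R sgn (h x)"
  have hm: "h \<in> borel_measurable (per_M L)"
    using h by simp
  have "(\<lambda>x. sgn (h x)) \<in> borel_measurable (per_M L)"
    using hm by simp
  then have "?s \<in> borel_measurable lborel"
    by (subst (asm) borel_measurable_restrict_space_iff) auto
  then have "?s \<in> borel_measurable (lebesgue_on UNIV)"
    by (intro measurable_restrict_space1 measurable_completion)
  then have "?s measurable_on UNIV"
    by (subst measurable_on_iff_borel_measurable) auto
  then obtain N g where N: "negligible N" and g: "\<And>n. continuous_on UNIV (g n)"
    and lim: "\<And>x. x \<notin> N \<Longrightarrow> (\<lambda>n. g n x) \<longlonglongrightarrow> ?s x"
    unfolding measurable_on_def by auto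
  \<comment> \<open>Clipping to [-1, 1] provides the dominating function |h|. The second factor
    vanishes at both ends, so that \<open>Y n\<close> is an admissible test function, and tends to 1
    at every interior point.\<close>
  define Y where "Y n x = max (-1) (min 1 (g n x)) * min 1 (real n * (x * (L - x)))" for n x
  have Yc: "continuous_on {0..L} (Y n)" for n
    unfolding Y_def
    by (intro continuous_intros continuous_on_max continuous_on_min continuous_on_subset[OF g]) auto
  have "(\<lambda>n. LINT x|per_M L. h x * Y n x) \<longlonglongrightarrow> (LINT x|per_M L. \<bar>h x\<bar>)"
  proof (rule integral_dominated_convergence[where w = "\<lambda>x. \<bar>h x\<bar>"])
    show "(\<lambda>x. h x * Y n x) \<in> borel_measurable (per_M L)" for n
      using hm continuous_measurable_per_M[OF Yc] by measurable
    show "AE x in per_M L. norm (h x * Y n x) \<le> \<bar>h x\<bar>" for n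
    proof (rule AE_I2)
      fix x assume "x \<in> space (per_M L)"
      then have "0 \<le> min 1 (real n * (x * (L - x)))" by simp
      then have "\<bar>Y n x\<bar> \<le> 1 * 1"
        unfolding Y_def abs_mult by (intro mult_mono) auto
      then show "norm (h x * Y n x) \<le> \<bar>h x\<bar>"
        by (simp add: abs_mult mult_left_le)
    qed
    have "AE x in lborel. x \<notin> N"
    proof -
      have "AE x in lebesgue. x \<notin> N"
        using N by (simp add: negligible_iff_null_sets AE_not_in)
      then show ?thesis by (simp add: AE_completion_iff)
    qed
    then have "AE x in lborel. x \<notin> N \<and> x \<noteq> 0 \<and> x \<noteq> L"
      using AE_lborel_singleton[of 0] AE_lborel_singleton[of L] by eventually_elim auto
    then have "AE x in per_M L. x \<notin> N \<and> x \<noteq> 0 \<and> x \<noteq> L"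
      by (rule AE_per_M)
    then show "AE x in per_M L. (\<lambda>n. h x * Y n x) \<longlonglongrightarrow> \<bar>h x\<bar>"
    proof (rule AE_mp, intro AE_I2 impI)
      fix x assume "x \<in> space (per_M L)" and x: "x \<notin> N \<and> x \<noteq> 0 \<and> x \<noteq> L"
      then have x': "0 < x" "x < L" by auto
      then have p: "x * (L - x) > 0" by simp
      have "eventually (\<lambda>n. min 1 (real n * (x * (L - x))) = 1) sequentially"
      proof -
        have "filterlim (\<lambda>n. real n * (x * (L - x))) at_top sequentially"
          using p by (intro filterlim_at_top_mult_tendsto_pos[OF tendsto_const _ filterlim_real_sequentially,
             of "x * (L - x)", simplified mult.commute]) auto
        then show ?thesis
          unfolding filterlim_at_top by (auto elim!: eventually_mono dest: spec[of _ 1])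
      qed
      then have 1: "(\<lambda>n. min 1 (real n * (x * (L - x)))) \<longlonglongrightarrow> 1"
        by (rule tendsto_eventually)
      have "(\<lambda>n. max (-1) (min 1 (g n x))) \<longlonglongrightarrow> max (-1) (min 1 (sgn (h x)))"
        using lim[of x] x x' by (intro tendsto_intros) auto
      moreover have "max (-1) (min 1 (sgn (h x))) = sgn (h x)"
        by (auto simp: sgn_if)
      ultimately have "(\<lambda>n. h x * Y n x) \<longlonglongrightarrow> h x * (sgn (h x) * 1)"
        unfolding Y_def using 1 by (intro tendsto_intros) auto
      then show "(\<lambda>n. h x * Y n x) \<longlonglongrightarrow> \<bar>h x\<bar>"
        by (simp add: abs_sgn)
    qed
  qed (use hm h in auto)
  moreover have "(LINT x|per_M L. h x * Y n x) = 0" for n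
    using L by (intro orth Yc) (simp add: Y_def)
  ultimately have "(LINT x|per_M L. \<bar>h x\<bar>) = 0"
    using LIMSEQ_const_iff[of 0 "LINT x|per_M L. \<bar>h x\<bar>"] by simp
  then show ?thesis
    using integral_nonneg_eq_0_iff_AE[of "per_M L" "\<lambda>x. \<bar>h x\<bar>"] h by simp
qed

lemma integral_abs_mult_bound:
  fixes h :: "real \<Rightarrow> 'a::{real_normed_field,banach,second_countable_topology}"
  assumes h: "integrable (per_M L) h" and Y: "continuous_on {0..L} Y"
    and B: "\<And>x. x \<in> {0..L} \<Longrightarrow> norm (Y x) \<le> B"
  shows "norm (LINT x|per_M L. h x * Y x) \<le> B * (LINT x|per_M L. norm (h x))"
proof -
  have "norm (LINT x|per_M L. h x * Y x) \<le> (LINT x|per_M L. norm (h x * Y x))"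
    by (rule integral_norm_bound)
  also have "\<dots> \<le> (LINT x|per_M L. B * norm (h x))"
    using integrable_norm[OF integrable_mult_continuous[OF h Y]] integrable_norm[OF h]
    by (intro integral_mono) (auto simp: norm_mult mult.commute[of B] intro!: mult_left_mono B)
  finally show ?thesis by simp
qed

text \<open>Replacing the test function by a uniform approximation costs at most \<open>e\<close>
  times the L^1 norm of \<open>h\<close>; each use of \<open>trig_approx\<close> below is paid for
  by this estimate.\<close>

lemma integral_near_trig_poly:
  fixes h Y :: "real \<Rightarrow> real"
  assumes h: "integrable (per_M L) h" and Y: "continuous_on {0..L} Y" and P: "trig_poly L P"
    and near: "\<And>x. x \<in> {0..L} \<Longrightarrow> cmod (of_real (Y x) - P x) \<le> e"
  shows "cmod (of_real (LINT x|per_M L. h x * Y x) - (LINT x|per_M L. of_real (h x) * P x))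
    \<le> e * (LINT x|per_M L. \<bar>h x\<bar>)"
proof -
  have hc: "integrable (per_M L) (\<lambda>x. complex_of_real (h x))"
    using h by simp
  have Yc: "continuous_on {0..L} (\<lambda>x. complex_of_real (Y x))"
    using Y by (intro continuous_intros)
  have "of_real (LINT x|per_M L. h x * Y x) - (LINT x|per_M L. of_real (h x) * P x)
      = (LINT x|per_M L. of_real (h x) * (of_real (Y x) - P x))"
    unfolding integral_complex_of_real[symmetric] right_diff_distrib of_real_mult
    by (intro Bochner_Integration.integral_diff[symmetric] integrable_mult_continuous hc Yc
        trig_poly_continuous[OF P])
  also have "cmod \<dots> \<le> e * (LINT x|per_M L. cmod (of_real (h x)))"
    using near by (intro integral_abs_mult_bound hc continuous_intros Yc trig_poly_continuous[OF P])
  finally show ?thesis by simp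
qed

text \<open>The passage e \<rightarrow> 0 that ends the density arguments; \<open>c\<close> may have
  any sign, hence the step e / (|c| + 1).\<close>

lemma small_multiple_imp_zero:
  fixes a c :: real
  assumes "\<And>e. e > 0 \<Longrightarrow> a \<le> b + e * c"
  shows "a \<le> b"
proof (rule field_le_epsilon)
  fix e :: real assume e: "e > 0"
  have "a \<le> b + (e / (\<bar>c\<bar> + 1)) * c"
    using e by (intro assms) auto
  also have "(e / (\<bar>c\<bar> + 1)) * c \<le> (e / (\<bar>c\<bar> + 1)) * (\<bar>c\<bar> + 1)"
    using e by (intro mult_left_mono) auto
  also have "\<dots> = e" by simp
  finally show "a \<le> b + e" by simp
qed

text \<open>Vanishing coefficients make \<open>h\<close> orthogonal to trigonometric polynomials,
  hence by uniform density to all continuous periodic functions. Integrability suffices, which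
  matters because weak derivatives are only known to be in L^1.\<close>

theorem fourier_unique:
  fixes h :: "real \<Rightarrow> real"
  assumes L: "L > 0" and h: "integrable (per_M L) h"
    and zero: "\<And>k. (LINT x|per_M L. of_real (h x) * per_exp L k x) = 0"
  shows "AE x in per_M L. h x = 0"
proof (rule AE_zero_if_orthogonal[OF L h])
  fix Y :: "real \<Rightarrow> real" assume Y: "continuous_on {0..L} Y" "Y 0 = Y L"
  have "\<bar>LINT x|per_M L. h x * Y x\<bar> \<le> 0 + e * (LINT x|per_M L. \<bar>h x\<bar>)" if e: "e > 0" for e
  proof -
    obtain P where P: "trig_poly L P" "\<And>x. x \<in> {0..L} \<Longrightarrow> cmod (of_real (Y x) - P x) < e"
      using trig_approx[OF L Y e] by blast
    obtain K c where K: "finite K" "P = (\<lambda>x. \<Sum>k\<in>K. c k * per_exp L k x)"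
      using P(1) unfolding trig_poly_def by blast
    have "(LINT x|per_M L. of_real (h x) * P x) = 0"
      unfolding K(2) using h by (subst integral_trig_poly_mult) (auto simp: zero)
    then show ?thesis
      using integral_near_trig_poly[OF h Y(1) P(1), of e] P(2) by (force simp: less_imp_le)
  qed
  then have "\<bar>LINT x|per_M L. h x * Y x\<bar> \<le> 0"
    by (rule small_multiple_imp_zero)
  then show "(LINT x|per_M L. h x * Y x) = 0" by simp
qed

lemma trig_poly_parseval:
  assumes L: "L > 0" and K: "finite K"
  shows "(LINT x|per_M L. (cmod (\<Sum>k\<in>K. c k * per_exp L k x))\<^sup>2) = L * (\<Sum>k\<in>K. (cmod (c k))\<^sup>2)"
proof -
  let ?P = "\<lambda>x. \<Sum>k\<in>K. c k * per_exp L k x"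
  have cont: "continuous_on {0..L} (\<lambda>x. cnj (?P x))"
    by (intro continuous_intros)
  have *: "(LINT x|per_M L. cnj (?P x) * per_exp L k x) = cnj (c k) * L" if "k \<in> K" for k
  proof -
    have "(LINT x|per_M L. cnj (?P x) * per_exp L k x)
       = (LINT x|per_M L. (\<Sum>j\<in>K. cnj (c j) * per_exp L (k - j) x))"
      by (simp add: sum_distrib_right cnj_per_exp mult.assoc per_exp_mult)
    also have "\<dots> = (\<Sum>j\<in>K. LINT x|per_M L. cnj (c j) * per_exp L (k - j) x)"
      by (intro Bochner_Integration.integral_sum integral_per_M(1) continuous_intros)
    also have "\<dots> = (\<Sum>j\<in>K. if k = j then cnj (c j) * L else 0)"
      by (intro sum.cong) (auto simp: integral_trig_monomial[OF L])
    also have "\<dots> = cnj (c k) * L" using K that by simp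
    finally show ?thesis .
  qed
  have "of_real (LINT x|per_M L. (cmod (?P x))\<^sup>2) = (LINT x|per_M L. cnj (?P x) * ?P x)"
    unfolding integral_complex_of_real[symmetric]
    by (intro Bochner_Integration.integral_cong refl) (subst complex_norm_square, rule mult.commute)
  also have "\<dots> = (\<Sum>k\<in>K. c k * (LINT x|per_M L. cnj (?P x) * per_exp L k x))"
    by (intro integral_trig_poly_mult integral_per_M(1) cont)
  also have "\<dots> = (\<Sum>k\<in>K. c k * (cnj (c k) * L))"
    by (intro sum.cong refl) (simp only: *)
  also have "\<dots> = (\<Sum>k\<in>K. of_real (L * (cmod (c k))\<^sup>2))"
    by (intro sum.cong refl) (simp add: complex_norm_square mult_ac del: of_real_power)
  finally show ?thesis
    by (simp add: sum_distrib_left flip: of_real_sum del: of_real_mult of_real_power)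
qed

lemma Hs_per_integrable: "u \<in> Hs_per s L \<Longrightarrow> integrable (per_M L) u"
  by (simp add: Hs_per_def L1_per_def set_integrable_per_M)

lemma L1_per_integrable: "u \<in> L1_per L \<Longrightarrow> integrable (per_M L) u"
  by (simp add: L1_per_def set_integrable_per_M)

lemma one_plus_square_pos: "1 + \<bar>real_of_int k\<bar>\<^sup>2 > 0"
  by (simp add: add_pos_nonneg)

lemma Hs_norm_nonneg: "L > 0 \<Longrightarrow> Hs_norm s L u \<ge> 0"
  unfolding Hs_norm_def by (auto intro!: infsum_nonneg mult_nonneg_nonneg)

text \<open>Cauchy-Schwarz for a norm that is defined by coefficients. Parseval is applied only to a
  trigonometric polynomial near \<open>Y\<close>, whose coefficients have l^2 norm at most B + e;
  the coefficients of \<open>h\<close> enter through finite partial sums.\<close>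

theorem integral_le_Hs0_norm:
  fixes h Y :: "real \<Rightarrow> real"
  assumes L: "L > 0" and h: "h \<in> Hs_per 0 L"
    and Y: "continuous_on {0..L} Y" "Y 0 = Y L" and B: "\<And>x. x \<in> {0..L} \<Longrightarrow> \<bar>Y x\<bar> \<le> B"
  shows "\<bar>LINT x|per_M L. h x * Y x\<bar> \<le> sqrt L * B * Hs_norm 0 L h"
proof -
  note hi = Hs_per_integrable[OF h]
  define S where "S = (\<Sum>\<^sub>\<infinity>k::int. (cmod (fourier_coeff L h k))\<^sup>2)"
  \<comment> \<open>The weight with exponent 0 equals 1 only for a nonzero base, since
    \<open>0 powr 0 = 0\<close>.\<close>
  have nz: "1 + (real_of_int k)\<^sup>2 \<noteq> 0" for k
    using one_plus_square_pos[of k] by simp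
  have sm: "(\<lambda>k::int. (cmod (fourier_coeff L h k))\<^sup>2) summable_on UNIV"
    using h by (simp add: Hs_per_def nz)
  have N: "Hs_norm 0 L h = sqrt (L * S)"
    by (simp add: Hs_norm_def S_def nz)
  have S0: "S \<ge> 0" unfolding S_def by (intro infsum_nonneg) auto
  have B0: "B \<ge> 0" using B[of 0] L by (simp add: order_trans[OF abs_ge_zero])
  have "\<bar>LINT x|per_M L. h x * Y x\<bar>
    \<le> sqrt L * B * Hs_norm 0 L h + e * (sqrt L * Hs_norm 0 L h + (LINT x|per_M L. \<bar>h x\<bar>))"
    if e: "e > 0" for e
  proof -
    obtain P where P: "trig_poly L P" "\<And>x. x \<in> {0..L} \<Longrightarrow> cmod (of_real (Y x) - P x) < e"
      using trig_approx[OF L Y e] by blast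
    obtain K c where K: "finite K" "P = (\<lambda>x. \<Sum>k\<in>K. c k * per_exp L k x)"
      using P(1) unfolding trig_poly_def by blast
    have Pb: "cmod (P x) \<le> B + e" if "x \<in> {0..L}" for x
      using B[OF that] P(2)[OF that] norm_triangle_sub[of "P x" "of_real (Y x)"]
      by (simp add: norm_minus_commute)
    have "L * (\<Sum>k\<in>K. (cmod (c k))\<^sup>2) = (LINT x|per_M L. (cmod (P x))\<^sup>2)"
      unfolding K(2) by (rule trig_poly_parseval[OF L K(1), symmetric])
    also have "\<dots> \<le> (LINT x|per_M L. (B + e)\<^sup>2)"
      using trig_poly_continuous[OF P(1)] Pb
      by (intro integral_mono integral_per_M(1) continuous_intros power_mono) auto
    also have "\<dots> = L * (B + e)\<^sup>2"
      using L integral_per_M(2)[of L "\<lambda>_. (B + e)\<^sup>2"] by simp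
    finally have "(\<Sum>k\<in>K. (cmod (c k))\<^sup>2) \<le> (B + e)\<^sup>2"
      using L by simp
    then have c: "L2_set (\<lambda>k. cmod (c k)) K \<le> B + e"
      unfolding L2_set_def using B0 e by (simp add: real_le_lsqrt)
    \<comment> \<open>The index is reflected because pairing with \<open>per_exp L k\<close>
      produces the coefficient at -k.\<close>
    have "(\<Sum>k\<in>K. (cmod (fourier_coeff L h (- k)))\<^sup>2) = (\<Sum>k\<in>uminus ` K. (cmod (fourier_coeff L h k))\<^sup>2)"
      by (subst sum.reindex) (auto simp: inj_on_def)
    also have "\<dots> \<le> S"
      unfolding S_def using K(1) by (intro finite_sum_le_infsum sm) auto
    finally have d: "L2_set (\<lambda>k. cmod (fourier_coeff L h (- k))) K \<le> sqrt S"
      unfolding L2_set_def by simp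
    have "(LINT x|per_M L. of_real (h x) * P x) = (\<Sum>k\<in>K. c k * (of_real L * fourier_coeff L h (- k)))"
      unfolding K(2) using hi L by (subst integral_trig_poly_mult) (auto simp: fourier_coeff_per_M)
    also have "cmod \<dots> \<le> (\<Sum>k\<in>K. cmod (c k * (of_real L * fourier_coeff L h (- k))))"
      by (rule norm_sum)
    also have "\<dots> = L * (\<Sum>k\<in>K. \<bar>cmod (c k)\<bar> * \<bar>cmod (fourier_coeff L h (- k))\<bar>)"
      using L by (simp add: norm_mult sum_distrib_left mult_ac)
    also have "\<dots> \<le> L * (L2_set (\<lambda>k. cmod (c k)) K * L2_set (\<lambda>k. cmod (fourier_coeff L h (- k))) K)"
      using L by (intro mult_left_mono L2_set_mult_ineq) auto
    also have "\<dots> \<le> L * ((B + e) * sqrt S)"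
      using L c d B0 e by (intro mult_left_mono mult_mono) auto
    also have "\<dots> = sqrt L * (B + e) * Hs_norm 0 L h"
      using L by (simp add: N real_sqrt_mult)
    finally have "cmod (LINT x|per_M L. of_real (h x) * P x) \<le> sqrt L * (B + e) * Hs_norm 0 L h" .
    moreover have "\<bar>LINT x|per_M L. h x * Y x\<bar> \<le> cmod (LINT x|per_M L. of_real (h x) * P x)
       + e * (LINT x|per_M L. \<bar>h x\<bar>)"
      using integral_near_trig_poly[OF hi Y(1) P(1), of e] P(2)
        norm_triangle_sub[of "of_real (LINT x|per_M L. h x * Y x)" "LINT x|per_M L. of_real (h x) * P x"]
      by (force simp: less_imp_le)
    ultimately show ?thesis by (simp add: algebra_simps)
  qed
  then show ?thesis by (rule small_multiple_imp_zero)
qed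

text \<open>For the partial Fourier sum P, the integral of Re(Y cnj P) and that of |P|^2 are both
  equal to the left-hand side. Integrating 2 Re(Y cnj P) \<le> Y^2 + |P|^2 therefore gives the
  claim.\<close>

theorem bessel:
  fixes Y :: "real \<Rightarrow> real"
  assumes L: "L > 0" and Y: "continuous_on {0..L} Y" and K: "finite K"
  shows "L * (\<Sum>k\<in>K. (cmod (fourier_coeff L Y k))\<^sup>2) \<le> (LINT x|per_M L. (Y x)\<^sup>2)"
proof -
  let ?c = "fourier_coeff L Y"
  let ?P = "\<lambda>x. \<Sum>k\<in>K. ?c k * per_exp L k x"
  have Pc: "continuous_on {0..L} ?P" by (intro continuous_intros)
  have Yi: "integrable (per_M L) (\<lambda>x. complex_of_real (Y x))"
    using integral_per_M(1)[OF Y] by simp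
  have Pcc: "integrable (per_M L) (\<lambda>x. of_real (Y x) * cnj (?P x))"
    by (intro integrable_mult_continuous Yi continuous_intros)
  have "(LINT x|per_M L. of_real (Y x) * cnj (?P x))
      = (LINT x|per_M L. (\<Sum>k\<in>K. cnj (?c k) * (of_real (Y x) * per_exp L (- k) x)))"
    by (simp add: sum_distrib_left cnj_per_exp mult_ac)
  also have "\<dots> = (\<Sum>k\<in>K. LINT x|per_M L. cnj (?c k) * (of_real (Y x) * per_exp L (- k) x))"
    by (intro Bochner_Integration.integral_sum integrable_mult_right
        integrable_mult_continuous Yi continuous_per_exp)
  also have "\<dots> = (\<Sum>k\<in>K. of_real (L * (cmod (?c k))\<^sup>2))"
  proof (intro sum.cong refl)
    fix k
    have "(LINT x|per_M L. cnj (?c k) * (of_real (Y x) * per_exp L (- k) x)) = cnj (?c k) * (of_real L * ?c k)"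
      using L by (simp add: fourier_coeff_per_M[of L Y k])
    then show "(LINT x|per_M L. cnj (?c k) * (of_real (Y x) * per_exp L (- k) x)) = of_real (L * (cmod (?c k))\<^sup>2)"
      by (simp add: complex_norm_square mult_ac del: of_real_power)
  qed
  finally have 1: "Re (LINT x|per_M L. of_real (Y x) * cnj (?P x)) = L * (\<Sum>k\<in>K. (cmod (?c k))\<^sup>2)"
    by (simp add: sum_distrib_left flip: of_real_sum del: of_real_mult of_real_power)
  have pt: "2 * Re (of_real (Y x) * cnj (?P x)) \<le> (Y x)\<^sup>2 + (cmod (?P x))\<^sup>2" for x
  proof -
    have "0 \<le> (Y x - Re (?P x))\<^sup>2 + (Im (?P x))\<^sup>2" by simp
    then show ?thesis unfolding cmod_power2 by (simp add: power2_eq_square algebra_simps)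
  qed
  have i1: "integrable (per_M L) (\<lambda>x. (Y x)\<^sup>2)" "integrable (per_M L) (\<lambda>x. (cmod (?P x))\<^sup>2)"
    by (intro integral_per_M(1) continuous_intros Y)+
  have "2 * (L * (\<Sum>k\<in>K. (cmod (?c k))\<^sup>2)) = (LINT x|per_M L. 2 * Re (of_real (Y x) * cnj (?P x)))"
    using Pcc 1 by (simp del: times_complex.sel cnj_sum Re_sum)
  also have "\<dots> \<le> (LINT x|per_M L. (Y x)\<^sup>2 + (cmod (?P x))\<^sup>2)"
    using pt Pcc i1 by (intro integral_mono Bochner_Integration.integrable_add integrable_mult_right integrable_Re) auto
  also have "\<dots> = (LINT x|per_M L. (Y x)\<^sup>2) + L * (\<Sum>k\<in>K. (cmod (?c k))\<^sup>2)"
    using i1 by (simp add: trig_poly_parseval[OF L K])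
  finally show ?thesis by simp
qed

section \<open>Periodic Sobolev functions and weak derivatives\<close>

lemma integral_deriv_eq_0:
  fixes F :: "real \<Rightarrow> 'a::euclidean_space"
  assumes L: "L > 0" and F: "\<And>x. x \<in> {0..L} \<Longrightarrow> (F has_vector_derivative F' x) (at x)"
    and F': "continuous_on {0..L} F'" and per: "F 0 = F L"
  shows "(LINT x|per_M L. F' x) = 0"
proof -
  have "(F' has_integral (F L - F 0)) {0..L}"
  proof (rule fundamental_theorem_of_calculus)
    show "(F has_vector_derivative F' x) (at x within {0..L})" if "x \<in> {0..L}" for x
      by (rule has_vector_derivative_at_within[OF F[OF that]])
  qed (use L in simp)
  then show ?thesis
    using integral_per_M(2)[OF F'] per by (simp add: integral_unique)
qed

lemma has_real_derivative_continuous_on: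
  fixes H :: "real \<Rightarrow> real"
  assumes "\<And>x. x \<in> S \<Longrightarrow> (H has_real_derivative H' x) (at x)"
  shows "continuous_on S H"
  using assms by (metis DERIV_isCont continuous_at_imp_continuous_on)

text \<open>Integration by parts against an exponential; the equal endpoint values remove the
  boundary term.\<close>

lemma fourier_coeff_deriv:
  assumes L: "L > 0" and H: "\<And>x. x \<in> {0..L} \<Longrightarrow> (H has_real_derivative H' x) (at x)"
    and H': "continuous_on {0..L} H'" and per: "H 0 = H L"
  shows "fourier_coeff L H' k = of_real (2 * pi * of_int k / L) * \<i> * fourier_coeff L H k"
proof -
  let ?w = "2 * pi * of_int k / L"
  let ?e = "per_exp L (- k)"
  have Hc: "continuous_on {0..L} H"
    using H by (rule has_real_derivative_continuous_on)
  let ?F' = "\<lambda>x. complex_of_real (H x) * ((2 * pi * of_int (- k) / L) *\<^sub>R (\<i> * ?e x)) + of_real (H' x) * ?e x"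
  have zero: "(LINT x|per_M L. ?F' x) = 0"
  proof (rule integral_deriv_eq_0[OF L])
    show "((\<lambda>x. complex_of_real (H x) * ?e x) has_vector_derivative ?F' x) (at x)" if "x \<in> {0..L}" for x
      by (intro has_vector_derivative_mult has_vector_derivative_of_real H that per_exp_has_vector_derivative)
    show "continuous_on {0..L} ?F'"
      by (intro continuous_intros H' Hc)
    show "complex_of_real (H 0) * ?e 0 = complex_of_real (H L) * ?e L"
      using L per by (simp add: per_exp_at_period)
  qed
  have F': "?F' = (\<lambda>x. of_real (- ?w) * \<i> * (of_real (H x) * ?e x) + of_real (H' x) * ?e x)"
    by (auto simp: scaleR_conv_of_real algebra_simps)
  have "(LINT x|per_M L. ?F' x) =
      of_real (- ?w) * \<i> * (LINT x|per_M L. of_real (H x) * ?e x) + (LINT x|per_M L. of_real (H' x) * ?e x)"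
    unfolding F'
    by (subst Bochner_Integration.integral_add)
      (simp_all only: integral_mult_right_zero, (intro integrable_mult_right integral_per_M(1) continuous_intros H' Hc)+)
  then have eq: "(LINT x|per_M L. of_real (H' x) * ?e x)
      = of_real ?w * \<i> * (LINT x|per_M L. of_real (H x) * ?e x)"
    unfolding zero of_real_minus mult_minus_left by (simp only: eq_commute[of 0] add_eq_0_iff minus_minus)
  show ?thesis
    unfolding fourier_coeff_per_M eq by (simp only: times_divide_eq_right)
qed

lemma cnj_fourier_coeff: "cnj (fourier_coeff L h k) = fourier_coeff L h (- k)"
proof -
  have "cnj (LINT x|per_M L. of_real (h x) * per_exp L (- k) x) = (LINT x|per_M L. cnj (of_real (h x) * per_exp L (- k) x))"
    by (rule Bochner_Integration.integral_cnj[symmetric])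
  then show ?thesis
    unfolding fourier_coeff_per_M by (simp add: cnj_per_exp)
qed

lemma periodic_deriv:
  assumes "periodic L H" "\<And>x. (H has_real_derivative H' x) (at x)"
  shows "periodic L H'"
  unfolding periodic_def
proof
  fix x
  have "((\<lambda>x. H (x + L)) has_real_derivative H' (x + L)) (at x)"
    using assms(2)[of "x + L"] by (simp add: DERIV_shift)
  moreover have "(\<lambda>x. H (x + L)) = H"
    using assms(1) by (simp add: periodic_def)
  ultimately show "H' (x + L) = H' x"
    using assms(2)[of x] DERIV_unique by metis
qed

lemma continuous_periodic_L1:
  "continuous_on UNIV H \<Longrightarrow> periodic L H \<Longrightarrow> H \<in> L1_per L"
  unfolding L1_per_def set_integrable_per_M
  by (auto intro!: borel_measurable_continuous_onI integral_per_M(1) intro: continuous_on_subset)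

text \<open>Up to a constant the coefficients of H'' are k^2 times those of H, and (1 + k^2)^2 \<le>
  2 + 2 k^4. Bessel's inequality for H and for H'' bounds all partial sums.\<close>

theorem C2_periodic_in_Hs2:
  assumes L: "L > 0" and per: "periodic L H"
    and H: "\<And>x. (H has_real_derivative H' x) (at x)" "\<And>x. (H' has_real_derivative H'' x) (at x)"
    and H'': "continuous_on UNIV H''"
  shows "H \<in> Hs_per 2 L"
proof -
  have perE: "F 0 = F L" if "periodic L F" for F :: "real \<Rightarrow> real"
    using that[unfolded periodic_def, rule_format, of 0] by simp
  have Hc: "continuous_on S H" "continuous_on S H'" "continuous_on S H''" for S
    using H H'' by (auto intro: has_real_derivative_continuous_on continuous_on_subset)
  have ft: "fourier_coeff L H'' k = - of_real ((2 * pi * of_int k / L)\<^sup>2) * fourier_coeff L H k" for k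
    using fourier_coeff_deriv[OF L H(1) Hc(2) perE[OF per], of k]
      fourier_coeff_deriv[OF L H(2) Hc(3) perE[OF periodic_deriv[OF per H(1)]], of k]
    by (simp add: power2_eq_square algebra_simps)
  \<comment> \<open>The constant for which k^4 |c|^2 = a |c''|^2, where c and c'' are the
    coefficients of H and H'' at k.\<close>
  define a where "a = (L / (2 * pi)) ^ 4"
  have term_le: "(1 + \<bar>of_int k\<bar>\<^sup>2) powr 2 * (cmod (fourier_coeff L H k))\<^sup>2
      \<le> 2 * (cmod (fourier_coeff L H k))\<^sup>2 + 2 * a * (cmod (fourier_coeff L H'' k))\<^sup>2" for k
  proof -
    define y where "y = (real_of_int k)\<^sup>2"
    have "(1 + y) powr 2 = (1 + y)\<^sup>2"
      unfolding y_def by (simp add: powr_numeral add_pos_nonneg)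
    also have "\<dots> \<le> 2 + 2 * y\<^sup>2"
      using zero_le_power2[of "1 - y"] by (simp add: power2_eq_square algebra_simps)
    finally have "(1 + y) powr 2 \<le> 2 + 2 * y\<^sup>2" .
    moreover have "a * (cmod (fourier_coeff L H'' k))\<^sup>2 = y\<^sup>2 * (cmod (fourier_coeff L H k))\<^sup>2"
    proof -
      have "cmod (fourier_coeff L H'' k) = (2 * pi / L)\<^sup>2 * y * cmod (fourier_coeff L H k)"
        unfolding ft y_def norm_mult norm_minus_cancel norm_of_real
        by (simp add: power_mult_distrib power_divide)
      then show ?thesis
        using L by (simp add: a_def power_mult_distrib power_divide power4_eq_xxxx power2_eq_square)
    qed
    moreover have "(1 + y) powr 2 * (cmod (fourier_coeff L H k))\<^sup>2 \<le> (2 + 2 * y\<^sup>2) * (cmod (fourier_coeff L H k))\<^sup>2"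
      if "(1 + y) powr 2 \<le> 2 + 2 * y\<^sup>2"
      using that by (rule mult_right_mono) simp
    ultimately have "(1 + y) powr 2 * (cmod (fourier_coeff L H k))\<^sup>2
        \<le> 2 * (cmod (fourier_coeff L H k))\<^sup>2 + 2 * (a * (cmod (fourier_coeff L H'' k))\<^sup>2)"
      by (simp add: distrib_right)
    then show ?thesis by (simp add: y_def mult.assoc)
  qed
  have "(\<lambda>k::int. (1 + \<bar>of_int k\<bar>\<^sup>2) powr 2 * (cmod (fourier_coeff L H k))\<^sup>2) summable_on UNIV"
  proof (rule nonneg_bdd_above_summable_on)
    show "bdd_above (sum (\<lambda>k::int. (1 + \<bar>of_int k\<bar>\<^sup>2) powr 2 * (cmod (fourier_coeff L H k))\<^sup>2)
        ` {F. F \<subseteq> UNIV \<and> finite F})"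
    proof (rule bdd_aboveI2)
      fix K :: "int set" assume "K \<in> {F. F \<subseteq> UNIV \<and> finite F}"
      then have K: "finite K" by simp
      have "(\<Sum>k\<in>K. (1 + \<bar>of_int k\<bar>\<^sup>2) powr 2 * (cmod (fourier_coeff L H k))\<^sup>2)
         \<le> (\<Sum>k\<in>K. 2 * (cmod (fourier_coeff L H k))\<^sup>2 + 2 * a * (cmod (fourier_coeff L H'' k))\<^sup>2)"
        by (intro sum_mono term_le)
      also have "\<dots> = 2 * (\<Sum>k\<in>K. (cmod (fourier_coeff L H k))\<^sup>2) + 2 * a * (\<Sum>k\<in>K. (cmod (fourier_coeff L H'' k))\<^sup>2)"
        by (simp add: sum.distrib sum_distrib_left)
      also have "\<dots> \<le> 2 * ((LINT x|per_M L. (H x)\<^sup>2) / L) + 2 * a * ((LINT x|per_M L. (H'' x)\<^sup>2) / L)"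
        using bessel[OF L Hc(1) K] bessel[OF L Hc(3) K] L
        by (intro add_mono mult_left_mono) (auto simp: a_def field_simps)
      finally show "(\<Sum>k\<in>K. (1 + \<bar>of_int k\<bar>\<^sup>2) powr 2 * (cmod (fourier_coeff L H k))\<^sup>2)
         \<le> 2 * ((LINT x|per_M L. (H x)\<^sup>2) / L) + 2 * a * ((LINT x|per_M L. (H'' x)\<^sup>2) / L)" .
    qed
  qed auto
  then show ?thesis
    using continuous_periodic_L1[OF Hc(1) per] by (simp add: Hs_per_def)
qed

section \<open>The Sobolev embedding of H^2 into C^1\<close>

lemma summable_on_int_inverse_squares: "(\<lambda>k::int. 2 / (1 + (real_of_int k)\<^sup>2)) summable_on UNIV"
proof -
  have "summable (\<lambda>n::nat. 2 / (1 + (real n)\<^sup>2))"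
  proof (rule summable_comparison_test_ev)
    show "eventually (\<lambda>n. norm (2 / (1 + (real n)\<^sup>2)) \<le> 2 * inverse (real n ^ 2)) sequentially"
      using eventually_gt_at_top[of "0::nat"]
      by eventually_elim (auto simp: field_simps add_pos_nonneg)
    show "summable (\<lambda>n. 2 * inverse (real n ^ 2))"
      by (intro summable_mult inverse_power_summable) auto
  qed
  then have nat: "(\<lambda>n::nat. 2 / (1 + (real n)\<^sup>2)) summable_on UNIV"
    by (intro norm_summable_imp_summable_on) (simp add: add_pos_nonneg)
  let ?g = "\<lambda>k::int. 2 / (1 + (real_of_int k)\<^sup>2)"
  have "?g summable_on range int"
    by (subst summable_on_reindex) (use nat in \<open>auto simp: o_def inj_on_def\<close>)
  moreover have "?g summable_on (\<lambda>n. - int n) ` {1..}"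
    by (subst summable_on_reindex)
      (use summable_on_subset_banach[OF nat, of "{1..}"] in \<open>auto simp: o_def inj_on_def\<close>)
  moreover have "range int \<inter> (\<lambda>n. - int n) ` {1..} = {}"
    by auto
  ultimately have "?g summable_on (range int \<union> (\<lambda>n. - int n) ` {1..})"
    by (rule summable_on_Un_disjoint)
  moreover have "range int \<union> (\<lambda>n. - int n) ` {1..} = UNIV"
  proof (intro set_eqI iffI UNIV_I)
    fix k :: int
    show "k \<in> range int \<union> (\<lambda>n. - int n) ` {1..}"
    proof (cases "k \<ge> 0")
      case True
      then have "k = int (nat k)" by simp
      then show ?thesis by blast
    next
      case False
      then have "k = - int (nat (- k))" "nat (- k) \<in> {1..}" by auto
      then show ?thesis by blast
    qed
  qed
  ultimately show ?thesis by simp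
qed

text \<open>The Cauchy-Schwarz constant of the next lemma: 2 / (1 + k^2) majorises (1 + |k|)^2 / (1
  + k^2)^2, and the division by L undoes the factor L in \<open>Hs_norm\<close>.\<close>

definition sobolev_const :: "real \<Rightarrow> real" where
  "sobolev_const L = sqrt ((\<Sum>\<^sub>\<infinity>k::int. 2 / (1 + (real_of_int k)\<^sup>2)) / L)"

text \<open>The factor 1 + |k| makes the Fourier series and its termwise derivative converge
  absolutely at the same time.\<close>

lemma Hs2_coeff_summable:
  assumes L: "L > 0" and h: "h \<in> Hs_per 2 L"
  defines "a \<equiv> \<lambda>k::int. (1 + \<bar>of_int k\<bar>) * cmod (fourier_coeff L h k)"
  shows "a summable_on UNIV" "infsum a UNIV \<le> sobolev_const L * Hs_norm 2 L h"
proof -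
  let ?c = "fourier_coeff L h"
  let ?b = "\<lambda>k::int. (1 + \<bar>of_int k\<bar>\<^sup>2) powr 2 * (cmod (?c k))\<^sup>2"
  define A where "A = (\<Sum>\<^sub>\<infinity>k::int. 2 / (1 + (real_of_int k)\<^sup>2))"
  define S where "S = infsum ?b UNIV"
  have b: "?b summable_on UNIV" using h by (simp add: Hs_per_def)
  have A0: "A \<ge> 0" unfolding A_def by (intro infsum_nonneg) (auto simp: add_nonneg_nonneg)
  have S0: "S \<ge> 0" unfolding S_def by (intro infsum_nonneg) auto
  have bound: "sum a K \<le> sqrt A * sqrt S" if K: "finite K" for K
  proof -
    let ?w = "\<lambda>k::int. 1 + (real_of_int k)\<^sup>2"
    have wp: "?w k > 0" for k by (simp add: add_pos_nonneg)
    \<comment> \<open>Dividing and multiplying by the weight 1 + k^2 prepares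
      Cauchy-Schwarz.\<close>
    have "sum a K = (\<Sum>k\<in>K. \<bar>(1 + \<bar>of_int k\<bar>) / ?w k\<bar> * \<bar>?w k * cmod (?c k)\<bar>)"
      unfolding a_def
    proof (intro sum.cong refl)
      fix k
      show "(1 + \<bar>real_of_int k\<bar>) * cmod (?c k) = \<bar>(1 + \<bar>of_int k\<bar>) / ?w k\<bar> * \<bar>?w k * cmod (?c k)\<bar>"
        using wp[of k] by (simp add: abs_mult abs_of_pos)
    qed
    also have "\<dots> \<le> L2_set (\<lambda>k. (1 + \<bar>of_int k\<bar>) / ?w k) K * L2_set (\<lambda>k. ?w k * cmod (?c k)) K"
      by (rule L2_set_mult_ineq)
    also have "\<dots> \<le> sqrt A * sqrt S"
    proof (intro mult_mono)
      have "(\<Sum>k\<in>K. ((1 + \<bar>of_int k\<bar>) / ?w k)\<^sup>2) \<le> (\<Sum>k\<in>K. 2 / ?w k)"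
      proof (intro sum_mono)
        fix k :: int
        have "(1 + \<bar>real_of_int k\<bar>)\<^sup>2 \<le> 2 * ?w k"
          using zero_le_power2[of "1 - \<bar>real_of_int k\<bar>"] by (simp add: power2_eq_square algebra_simps)
        then have "(1 + \<bar>real_of_int k\<bar>)\<^sup>2 / (?w k)\<^sup>2 \<le> 2 * ?w k / (?w k)\<^sup>2"
          by (intro divide_right_mono) auto
        then show "((1 + \<bar>of_int k\<bar>) / ?w k)\<^sup>2 \<le> 2 / ?w k"
          using wp[of k] unfolding power_divide power2_eq_square[of "?w k"]
          by (metis less_irrefl mult_divide_mult_cancel_right)
      qed
      also have "\<dots> \<le> A"
        unfolding A_def by (intro finite_sum_le_infsum summable_on_int_inverse_squares K) (auto simp: add_nonneg_nonneg)
      finally show "L2_set (\<lambda>k. (1 + \<bar>of_int k\<bar>) / ?w k) K \<le> sqrt A"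
        by (simp add: L2_set_def)
      have "(\<Sum>k\<in>K. (?w k * cmod (?c k))\<^sup>2) = sum ?b K"
      proof (intro sum.cong refl)
        fix k show "(?w k * cmod (?c k))\<^sup>2 = ?b k"
          using wp[of k] by (simp add: power_mult_distrib powr_numeral)
      qed
      also have "\<dots> \<le> S" unfolding S_def by (intro finite_sum_le_infsum b K) auto
      finally show "L2_set (\<lambda>k. ?w k * cmod (?c k)) K \<le> sqrt S"
        by (simp add: L2_set_def)
    qed (auto simp: A0)
    finally show ?thesis .
  qed
  show sm: "a summable_on UNIV"
  proof (rule nonneg_bdd_above_summable_on)
    show "bdd_above (sum a ` {F. F \<subseteq> UNIV \<and> finite F})"
      by (rule bdd_aboveI2) (use bound in auto)
  qed (auto simp: a_def)
  have "infsum a UNIV \<le> sqrt A * sqrt S"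
    by (rule infsum_le_finite_sums[OF sm]) (use bound in auto)
  also have "\<dots> = sobolev_const L * Hs_norm 2 L h"
    using L A0 S0 unfolding sobolev_const_def Hs_norm_def A_def[symmetric] S_def[symmetric]
    by (simp add: real_sqrt_mult real_sqrt_divide)
  finally show "infsum a UNIV \<le> sobolev_const L * Hs_norm 2 L h" .
qed

lemma per_exp_periodic: "L > 0 \<Longrightarrow> per_exp L k (x + L) = per_exp L k x"
proof -
  assume "L > 0"
  then have "2 * pi * of_int k * (x + L) / L = 2 * pi * of_int k * x / L + 2 * pi * of_int k"
    by (simp add: field_simps)
  then have "per_exp L k (x + L) = per_exp L k x * cis (2 * pi * of_int k)"
    unfolding per_exp_def by (simp only: cis_mult)
  then show ?thesis by (simp add: cis_2pi_int)
qed

text \<open>H is the sum of the Fourier series. The Weierstrass test gives uniform convergence of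
  the differentiated series, and H has the coefficients of h, so both agree almost everywhere by
  \<open>fourier_unique\<close>.\<close>

theorem Hs2_representative:
  assumes L: "L > 0" and h: "h \<in> Hs_per 2 L"
  obtains H H' where "\<And>x. (H has_real_derivative H' x) (at x)" "continuous_on UNIV H'" "periodic L H"
    "AE x in per_M L. h x = H x" "\<And>x. \<bar>H x\<bar> \<le> sobolev_const L * Hs_norm 2 L h"
proof -
  let ?c = "fourier_coeff L h"
  define a where "a k = (1 + \<bar>of_int k\<bar>) * cmod (?c k)" for k :: int
  \<comment> \<open>An enumeration of the integers turns the unordered sum into a series indexed by
    naturals, for which termwise differentiation and integration are available.\<close>
  define \<kappa> where "\<kappa> = int_decode"
  have bij: "bij \<kappa>" unfolding \<kappa>_def by (rule bij_int_decode)
  have a_sum: "a summable_on UNIV" and a_le: "infsum a UNIV \<le> sobolev_const L * Hs_norm 2 L h"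
    using Hs2_coeff_summable[OF L h] unfolding a_def by auto
  have "(\<lambda>n. a (\<kappa> n)) summable_on UNIV"
    using summable_on_reindex_bij_betw[OF bij, of a] a_sum by simp
  then have "((\<lambda>n. a (\<kappa> n)) has_sum infsum a UNIV) UNIV"
    using infsum_reindex_bij_betw[OF bij, of a] by (metis has_sum_infsum)
  then have a_sums: "(\<lambda>n. a (\<kappa> n)) sums infsum a UNIV"
    by (rule has_sum_imp_sums)
  then have a_summable: "summable (\<lambda>n. a (\<kappa> n))"
    by (rule sums_summable)
  \<comment> \<open>Taking real parts keeps the sum real at every stage. It loses nothing because
    the coefficients of a real function at k and -k are conjugate.\<close>
  define F where "F n x = Re (?c (\<kappa> n) * per_exp L (\<kappa> n) x)" for n x
  define G where "G n x = Re (?c (\<kappa> n) * ((2 * pi * of_int (\<kappa> n) / L) *\<^sub>R (\<i> * per_exp L (\<kappa> n) x)))" for n x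
  have dF: "(F n has_real_derivative G n x) (at x)" for n x
  proof -
    have "((\<lambda>x. ?c (\<kappa> n) * per_exp L (\<kappa> n) x) has_vector_derivative
       ?c (\<kappa> n) * ((2 * pi * of_int (\<kappa> n) / L) *\<^sub>R (\<i> * per_exp L (\<kappa> n) x))) (at x)"
      by (intro has_vector_derivative_mult_right per_exp_has_vector_derivative)
    then show ?thesis unfolding F_def G_def has_vector_derivative_complex_iff by blast
  qed
  have Fle: "\<bar>F n x\<bar> \<le> a (\<kappa> n)" for n x
  proof -
    have "\<bar>F n x\<bar> \<le> cmod (?c (\<kappa> n) * per_exp L (\<kappa> n) x)"
      unfolding F_def by (rule abs_Re_le_cmod)
    also have "\<dots> \<le> a (\<kappa> n)"
      using mult_right_mono[of 1 "1 + \<bar>of_int (\<kappa> n)\<bar>" "cmod (?c (\<kappa> n))"] by (simp add: a_def norm_mult)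
    finally show ?thesis .
  qed
  have Gle: "\<bar>G n x\<bar> \<le> (2 * pi / L) * a (\<kappa> n)" for n x
  proof -
    have "\<bar>G n x\<bar> \<le> cmod (?c (\<kappa> n) * ((2 * pi * of_int (\<kappa> n) / L) *\<^sub>R (\<i> * per_exp L (\<kappa> n) x)))"
      unfolding G_def by (rule abs_Re_le_cmod)
    also have "\<dots> = (2 * pi / L) * (\<bar>of_int (\<kappa> n)\<bar> * cmod (?c (\<kappa> n)))"
      using L by (simp add: norm_mult abs_mult)
    also have "\<dots> \<le> (2 * pi / L) * a (\<kappa> n)"
      using L by (intro mult_left_mono) (auto simp: a_def intro!: mult_right_mono)
    finally show ?thesis .
  qed
  define H where "H x = (\<Sum>n. F n x)" for x
  define H' where "H' x = (\<Sum>n. G n x)" for x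
  have ucG: "uniformly_convergent_on UNIV (\<lambda>n x. \<Sum>i<n. G i x)"
    using Gle a_summable by (intro Weierstrass_m_test'[where M = "\<lambda>n. (2 * pi / L) * a (\<kappa> n)"] summable_mult) auto
  have F_summable: "summable (\<lambda>n. F n x)" for x
    by (rule summable_comparison_test'[OF a_summable]) (use Fle in auto)
  show thesis
  proof
    show "(H has_real_derivative H' x) (at x)" for x
      unfolding H_def[abs_def] H'_def
      by (rule has_field_derivative_series'(2)[OF convex_UNIV _ ucG UNIV_I F_summable])
        (use dF in auto)
    have "uniform_limit UNIV (\<lambda>n x. \<Sum>k<n. G k x) H' sequentially"
      using uniform_limit_suminf[OF ucG] unfolding H'_def[abs_def] .
    moreover have "continuous_on UNIV (\<lambda>x. \<Sum>k<n. G k x)" for n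
      unfolding G_def by (intro continuous_intros)
    ultimately show "continuous_on UNIV H'"
      by (intro uniform_limit_theorem[OF always_eventually]) auto
    show "periodic L H"
      unfolding periodic_def H_def F_def using L by (simp add: per_exp_periodic)
    show "\<bar>H x\<bar> \<le> sobolev_const L * Hs_norm 2 L h" for x
    proof -
      have "\<bar>H x\<bar> \<le> (\<Sum>n. a (\<kappa> n))"
        unfolding H_def using norm_suminf_le[OF _ a_summable, of "\<lambda>n. F n x"] Fle by simp
      also have "\<dots> = infsum a UNIV" using a_sums by (simp add: sums_iff)
      finally show ?thesis using a_le by simp
    qed
    have Hc: "continuous_on {0..L} H"
      using \<open>\<And>x. (H has_real_derivative H' x) (at x)\<close> by (rule has_real_derivative_continuous_on)
    have coeff: "(LINT x|per_M L. of_real (H x) * per_exp L j x) = of_real L * ?c (- j)" for j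
    proof -
      let ?g = "\<lambda>n x. complex_of_real (F n x) * per_exp L j x"
      have Fc: "continuous_on {0..L} (\<lambda>x. complex_of_real (F n x))" for n
        unfolding F_def by (intro continuous_intros)
      have gi: "integrable (per_M L) (?g n)" for n
        by (intro integral_per_M(1) continuous_intros Fc)
      have gn: "cmod (?g n x) \<le> a (\<kappa> n)" for n x
        using Fle by (simp add: norm_mult)
      have S1: "(\<Sum>n. ?g n x) = of_real (H x) * per_exp L j x" for x
        unfolding H_def using F_summable[of x] by (simp add: suminf_mult2[symmetric] suminf_of_real)
      have "summable (\<lambda>n. LINT x|per_M L. cmod (?g n x))"
      proof (rule summable_comparison_test')
        show "summable (\<lambda>n. L * a (\<kappa> n))" using a_summable by (rule summable_mult)
        show "norm (LINT x|per_M L. cmod (?g n x)) \<le> L * a (\<kappa> n)" for n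
        proof -
          have "(LINT x|per_M L. cmod (?g n x)) \<le> (LINT x|per_M L. a (\<kappa> n))"
            using gn integral_per_M(1)[of L "\<lambda>_. a (\<kappa> n)"] gi by (intro integral_mono integrable_norm) auto
          then show ?thesis
            using L by (simp add: measure_per_M integral_nonneg)
        qed
      qed
      then have "(\<lambda>n. LINT x|per_M L. ?g n x) sums (LINT x|per_M L. (\<Sum>n. ?g n x))"
        by (intro sums_integral gi AE_I2)
          (auto intro!: summable_comparison_test'[OF a_summable] gn simp del: norm_mult)
      then have sums: "(\<lambda>n. LINT x|per_M L. ?g n x) sums (LINT x|per_M L. of_real (H x) * per_exp L j x)"
        by (simp only: S1)
      \<comment> \<open>A real part carries half a coefficient at k and half at -k. Hence the
        coefficient of the sum at -j is assembled from two terms of the series, those with k = j and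
        k = -j.\<close>
      let ?p = "\<lambda>k. of_real L / 2 * ((if k = - j then ?c (- j) else 0) + (if k = j then ?c (- j) else 0))"
      have val: "(LINT x|per_M L. ?g n x) = ?p (\<kappa> n)" for n
      proof -
        let ?k = "\<kappa> n"
        have "?g n x = ?c ?k / 2 * per_exp L (?k + j) x + ?c (- ?k) / 2 * per_exp L (j - ?k) x" for x
        proof -
          have "complex_of_real (F n x) = (?c ?k * per_exp L ?k x + cnj (?c ?k * per_exp L ?k x)) / 2"
            unfolding F_def complex_add_cnj by simp
          also have "\<dots> = ?c ?k / 2 * per_exp L ?k x + ?c (- ?k) / 2 * per_exp L (- ?k) x"
            by (simp add: cnj_per_exp cnj_fourier_coeff add_divide_distrib)
          finally show ?thesis
            by (simp add: distrib_right mult.assoc per_exp_mult add.commute)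
        qed
        then have "(LINT x|per_M L. ?g n x) =
            (LINT x|per_M L. ?c ?k / 2 * per_exp L (?k + j) x + ?c (- ?k) / 2 * per_exp L (j - ?k) x)"
          by simp
        also have "\<dots> = ?c ?k / 2 * (LINT x|per_M L. per_exp L (?k + j) x)
            + ?c (- ?k) / 2 * (LINT x|per_M L. per_exp L (j - ?k) x)"
          by (subst Bochner_Integration.integral_add)
            (auto intro!: integrable_mult_right integral_per_M(1) continuous_intros)
        also have "\<dots> = ?p ?k"
          by (auto simp: integral_trig_monomial[OF L] add_eq_0_iff2)
        finally show ?thesis .
      qed
      have "((\<lambda>k. of_real L / 2 * ((if k = i then ?c (- j) else 0) :: complex)) has_sum of_real L / 2 * ?c (- j)) UNIV"
        for i :: int
        by (rule has_sum_cmult_right) (use has_sum_finite_neutralI[of "{i}" UNIV "\<lambda>k. if k = i then ?c (- j) else 0"] in auto)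
      from has_sum_add[OF this[of "- j"] this[of j]]
      have "(?p has_sum (of_real L * ?c (- j))) UNIV"
        by (simp add: distrib_left)
      then have "((\<lambda>n. ?p (\<kappa> n)) has_sum (of_real L * ?c (- j))) UNIV"
        using has_sum_reindex_bij_betw[OF bij, of ?p] by simp
      then have "(\<lambda>n. ?p (\<kappa> n)) sums (of_real L * ?c (- j))"
        by (rule has_sum_imp_sums)
      then show ?thesis
        using sums by (simp only: val) (rule sums_unique2)
    qed
    have hi: "integrable (per_M L) h" by (rule Hs_per_integrable[OF h])
    have "AE x in per_M L. h x - H x = 0"
    proof (rule fourier_unique[OF L])
      show "integrable (per_M L) (\<lambda>x. h x - H x)"
        by (intro Bochner_Integration.integrable_diff hi integral_per_M(1) Hc)
      show "(LINT x|per_M L. of_real (h x - H x) * per_exp L k x) = 0" for k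
      proof -
        have "(LINT x|per_M L. of_real (h x - H x) * per_exp L k x)
          = (LINT x|per_M L. of_real (h x) * per_exp L k x) - (LINT x|per_M L. of_real (H x) * per_exp L k x)"
          unfolding of_real_diff left_diff_distrib
          by (intro Bochner_Integration.integral_diff integrable_mult_continuous continuous_per_exp
              integrable_of_real hi integral_per_M(1) Hc)
        also have "\<dots> = 0"
          using L unfolding coeff by (simp add: fourier_coeff_per_M)
        finally show ?thesis .
      qed
    qed
    then show "AE x in per_M L. h x = H x" by simp
  qed
qed

section \<open>Weak derivatives and their extension to C^1 test functions\<close>

fun trig_comb :: "real \<Rightarrow> real \<times> real \<Rightarrow> real \<Rightarrow> real" where
  "trig_comb w (a, b) = (\<lambda>x. a * cos (w * x) + b * sin (w * x))"

lemma trig_comb_has_derivative: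
  "(trig_comb w ab has_real_derivative trig_comb w (w * snd ab, - w * fst ab) x) (at x)"
proof (cases ab)
  case (Pair a b)
  have "((\<lambda>x. a * cos (w * x) + b * sin (w * x)) has_real_derivative
      (w * b) * cos (w * x) + (- w * a) * sin (w * x)) (at x)"
    by (auto intro!: derivative_eq_intros)
  then show ?thesis by (simp add: Pair)
qed

text \<open>Differentiation only changes the pair of amplitudes, so all orders of smoothness follow
  by one induction.\<close>

lemma C_k_trig_comb: "C_k n (trig_comb w ab)"
proof -
  have d: "deriv (trig_comb w ab) = trig_comb w (w * snd ab, - w * fst ab)" for ab
    using trig_comb_has_derivative by (intro ext DERIV_imp_deriv)
  have ex: "\<exists>ab'. (deriv ^^ j) (trig_comb w ab) = trig_comb w ab'" for j
  proof (induction j)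
    case (Suc j) then show ?case using d by (metis comp_apply funpow.simps(2))
  qed (metis funpow_0)
  have "trig_comb w ab differentiable (at x)" for ab x
    using trig_comb_has_derivative real_differentiable_def by blast
  moreover have "continuous_on UNIV (trig_comb w ab)" for ab
    by (rule has_real_derivative_continuous_on) (rule trig_comb_has_derivative)
  ultimately show ?thesis
    unfolding C_k_def using ex by metis
qed

lemma weak_deriv_integrable:
  assumes "weak_deriv_per L u q"
  shows "integrable (per_M L) u" "integrable (per_M L) q"
  using assms by (auto simp: weak_deriv_per_def intro: L1_per_integrable)

text \<open>Weak derivatives are tested on real functions, so the exponential is split into cosine
  and sine and reassembled afterwards.\<close>

lemma weak_deriv_fourier:
  assumes L: "L > 0" and w: "weak_deriv_per L u q"
  shows "(LINT x|per_M L. of_real (q x) * per_exp L k x)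
    = - (of_real (2 * pi * of_int k / L) * \<i> * (LINT x|per_M L. of_real (u x) * per_exp L k x))"
proof -
  define \<omega> where "\<omega> = 2 * pi * of_int k / L"
  note ui = weak_deriv_integrable(1)[OF w] and qi = weak_deriv_integrable(2)[OF w]
  have per: "periodic L (trig_comb \<omega> (a, b))" for a b
  proof -
    have "\<omega> * (x + L) = \<omega> * x + 2 * pi * of_int k" for x
      using L by (simp add: \<omega>_def field_simps)
    then show ?thesis
      unfolding periodic_def by (simp add: cos_add sin_add)
  qed
  have test: "(LINT x|per_M L. u x * trig_comb \<omega> (\<omega> * b, - \<omega> * a) x) = - (LINT x|per_M L. q x * trig_comb \<omega> (a, b) x)" for a b
  proof -
    have d: "deriv (trig_comb \<omega> (a, b)) = trig_comb \<omega> (\<omega> * b, - \<omega> * a)"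
      using trig_comb_has_derivative[of \<omega> "(a, b)"] by (intro ext DERIV_imp_deriv) auto
    have "(LINT x:{0..L}|lborel. u x * deriv (trig_comb \<omega> (a, b)) x) = - (LINT x:{0..L}|lborel. q x * trig_comb \<omega> (a, b) x)"
      using w per C_k_trig_comb unfolding weak_deriv_per_def by blast
    then show ?thesis unfolding d set_integral_per_M .
  qed
  have e: "per_exp L k x = of_real (cos (\<omega> * x)) + \<i> * of_real (sin (\<omega> * x))" for x
    by (simp add: per_exp_def \<omega>_def complex_eq_iff)
  have split: "(LINT x|per_M L. of_real (h x) * per_exp L k x)
      = of_real (LINT x|per_M L. h x * cos (\<omega> * x)) + \<i> * of_real (LINT x|per_M L. h x * sin (\<omega> * x))"
    if h: "integrable (per_M L) h" for h :: "real \<Rightarrow> real"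
  proof -
    have i: "integrable (per_M L) (\<lambda>x. h x * cos (\<omega> * x))" "integrable (per_M L) (\<lambda>x. h x * sin (\<omega> * x))"
      by (intro integrable_mult_continuous h continuous_intros)+
    have "(LINT x|per_M L. of_real (h x) * per_exp L k x)
      = (LINT x|per_M L. of_real (h x * cos (\<omega> * x)) + \<i> * of_real (h x * sin (\<omega> * x)))"
      by (simp add: e distrib_left mult_ac)
    also have "\<dots> = (LINT x|per_M L. of_real (h x * cos (\<omega> * x))) + (LINT x|per_M L. \<i> * of_real (h x * sin (\<omega> * x)))"
      using i by (intro Bochner_Integration.integral_add integrable_mult_right integrable_of_real)
    also have "\<dots> = of_real (LINT x|per_M L. h x * cos (\<omega> * x)) + \<i> * of_real (LINT x|per_M L. h x * sin (\<omega> * x))"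
      by (simp only: integral_mult_right_zero integral_complex_of_real)
    finally show ?thesis .
  qed
  have "(LINT x|per_M L. q x * cos (\<omega> * x)) = \<omega> * (LINT x|per_M L. u x * sin (\<omega> * x))"
    using test[of 0 1] test[of 1 0] by (simp add: mult.left_commute)
  moreover have "(LINT x|per_M L. q x * sin (\<omega> * x)) = - \<omega> * (LINT x|per_M L. u x * cos (\<omega> * x))"
    using test[of 1 0] by (simp add: mult.left_commute)
  ultimately show ?thesis
    unfolding split[OF ui] split[OF qi] \<omega>_def[symmetric] by (simp add: complex_eq_iff)
qed

lemma classical_fourier:
  assumes L: "L > 0" and U: "\<And>x. (U has_real_derivative U' x) (at x)" "continuous_on UNIV U'" "U 0 = U L"
  shows "(LINT x|per_M L. of_real (U' x) * per_exp L k x)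
    = - (of_real (2 * pi * of_int k / L) * \<i> * (LINT x|per_M L. of_real (U x) * per_exp L k x))"
  using fourier_coeff_deriv[OF L U(1) continuous_on_subset[OF U(2) subset_UNIV] U(3), of "- k"] L
  unfolding fourier_coeff_per_M by (simp add: field_simps)

text \<open>Both derivatives have the Fourier coefficients that those of \<open>u\<close> prescribe,
  and coefficients determine an integrable function.\<close>

theorem weak_deriv_eq_classical:
  assumes L: "L > 0" and w: "weak_deriv_per L u q" and u: "AE x in per_M L. u x = U x"
    and U: "\<And>x. (U has_real_derivative U' x) (at x)" "continuous_on UNIV U'" "U 0 = U L"
  shows "AE x in per_M L. q x = U' x"
proof -
  note ui = weak_deriv_integrable(1)[OF w] and qi = weak_deriv_integrable(2)[OF w]
  have U'i: "integrable (per_M L) U'" and Ui: "integrable (per_M L) U"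
    by (rule integral_per_M(1), rule continuous_on_subset[OF U(2) subset_UNIV],
        rule integral_per_M(1), rule has_real_derivative_continuous_on, rule U(1))
  have "AE x in per_M L. q x - U' x = 0"
  proof (rule fourier_unique[OF L])
    show "integrable (per_M L) (\<lambda>x. q x - U' x)" using U'i qi by simp
    show "(LINT x|per_M L. of_real (q x - U' x) * per_exp L k x) = 0" for k
    proof -
      have "(LINT x|per_M L. of_real (u x) * per_exp L k x) = (LINT x|per_M L. of_real (U x) * per_exp L k x)"
        using u ui Ui borel_measurable_per_M[OF borel_measurable_per_exp]
        by (intro integral_cong_AE borel_measurable_times borel_measurable_of_real) (auto elim: eventually_mono)
      then have "(LINT x|per_M L. of_real (q x) * per_exp L k x) = (LINT x|per_M L. of_real (U' x) * per_exp L k x)"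
        unfolding weak_deriv_fourier[OF L w] classical_fourier[OF L U] by simp
      then show ?thesis
        unfolding of_real_diff left_diff_distrib
        by (subst Bochner_Integration.integral_diff)
          (auto intro!: integrable_mult_continuous continuous_per_exp U'i qi)
    qed
  qed
  then show ?thesis by simp
qed

text \<open>The definition tests with smooth functions only, whereas the energy and weight arguments
  test with functions of finite smoothness. A trigonometric polynomial R with R' near Y' and R near
  Y passes from one class to the other.\<close>

theorem weak_deriv_C1_test:
  assumes L: "L > 0" and w: "weak_deriv_per L u q"
    and Y: "\<And>x. (Y has_real_derivative Y' x) (at x)" "continuous_on UNIV Y'" "Y 0 = Y L" "Y' 0 = Y' L"
  shows "(LINT x|per_M L. u x * Y' x) = - (LINT x|per_M L. q x * Y x)"
proof -
  note ui = weak_deriv_integrable(1)[OF w] and qi = weak_deriv_integrable(2)[OF w]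
  have Yc: "continuous_on {0..L} Y" "continuous_on {0..L} Y'"
    by (rule has_real_derivative_continuous_on, rule Y(1), rule continuous_on_subset[OF Y(2) subset_UNIV])
  let ?u = "LINT x|per_M L. \<bar>u x\<bar>" and ?q = "LINT x|per_M L. \<bar>q x\<bar>"
  have "\<bar>(LINT x|per_M L. u x * Y' x) + (LINT x|per_M L. q x * Y x)\<bar> \<le> 0 + e * (2 * ?u + 2 * L * ?q)"
    if e: "e > 0" for e
  proof -
    obtain P where P: "trig_poly L P" "\<And>x. x \<in> {0..L} \<Longrightarrow> cmod (of_real (Y' x) - P x) < e"
      using trig_approx[OF L Yc(2) Y(4) e] by blast
    obtain K c where K: "finite K" "P = (\<lambda>x. \<Sum>k\<in>K. c k * per_exp L k x)"
      using P(1) unfolding trig_poly_def by blast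
    \<comment> \<open>Dropping the constant term makes the antiderivative of the polynomial
      periodic. In \<open>d\<close> the quotient at k = 0 then has numerator 0.\<close>
    define c' where "c' k = (if k = 0 then 0 else c k)" for k
    define d where "d k = c' k / (of_real (2 * pi * of_int k / L) * \<i>)" for k
    define R' where "R' x = (\<Sum>k\<in>K. c' k * per_exp L k x)" for x
    \<comment> \<open>The additive constant arranges R 0 = Y 0, so closeness of the derivatives
      integrates to closeness of the functions.\<close>
    define R where "R x = (\<Sum>k\<in>K. d k * per_exp L k x) + (of_real (Y 0) - (\<Sum>k\<in>K. d k))" for x
    have dk: "d k * (of_real (2 * pi * of_int k / L) * \<i>) = c' k" for k
      using L unfolding d_def c'_def by (cases "k = 0") auto
    have tR: "trig_poly L R" "trig_poly L R'"
      unfolding R_def[abs_def] R'_def[abs_def]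
      by (auto intro!: trig_poly_add trig_poly_sum trig_poly_monomial trig_poly_const K(1))
    have dR: "(R has_vector_derivative R' x) (at x within S)" for x S
    proof -
      have "(R has_vector_derivative
          (\<Sum>k\<in>K. d k * ((2 * pi * of_int k / L) *\<^sub>R (\<i> * per_exp L k x))) + 0) (at x within S)"
        unfolding R_def
        by (intro has_vector_derivative_add has_vector_derivative_sum has_vector_derivative_mult_right
            per_exp_has_vector_derivative has_vector_derivative_const)
      also have "(\<Sum>k\<in>K. d k * ((2 * pi * of_int k / L) *\<^sub>R (\<i> * per_exp L k x))) + 0 = R' x"
        unfolding R'_def dk[symmetric] by (simp add: scaleR_conv_of_real mult_ac)
      finally show ?thesis .
    qed
    define m where "m = (if 0 \<in> K then c 0 else 0)"
    have P_R': "P x - R' x = m" for x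
    proof -
      have "P x - R' x = (\<Sum>k\<in>K. if k = 0 then c 0 else 0)"
        unfolding K(2) R'_def sum_subtractf[symmetric] by (intro sum.cong) (auto simp: c'_def)
      then show ?thesis using K(1) by (simp add: m_def)
    qed
    have intP: "of_real L * m = (LINT x|per_M L. P x)"
    proof -
      have "(LINT x|per_M L. P x) = (\<Sum>k\<in>K. LINT x|per_M L. c k * per_exp L k x)"
        unfolding K(2) by (intro Bochner_Integration.integral_sum integral_per_M(1) continuous_intros)
      also have "\<dots> = (\<Sum>k\<in>K. if k = 0 then c 0 * of_real L else 0)"
        by (intro sum.cong) (auto simp: integral_trig_monomial[OF L])
      also have "\<dots> = of_real L * m" using K(1) by (simp add: m_def)
      finally show ?thesis ..
    qed
    \<comment> \<open>Since Y' has mean 0, the mean \<open>m\<close> of its approximation P is at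
      most \<open>e\<close>; removing it only doubles the error.\<close>
    have intY': "(LINT x|per_M L. Y' x) = 0"
      by (rule integral_deriv_eq_0[OF L _ Yc(2) Y(3)])
        (use Y(1) in \<open>simp add: has_real_derivative_iff_has_vector_derivative\<close>)
    have "cmod (of_real (LINT x|per_M L. 1 * Y' x) - (LINT x|per_M L. of_real 1 * P x))
        \<le> e * (LINT x|per_M L. \<bar>1\<bar>)"
      using P by (intro integral_near_trig_poly Yc) (auto intro!: integral_per_M(1) simp: less_imp_le)
    then have "cmod (of_real L * m) \<le> e * L"
      using L by (simp add: intY' measure_per_M flip: intP del: norm_mult)
    then have me: "cmod m \<le> e" using L by (simp add: norm_mult mult.commute[of L])
    have R'Y: "cmod (of_real (Y' x) - R' x) \<le> 2 * e" if "x \<in> {0..L}" for x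
    proof -
      have split: "of_real (Y' x) - R' x = (of_real (Y' x) - P x) + m"
        using P_R'[of x] by (simp add: algebra_simps)
      show ?thesis
        unfolding split
        using norm_triangle_ineq[of "of_real (Y' x) - P x" m] P(2)[OF that] me by linarith
    qed
    have RY: "cmod (of_real (Y x) - R x) \<le> e * (2 * L)" if x: "x \<in> {0..L}" for x
    proof -
      have "norm ((of_real (Y x) - R x) - (of_real (Y 0) - R 0)) \<le> 2 * e * norm (x - 0)"
      proof (rule differentiable_bound[where S = "{0..L}" and f' = "\<lambda>y h. h *\<^sub>R (of_real (Y' y) - R' y)"])
        show "((\<lambda>x. of_real (Y x) - R x) has_derivative (\<lambda>h. h *\<^sub>R (of_real (Y' y) - R' y))) (at y within {0..L})" for y
          using has_vector_derivative_diff[OF has_vector_derivative_of_real[OF Y(1)] dR, of y]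
          unfolding has_vector_derivative_def by (rule has_derivative_at_withinI)
        show "onorm (\<lambda>h. h *\<^sub>R (complex_of_real (Y' y) - R' y)) \<le> 2 * e" if "y \<in> {0..L}" for y
          using R'Y[OF that] by (intro onorm_le) (simp add: mult.commute mult_left_mono)
      qed (use x L in auto)
      moreover have "R 0 = of_real (Y 0)" by (simp add: R_def)
      ultimately have "cmod (of_real (Y x) - R x) \<le> 2 * e * x" using x by simp
      also have "\<dots> \<le> e * (2 * L)" using x e by simp
      finally show ?thesis .
    qed
    have q0: "(LINT x|per_M L. complex_of_real (q x)) = 0"
      using weak_deriv_fourier[OF L w, of 0] by simp
    have "(LINT x|per_M L. of_real (q x) * R x)
       = (\<Sum>k\<in>K. d k * (LINT x|per_M L. of_real (q x) * per_exp L k x))"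
    proof -
      have "(LINT x|per_M L. of_real (q x) * R x) = (LINT x|per_M L. of_real (q x) * (\<Sum>k\<in>K. d k * per_exp L k x)
          + of_real (q x) * (of_real (Y 0) - (\<Sum>k\<in>K. d k)))"
        by (simp add: R_def distrib_left)
      also have "\<dots> = (LINT x|per_M L. of_real (q x) * (\<Sum>k\<in>K. d k * per_exp L k x))
          + (LINT x|per_M L. of_real (q x) * (of_real (Y 0) - (\<Sum>k\<in>K. d k)))"
        by (intro Bochner_Integration.integral_add integrable_mult_continuous integrable_of_real qi continuous_intros)
      also have "(LINT x|per_M L. of_real (q x) * (of_real (Y 0) - (\<Sum>k\<in>K. d k))) = 0"
        using q0 by (simp only: integral_mult_left_zero mult_zero_left)
      also have "(LINT x|per_M L. of_real (q x) * (\<Sum>k\<in>K. d k * per_exp L k x))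
          = (\<Sum>k\<in>K. d k * (LINT x|per_M L. of_real (q x) * per_exp L k x))"
        by (intro integral_trig_poly_mult integrable_of_real qi)
      finally show ?thesis by simp
    qed
    also have "\<dots> = - (\<Sum>k\<in>K. c' k * (LINT x|per_M L. of_real (u x) * per_exp L k x))"
      unfolding weak_deriv_fourier[OF L w] dk[symmetric] by (simp add: sum_negf mult_ac)
    also have "(\<Sum>k\<in>K. c' k * (LINT x|per_M L. of_real (u x) * per_exp L k x)) = (LINT x|per_M L. of_real (u x) * R' x)"
      unfolding R'_def by (intro integral_trig_poly_mult[symmetric] integrable_of_real ui)
    finally have eq: "(LINT x|per_M L. of_real (q x) * R x) = - (LINT x|per_M L. of_real (u x) * R' x)" .
    have "of_real ((LINT x|per_M L. u x * Y' x) + (LINT x|per_M L. q x * Y x))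
      = (of_real (LINT x|per_M L. u x * Y' x) - (LINT x|per_M L. of_real (u x) * R' x))
       + (of_real (LINT x|per_M L. q x * Y x) - (LINT x|per_M L. of_real (q x) * R x))"
      unfolding eq by simp
    also have "cmod \<dots> \<le> 2 * e * ?u + e * (2 * L) * ?q"
      by (intro order_trans[OF norm_triangle_ineq] add_mono integral_near_trig_poly ui qi Yc tR R'Y RY)
    finally have "\<bar>(LINT x|per_M L. u x * Y' x) + (LINT x|per_M L. q x * Y x)\<bar> \<le> 2 * e * ?u + e * (2 * L) * ?q"
      unfolding norm_of_real .
    also have "\<dots> = 0 + e * (2 * ?u + 2 * L * ?q)"
      by (simp add: algebra_simps)
    finally show ?thesis .
  qed
  then have "\<bar>(LINT x|per_M L. u x * Y' x) + (LINT x|per_M L. q x * Y x)\<bar> \<le> 0"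
    by (rule small_multiple_imp_zero)
  then show ?thesis by simp
qed

section \<open>Regularity of the solutions\<close>

lemma continuous_AE_eq_imp_eq:
  fixes H K :: "real \<Rightarrow> real"
  assumes L: "L > 0" and c: "continuous_on {0..L} H" "continuous_on {0..L} K"
    and ae: "AE x in per_M L. H x = K x" and x: "x \<in> {0..L}"
  shows "H x = K x"
proof -
  have sc: "continuous_on {0..L} (\<lambda>x. (H x - K x)\<^sup>2)"
    by (intro continuous_intros c)
  have "(LINT x|per_M L. (H x - K x)\<^sup>2) = (LINT x|per_M L. 0)"
    using ae continuous_measurable_per_M[OF sc] by (intro integral_cong_AE) auto
  then have "integral {0..L} (\<lambda>x. (H x - K x)\<^sup>2) = 0"
    using integral_per_M(2)[OF sc] by simp
  then have "((\<lambda>x. (H x - K x)\<^sup>2) has_integral 0) (cbox 0 L)"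
    using integrable_integral[OF integrable_continuous_interval[OF sc]] by simp
  then have "(H x - K x)\<^sup>2 = 0"
    using has_integral_0_cbox_imp_0[of 0 L "\<lambda>x. (H x - K x)\<^sup>2" x] sc L x by simp
  then show ?thesis by simp
qed

lemma fourier_coeff_diff:
  assumes "integrable (per_M L) h" "integrable (per_M L) k"
  shows "fourier_coeff L (\<lambda>x. h x - k x) n = fourier_coeff L h n - fourier_coeff L k n"
proof -
  have "(LINT x|per_M L. of_real (h x - k x) * per_exp L (- n) x)
      = (LINT x|per_M L. of_real (h x) * per_exp L (- n) x) - (LINT x|per_M L. of_real (k x) * per_exp L (- n) x)"
    unfolding of_real_diff left_diff_distrib
    by (intro Bochner_Integration.integral_diff integrable_mult_continuous continuous_per_exp
        integrable_of_real assms)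
  then show ?thesis unfolding fourier_coeff_per_M by (simp only: diff_divide_distrib)
qed

lemma Hs_per_diff:
  assumes h: "h \<in> Hs_per s L" and k: "k \<in> Hs_per s L"
  shows "(\<lambda>x. h x - k x) \<in> Hs_per s L"
proof -
  let ?w = "\<lambda>n::int. (1 + \<bar>of_int n\<bar>\<^sup>2) powr s"
  have "(\<lambda>n. ?w n * (cmod (fourier_coeff L h n))\<^sup>2) summable_on UNIV"
      "(\<lambda>n. ?w n * (cmod (fourier_coeff L k n))\<^sup>2) summable_on UNIV"
    using h k by (auto simp: Hs_per_def)
  then have sm: "(\<lambda>n. 2 * (?w n * (cmod (fourier_coeff L h n))\<^sup>2) + 2 * (?w n * (cmod (fourier_coeff L k n))\<^sup>2)) summable_on UNIV"
    by (intro summable_on_add summable_on_cmult_right)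
  have "(\<lambda>n. ?w n * (cmod (fourier_coeff L (\<lambda>x. h x - k x) n))\<^sup>2) summable_on UNIV"
  proof (rule summable_on_comparison_test[OF sm])
    fix n
    have "(cmod (fourier_coeff L h n - fourier_coeff L k n))\<^sup>2
        \<le> (cmod (fourier_coeff L h n) + cmod (fourier_coeff L k n))\<^sup>2"
      by (intro power_mono norm_triangle_ineq4) auto
    also have "\<dots> \<le> 2 * (cmod (fourier_coeff L h n))\<^sup>2 + 2 * (cmod (fourier_coeff L k n))\<^sup>2"
      using zero_le_power2[of "cmod (fourier_coeff L h n) - cmod (fourier_coeff L k n)"]
      by (simp add: power2_eq_square algebra_simps)
    finally have "(cmod (fourier_coeff L (\<lambda>x. h x - k x) n))\<^sup>2
        \<le> 2 * (cmod (fourier_coeff L h n))\<^sup>2 + 2 * (cmod (fourier_coeff L k n))\<^sup>2"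
      unfolding fourier_coeff_diff[OF Hs_per_integrable[OF h] Hs_per_integrable[OF k]] .
    then have "?w n * (cmod (fourier_coeff L (\<lambda>x. h x - k x) n))\<^sup>2
        \<le> ?w n * (2 * (cmod (fourier_coeff L h n))\<^sup>2 + 2 * (cmod (fourier_coeff L k n))\<^sup>2)"
      by (rule mult_left_mono) simp
    then show "?w n * (cmod (fourier_coeff L (\<lambda>x. h x - k x) n))\<^sup>2
        \<le> 2 * (?w n * (cmod (fourier_coeff L h n))\<^sup>2) + 2 * (?w n * (cmod (fourier_coeff L k n))\<^sup>2)"
      by (simp add: algebra_simps)
  qed auto
  moreover have "(\<lambda>x. h x - k x) \<in> L1_per L"
    using h k by (auto simp: Hs_per_def L1_per_def periodic_def intro: set_integral_diff)
  ultimately show ?thesis by (simp add: Hs_per_def)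
qed

lemma Hs_per_divide:
  assumes h: "h \<in> Hs_per s L"
  shows "(\<lambda>x. h x / a) \<in> Hs_per s L"
proof -
  have "(LINT x|per_M L. of_real (h x / a) * per_exp L (- n) x)
      = of_real (1 / a) * (LINT x|per_M L. of_real (h x) * per_exp L (- n) x)" for n
    unfolding integral_mult_right_zero[symmetric] by (intro Bochner_Integration.integral_cong) auto
  then have fc: "fourier_coeff L (\<lambda>x. h x / a) n = of_real (1 / a) * fourier_coeff L h n" for n
    unfolding fourier_coeff_per_M by (simp only: times_divide_eq_right)
  have eq: "(1 + \<bar>of_int n\<bar>\<^sup>2) powr s * (cmod (fourier_coeff L (\<lambda>x. h x / a) n))\<^sup>2
     = (1 / a)\<^sup>2 * ((1 + \<bar>of_int n\<bar>\<^sup>2) powr s * (cmod (fourier_coeff L h n))\<^sup>2)" for n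
    by (simp add: fc norm_mult norm_divide power_divide)
  have "(\<lambda>n::int. (1 + \<bar>of_int n\<bar>\<^sup>2) powr s * (cmod (fourier_coeff L (\<lambda>x. h x / a) n))\<^sup>2) summable_on UNIV"
    unfolding eq using h by (intro summable_on_cmult_right) (simp add: Hs_per_def)
  moreover have "(\<lambda>x. h x / a) \<in> L1_per L"
    using h by (auto simp: Hs_per_def L1_per_def periodic_def set_integrable_per_M)
  ultimately show ?thesis by (simp add: Hs_per_def)
qed

lemma Hs2_subset_Hs0: "h \<in> Hs_per 2 L \<Longrightarrow> h \<in> Hs_per 0 L"
proof -
  assume h: "h \<in> Hs_per 2 L"
  then have sm: "(\<lambda>n::int. (1 + \<bar>of_int n\<bar>\<^sup>2) powr 2 * (cmod (fourier_coeff L h n))\<^sup>2) summable_on UNIV"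
    by (simp add: Hs_per_def)
  have "(\<lambda>n::int. (1 + \<bar>of_int n\<bar>\<^sup>2) powr 0 * (cmod (fourier_coeff L h n))\<^sup>2) summable_on UNIV"
  proof (rule summable_on_comparison_test[OF sm])
    fix n :: int
    have "(1 + \<bar>real_of_int n\<bar>\<^sup>2) powr 0 \<le> (1 + \<bar>real_of_int n\<bar>\<^sup>2) powr 2"
      by (intro powr_mono) auto
    then show "(1 + \<bar>of_int n\<bar>\<^sup>2) powr 0 * (cmod (fourier_coeff L h n))\<^sup>2
       \<le> (1 + \<bar>of_int n\<bar>\<^sup>2) powr 2 * (cmod (fourier_coeff L h n))\<^sup>2"
      by (rule mult_right_mono) simp
  qed auto
  then show ?thesis using h by (simp add: Hs_per_def)
qed

text \<open>Continuous representatives agree everywhere on the window, so the bound for the sum of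
  the Fourier series passes to any of them.\<close>

lemma sobolev_sup_bound:
  assumes L: "L > 0" and h: "h \<in> Hs_per 2 L" and H: "continuous_on {0..L} H"
    and ae: "AE x in per_M L. h x = H x" and x: "x \<in> {0..L}"
  shows "\<bar>H x\<bar> \<le> sobolev_const L * Hs_norm 2 L h"
proof -
  obtain K K' where K: "\<And>x. (K has_real_derivative K' x) (at x)"
    "AE x in per_M L. h x = K x" "\<And>x. \<bar>K x\<bar> \<le> sobolev_const L * Hs_norm 2 L h"
    using Hs2_representative[OF L h] by metis
  have "AE x in per_M L. H x = K x"
    using ae K(2) by eventually_elim auto
  then have "H x = K x"
    by (intro continuous_AE_eq_imp_eq[OF L H _ _ x] has_real_derivative_continuous_on[OF K(1)])
  then show ?thesis using K(3) by simp
qed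

text \<open>The interface between the function space formulation and calculus. Only uniform
  continuity in time and derivatives of pairings with C^1 functions survive. The last clause says
  that the solution has no quadratic variation; this is what permits a chain rule for nonlinear
  functionals.\<close>

definition regular_solution ::
  "(real \<Rightarrow> real) \<Rightarrow> (real \<Rightarrow> real) \<Rightarrow> real \<Rightarrow> (real \<Rightarrow> real \<Rightarrow> real) \<Rightarrow> (real \<Rightarrow> real \<Rightarrow> real) \<Rightarrow> bool"
  where
  "regular_solution f g L U Q \<longleftrightarrow>
     (\<forall>t\<ge>0. (\<forall>x. (U t has_real_derivative Q t x) (at x)) \<and> continuous_on UNIV (Q t) \<and> periodic L (U t)) \<and>
     (\<forall>t\<ge>0. \<forall>e>0. \<forall>\<^sub>F s in at t within {0..}. \<forall>x\<in>{0..L}. \<bar>U s x - U t x\<bar> \<le> e) \<and>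
     (\<forall>t>0. \<forall>Y Y'. (\<forall>x. (Y has_real_derivative Y' x) (at x)) \<and> continuous_on UNIV Y' \<and> periodic L Y \<longrightarrow>
        ((\<lambda>s. integral {0..L} (\<lambda>x. (U s x - U t x) * Y x) / (s - t)) \<longlongrightarrow>
           integral {0..L} (\<lambda>x. (f (U t x) - Q t x) * Y' x + g (U t x) * Y x)) (at t)) \<and>
     (\<forall>t>0. ((\<lambda>s. integral {0..L} (\<lambda>x. (U s x - U t x)\<^sup>2) / (s - t)) \<longlongrightarrow> 0) (at t))"

text \<open>The equation expresses the L^2 time derivative by weak space derivatives, and
  \<open>weak_deriv_C1_test\<close> moves these onto the test function. For the quadratic variation,
  the pairing of the difference quotient with an increment is at most the supremum of the increment
  times a bounded factor.\<close>

theorem H2_global_solution_regular: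
  assumes L: "L > 0" and fc: "continuous_on UNIV f" and gc: "continuous_on UNIV g"
    and sol: "H2_global_solution f g L \<psi> u"
  obtains U Q where "regular_solution f g L U Q"
    "\<And>t. t \<ge> 0 \<Longrightarrow> u t \<in> Hs_per 2 L" "\<And>t. t \<ge> 0 \<Longrightarrow> AE x in per_M L. u t x = U t x"
proof -
  have solT: "H2_solution f g L T \<psi> u" if "T > 0" for T
    using sol that by (simp add: H2_global_solution_def)
  have uH: "u t \<in> Hs_per 2 L" if "t \<ge> 0" for t
    using solT[of "t + 1"] that by (auto simp: H2_solution_def)
  have "\<forall>t\<in>{0..}. \<exists>P. (\<forall>x. (fst P has_real_derivative snd P x) (at x)) \<and> continuous_on UNIV (snd P)
      \<and> periodic L (fst P) \<and> (AE x in per_M L. u t x = fst P x)"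
  proof
    fix t :: real assume "t \<in> {0..}"
    then have "u t \<in> Hs_per 2 L" using uH by simp
    then obtain H H' where "\<And>x. (H has_real_derivative H' x) (at x)" "continuous_on UNIV H'" "periodic L H"
        "AE x in per_M L. u t x = H x"
      using Hs2_representative[OF L] by metis
    then show "\<exists>P. (\<forall>x. (fst P has_real_derivative snd P x) (at x)) \<and> continuous_on UNIV (snd P)
      \<and> periodic L (fst P) \<and> (AE x in per_M L. u t x = fst P x)"
      by (intro exI[of _ "(H, H')"]) auto
  qed
  then obtain P where P: "\<forall>t\<in>{0..}. (\<forall>x. (fst (P t) has_real_derivative snd (P t) x) (at x))
      \<and> continuous_on UNIV (snd (P t)) \<and> periodic L (fst (P t)) \<and> (AE x in per_M L. u t x = fst (P t) x)"
    by (rule bchoice[THEN exE])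
  define U where "U t = fst (P t)" for t
  define Q where "Q t = snd (P t)" for t
  have U: "(U t has_real_derivative Q t x) (at x)" "continuous_on UNIV (Q t)" "periodic L (U t)"
      "AE x in per_M L. u t x = U t x" if "t \<ge> 0" for t x
    using P that unfolding U_def Q_def by auto
  have Uc: "continuous_on S (U t)" if "t \<ge> 0" for t S
    using U(1)[OF that] by (rule has_real_derivative_continuous_on)
  have U0: "U t 0 = U t L" if "t \<ge> 0" for t
    using U(3)[OF that, unfolded periodic_def, rule_format, of 0] by simp
  \<comment> \<open>The Sobolev bound for the supremum of the increment from time t to time
    s.\<close>
  let ?B = "\<lambda>t s. sobolev_const L * Hs_norm 2 L (\<lambda>x. u s x - u t x)"
  have diff_bound: "\<bar>U s x - U t x\<bar> \<le> ?B t s" if "t \<ge> 0" "s \<ge> 0" "x \<in> {0..L}" for t s x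
  proof (rule sobolev_sup_bound[OF L Hs_per_diff[OF uH uH] _ _ that(3)])
    show "AE x in per_M L. u s x - u t x = U s x - U t x"
      using U(4)[OF that(1)] U(4)[OF that(2)] by eventually_elim auto
  qed (use that in \<open>auto intro!: continuous_intros Uc\<close>)
  have conv0: "(?B t \<longlongrightarrow> 0) (at t within {0..})" if "t \<ge> 0" for t
  proof -
    have "((\<lambda>s. Hs_norm 2 L (\<lambda>x. u s x - u t x)) \<longlongrightarrow> 0) (at t within {0..t + 1})"
      using solT[of "t + 1"] that by (simp add: H2_solution_def)
    also have "at t within {0..t + 1} = at t within {0..}"
      by (rule at_within_nhd[where S = "{..<t + 1}"]) auto
    finally show ?thesis by (rule tendsto_mult_right_zero)
  qed
  have conv: "(?B t \<longlongrightarrow> 0) (at t)" if "t > 0" for t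
  proof -
    have "at t within {0..} = at t"
      using that by (intro at_within_interior) (simp add: interior_real_atLeast)
    then show ?thesis using conv0[of t] that by simp
  qed
  have evpos: "\<forall>\<^sub>F s in at t. s > 0 \<and> s \<noteq> t" if "t > 0" for t :: real
    using eventually_at_in_open[of "{0<..}" t] that by (auto elim!: eventually_mono)
  have vex: "\<exists>v N. v \<in> Hs_per 0 L \<and> (N \<longlongrightarrow> 0) (at t)
      \<and> (\<forall>s. N s = Hs_norm 0 L (\<lambda>x. (u s x - u t x) / (s - t) - v x))
      \<and> (\<exists>p q r. weak_deriv_per L (\<lambda>x. f (u t x)) p \<and> weak_deriv_per L (u t) q \<and> weak_deriv_per L q r \<and>
          (AE x in lborel. v x + p x = r x + g (u t x)))" if t: "t > 0" for t
  proof -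
    obtain v where v: "\<forall>t\<in>{0<..t + 1}. v t \<in> Hs_per 0 L"
       "\<forall>\<tau>\<in>{0<..t + 1}. ((\<lambda>s. Hs_norm 0 L (\<lambda>x. (u s x - u \<tau> x) / (s - \<tau>) - v \<tau> x)) \<longlongrightarrow> 0) (at \<tau> within {0<..t + 1})"
       "\<forall>\<tau>\<in>{0<..t + 1}. \<exists>p q r.
          weak_deriv_per L (\<lambda>x. f (u \<tau> x)) p \<and> weak_deriv_per L (u \<tau>) q \<and> weak_deriv_per L q r \<and>
          (AE x in lborel. v \<tau> x + p x = r x + g (u \<tau> x))"
      using solT[of "t + 1"] t unfolding H2_solution_def by auto
    \<comment> \<open>The horizon t + 1 puts t in the interior of the time interval, so the limit is
      two-sided.\<close>
    have "at t within {0<..t + 1} = at t within UNIV"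
      using t by (intro at_within_nhd[where S = "{0<..<t + 1}"]) auto
    then have "((\<lambda>s. Hs_norm 0 L (\<lambda>x. (u s x - u t x) / (s - t) - v t x)) \<longlongrightarrow> 0) (at t)"
      using bspec[OF v(2), of t] t by simp
    then show ?thesis
      using v(1,3) t
      by (intro exI[of _ "v t"] exI[of _ "\<lambda>s. Hs_norm 0 L (\<lambda>x. (u s x - u t x) / (s - t) - v t x)"]) auto
  qed
  \<comment> \<open>The quotient of representatives is the L^2 derivative \<open>v\<close> plus an
    error that enters only through its norm.\<close>
  have split: "integral {0..L} (\<lambda>x. (U s x - U t x) * Y x) / (s - t)
       = (LINT x|per_M L. ((u s x - u t x) / (s - t) - v x) * Y x) + (LINT x|per_M L. v x * Y x)"
    if s: "s \<ge> 0" and t: "t \<ge> 0" and v: "v \<in> Hs_per 0 L" and Y: "continuous_on {0..L} Y" for s t v Y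
  proof -
    note vi = Hs_per_integrable[OF v] and di = Hs_per_integrable[OF Hs_per_diff[OF uH[OF s] uH[OF t]]]
    have "integral {0..L} (\<lambda>x. (U s x - U t x) * Y x) / (s - t)
        = (LINT x|per_M L. (U s x - U t x) * Y x / (s - t))"
      using integral_per_M(2)[of L "\<lambda>x. (U s x - U t x) * Y x"] Y Uc s t by (simp add: continuous_intros)
    also have "\<dots> = (LINT x|per_M L. (u s x - u t x) / (s - t) * Y x)"
    proof (rule integral_cong_AE)
      show "(\<lambda>x. (U s x - U t x) * Y x / (s - t)) \<in> borel_measurable (per_M L)"
        by (intro borel_measurable_divide borel_measurable_times borel_measurable_diff borel_measurable_const continuous_measurable_per_M Uc Y s t)
      show "(\<lambda>x. (u s x - u t x) / (s - t) * Y x) \<in> borel_measurable (per_M L)"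
        by (intro borel_measurable_divide borel_measurable_times borel_measurable_const continuous_measurable_per_M Y borel_measurable_integrable[OF di])
      show "AE x in per_M L. (U s x - U t x) * Y x / (s - t) = (u s x - u t x) / (s - t) * Y x"
        using U(4)[OF s] U(4)[OF t] by eventually_elim auto
    qed
    also have "\<dots> = (LINT x|per_M L. ((u s x - u t x) / (s - t) - v x) * Y x + v x * Y x)"
      by (simp add: algebra_simps)
    also have "\<dots> = (LINT x|per_M L. ((u s x - u t x) / (s - t) - v x) * Y x) + (LINT x|per_M L. v x * Y x)"
      by (intro Bochner_Integration.integral_add integrable_mult_continuous Y vi
          Bochner_Integration.integrable_diff[OF integrable_divide[OF di] vi])
    finally show ?thesis .
  qed
  have dqH: "(\<lambda>x. (u s x - u t x) / (s - t) - v x) \<in> Hs_per 0 L" if "s \<ge> 0" "t \<ge> 0" "v \<in> Hs_per 0 L" for s t v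
    by (intro Hs_per_diff Hs_per_divide Hs2_subset_Hs0 uH that)
  have "regular_solution f g L U Q"
    unfolding regular_solution_def
  proof (intro conjI allI impI)
    fix t e :: real assume t: "t \<ge> 0" and e: "e > 0"
    have "\<forall>\<^sub>F s in at t within {0..}. ?B t s < e"
      using order_tendstoD(2)[OF conv0[OF t] e] .
    moreover have "\<forall>\<^sub>F s in at t within {0..}. s \<in> {0..}"
      by (simp add: eventually_at_filter)
    ultimately show "\<forall>\<^sub>F s in at t within {0..}. \<forall>x\<in>{0..L}. \<bar>U s x - U t x\<bar> \<le> e"
      by eventually_elim (use diff_bound[OF t] in force)
  next
    fix t :: real and Y Y' :: "real \<Rightarrow> real"
    assume t: "t > 0" and "(\<forall>x. (Y has_real_derivative Y' x) (at x)) \<and> continuous_on UNIV Y' \<and> periodic L Y"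
    then have Y: "\<And>x. (Y has_real_derivative Y' x) (at x)" "continuous_on UNIV Y'" "periodic L Y" by auto
    have Y0: "Y 0 = Y L" using Y(3)[unfolded periodic_def, rule_format, of 0] by simp
    have Y'0: "Y' 0 = Y' L"
      using periodic_deriv[OF Y(3,1), unfolded periodic_def, rule_format, of 0] by simp
    have Yc: "continuous_on S Y" "continuous_on S Y'" for S
      by (rule has_real_derivative_continuous_on, rule Y(1), rule continuous_on_subset[OF Y(2) subset_UNIV])
    obtain B where B: "\<And>x. x \<in> {0..L} \<Longrightarrow> \<bar>Y x\<bar> \<le> B"
      using compact_imp_bounded[OF compact_continuous_image[OF Yc(1) compact_Icc, of 0 L]]
      unfolding bounded_iff real_norm_def by (meson image_eqI)
    obtain v N p q r where v: "v \<in> Hs_per 0 L" and N: "(N \<longlongrightarrow> 0) (at t)"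
      "\<And>s. N s = Hs_norm 0 L (\<lambda>x. (u s x - u t x) / (s - t) - v x)"
      and p: "weak_deriv_per L (\<lambda>x. f (u t x)) p" and q: "weak_deriv_per L (u t) q"
      and r: "weak_deriv_per L q r" and eq: "AE x in lborel. v x + p x = r x + g (u t x)"
      using vex[OF t] by blast
    have t0: "t \<ge> 0" using t by simp
    let ?I = "LINT x|per_M L. v x * Y x"
    have "((\<lambda>s. integral {0..L} (\<lambda>x. (U s x - U t x) * Y x) / (s - t) - ?I) \<longlongrightarrow> 0) (at t)"
    proof (rule Lim_null_comparison)
      show "((\<lambda>s. sqrt L * B * N s) \<longlongrightarrow> 0) (at t)"
        using N(1) by (rule tendsto_mult_right_zero)
      show "\<forall>\<^sub>F s in at t. norm (integral {0..L} (\<lambda>x. (U s x - U t x) * Y x) / (s - t) - ?I) \<le> sqrt L * B * N s"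
        using evpos[OF t]
      proof eventually_elim
        case (elim s)
        then have s: "s \<ge> 0" by simp
        show ?case
          unfolding split[OF s t0 v Yc(1)] N(2)
          using integral_le_Hs0_norm[OF L dqH[OF s t0 v] Yc(1) Y0 B] by simp
      qed
    qed
    then have "((\<lambda>s. integral {0..L} (\<lambda>x. (U s x - U t x) * Y x) / (s - t)) \<longlongrightarrow> ?I) (at t)"
      by (simp add: LIM_zero_iff)
    moreover have "?I = integral {0..L} (\<lambda>x. (f (U t x) - Q t x) * Y' x + g (U t x) * Y x)"
    proof -
      note ae = U(4)[OF t0]
      have fU: "continuous_on {0..L} (\<lambda>x. f (U t x))" and gU: "continuous_on {0..L} (\<lambda>x. g (U t x))"
        by (rule continuous_on_compose2[OF fc Uc[OF t0]], simp, rule continuous_on_compose2[OF gc Uc[OF t0]], simp)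
      have Qc: "continuous_on {0..L} (Q t)"
        by (rule continuous_on_subset[OF U(2)[OF t0] subset_UNIV])
      note vi = Hs_per_integrable[OF v] and pi = weak_deriv_integrable(2)[OF p] and ri = weak_deriv_integrable(2)[OF r]
        and qi = weak_deriv_integrable(1)[OF r] and fi = weak_deriv_integrable(1)[OF p]
      have gi: "integrable (per_M L) (\<lambda>x. g (U t x))" by (rule integral_per_M(1)[OF gU])
      have "?I = (LINT x|per_M L. (r x * Y x - p x * Y x) + g (U t x) * Y x)"
      proof (rule integral_cong_AE)
        show "AE x in per_M L. v x * Y x = r x * Y x - p x * Y x + g (U t x) * Y x"
          using AE_per_M[OF eq, of L] ae
        proof eventually_elim
          case (elim x)
          then have vx: "v x = r x - p x + g (U t x)" by simp
          show ?case unfolding vx by (simp add: distrib_right left_diff_distrib)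
        qed
      qed (intro borel_measurable_add borel_measurable_diff borel_measurable_times borel_measurable_integrable
             vi pi ri gi integral_per_M(1) Yc)+
      also have "\<dots> = (LINT x|per_M L. r x * Y x) - (LINT x|per_M L. p x * Y x) + (LINT x|per_M L. g (U t x) * Y x)"
        using integrable_mult_continuous[OF ri Yc(1)] integrable_mult_continuous[OF pi Yc(1)]
          integrable_mult_continuous[OF gi Yc(1)] by simp
      also have "(LINT x|per_M L. r x * Y x) = - (LINT x|per_M L. q x * Y' x)"
        using weak_deriv_C1_test[OF L r Y(1,2) Y0 Y'0] by simp
      also have "(LINT x|per_M L. q x * Y' x) = (LINT x|per_M L. Q t x * Y' x)"
        using weak_deriv_eq_classical[OF L q ae U(1)[OF t0] U(2)[OF t0] U0[OF t0]]
        by (intro integral_cong_AE borel_measurable_times borel_measurable_integrable qi integral_per_M(1) Yc Qc)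
          (auto elim: eventually_mono)
      also have "(LINT x|per_M L. p x * Y x) = - (LINT x|per_M L. f (u t x) * Y' x)"
        using weak_deriv_C1_test[OF L p Y(1,2) Y0 Y'0] by simp
      also have "(LINT x|per_M L. f (u t x) * Y' x) = (LINT x|per_M L. f (U t x) * Y' x)"
        using ae
        by (intro integral_cong_AE borel_measurable_times borel_measurable_integrable[OF fi] borel_measurable_integrable[OF integral_per_M(1)] Yc fU)
          (auto elim: eventually_mono)
      finally have "?I = - (LINT x|per_M L. Q t x * Y' x) - - (LINT x|per_M L. f (U t x) * Y' x)
          + (LINT x|per_M L. g (U t x) * Y x)" .
      also have "\<dots> = (LINT x|per_M L. (f (U t x) * Y' x - Q t x * Y' x) + g (U t x) * Y x)"
        using integral_per_M(1)[OF continuous_on_mult[OF fU Yc(2)]] integral_per_M(1)[OF continuous_on_mult[OF Qc Yc(2)]]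
          integral_per_M(1)[OF continuous_on_mult[OF gU Yc(1)]] by simp
      also have "\<dots> = integral {0..L} (\<lambda>x. (f (U t x) * Y' x - Q t x * Y' x) + g (U t x) * Y x)"
        by (intro integral_per_M(2) continuous_intros Qc Yc fU gU)
      finally show ?thesis by (simp add: left_diff_distrib)
    qed
    ultimately show "((\<lambda>s. integral {0..L} (\<lambda>x. (U s x - U t x) * Y x) / (s - t)) \<longlongrightarrow>
           integral {0..L} (\<lambda>x. (f (U t x) - Q t x) * Y' x + g (U t x) * Y x)) (at t)"
      by simp
  next
    fix t :: real assume t: "t > 0"
    then have t0: "t \<ge> 0" by simp
    obtain v N where v: "v \<in> Hs_per 0 L" and N: "(N \<longlongrightarrow> 0) (at t)"
      "\<And>s. N s = Hs_norm 0 L (\<lambda>x. (u s x - u t x) / (s - t) - v x)"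
      using vex[OF t] by blast
    let ?V = "LINT x|per_M L. \<bar>v x\<bar>"
    show "((\<lambda>s. integral {0..L} (\<lambda>x. (U s x - U t x)\<^sup>2) / (s - t)) \<longlongrightarrow> 0) (at t)"
    proof (rule Lim_null_comparison)
      have "((\<lambda>s. ?B t s * (sqrt L * N s + ?V)) \<longlongrightarrow> 0 * (sqrt L * 0 + ?V)) (at t)"
        by (intro tendsto_intros conv t N(1))
      then show "((\<lambda>s. ?B t s * (sqrt L * N s + ?V)) \<longlongrightarrow> 0) (at t)" by simp
      show "\<forall>\<^sub>F s in at t. norm (integral {0..L} (\<lambda>x. (U s x - U t x)\<^sup>2) / (s - t)) \<le> ?B t s * (sqrt L * N s + ?V)"
        using evpos[OF t]
      proof eventually_elim
        case (elim s)
        then have s: "s \<ge> 0" by simp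
        \<comment> \<open>The increment itself serves as test function, which turns the square into
          a pairing with the difference quotient.\<close>
        let ?Y = "\<lambda>x. U s x - U t x"
        have Yc: "continuous_on {0..L} ?Y" by (intro continuous_intros Uc s t0)
        have Y0: "?Y 0 = ?Y L" using U0[OF s] U0[OF t0] by simp
        have B: "\<bar>?Y x\<bar> \<le> ?B t s" if "x \<in> {0..L}" for x
          using diff_bound[OF t0 s that] .
        have "norm (integral {0..L} (\<lambda>x. (U s x - U t x)\<^sup>2) / (s - t))
          \<le> \<bar>LINT x|per_M L. ((u s x - u t x) / (s - t) - v x) * ?Y x\<bar> + \<bar>LINT x|per_M L. v x * ?Y x\<bar>"
          unfolding power2_eq_square split[OF s t0 v Yc] real_norm_def by (rule abs_triangle_ineq)
        also have "\<dots> \<le> sqrt L * ?B t s * N s + ?B t s * ?V"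
          using integral_le_Hs0_norm[OF L dqH[OF s t0 v] Yc Y0 B]
            integral_abs_mult_bound[OF Hs_per_integrable[OF v] Yc, of "?B t s"] B
          unfolding N(2) by (intro add_mono) auto
        finally show ?case by (simp add: algebra_simps)
      qed
    qed
  qed (use U in auto)
  then show ?thesis using that uH U(4) by blast
qed

section \<open>Periodic reduction and elementary calculus estimates\<close>

lemma periodic_shift_nat: "periodic L h \<Longrightarrow> h (x + real n * L) = h x"
proof (induction n)
  case (Suc n)
  have "h (x + real (Suc n) * L) = h ((x + real n * L) + L)" by (simp add: algebra_simps)
  then show ?case using Suc by (simp add: periodic_def)
qed simp

lemma periodic_shift_int:
  assumes "periodic L h"
  shows "h (x + of_int n * L) = h x"
proof (cases "n \<ge> 0")
  case True
  then show ?thesis using periodic_shift_nat[OF assms, of x "nat n"] by simp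
next
  case False
  then show ?thesis using periodic_shift_nat[OF assms, of "x + of_int n * L" "nat (- n)"] by simp
qed

lemma floor_shift_in_window:
  assumes L: "L > 0"
  shows "x - of_int \<lfloor>(x - a) / L\<rfloor> * L \<in> {a..<a + L}"
proof -
  define n where "n = \<lfloor>(x - a) / L\<rfloor>"
  have "of_int n \<le> (x - a) / L" "(x - a) / L < of_int n + 1"
    unfolding n_def by linarith+
  then have "of_int n * L \<le> x - a" "x - a < (of_int n + 1) * L"
    using L by (simp_all add: field_simps)
  then show ?thesis unfolding n_def[symmetric] by (auto simp: algebra_simps)
qed

lemma periodic_reduce:
  assumes L: "L > 0" and per: "periodic L h"
  obtains y where "y \<in> {a..<a + L}" "h x = h y"
proof -
  define n where "n = \<lfloor>(x - a) / L\<rfloor>"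
  show ?thesis
    using that[of "x - of_int n * L"] floor_shift_in_window[OF L, of x a]
      periodic_shift_int[OF per, of "x - of_int n * L" n] by (simp add: n_def)
qed

lemma periodic_bounded:
  fixes h :: "real \<Rightarrow> real"
  assumes L: "L > 0" and per: "periodic L h" and c: "continuous_on UNIV h"
  obtains B where "B > 0" "\<And>x. \<bar>h x\<bar> \<le> B"
proof -
  obtain B where B: "B > 0" "\<And>x. x \<in> {0..L} \<Longrightarrow> \<bar>h x\<bar> \<le> B"
    using compact_imp_bounded[OF compact_continuous_image[OF continuous_on_subset[OF c subset_UNIV] compact_Icc, of 0 L]]
    unfolding bounded_pos real_norm_def by (metis image_eqI)
  have "\<bar>h x\<bar> \<le> B" for x
    by (rule periodic_reduce[OF L per, of 0 x]) (use B(2) in auto)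
  then show ?thesis using that B(1) by blast
qed

text \<open>The mean value inequality for y \<mapsto> H (x + y) - y H' x, whose derivative is at
  most B |y|; this route gives B in place of B / 2.\<close>

lemma quadratic_remainder:
  assumes H: "\<And>x. (H has_real_derivative H' x) (at x)" "\<And>x. (H' has_real_derivative H'' x) (at x)"
    and B: "\<And>x. \<bar>H'' x\<bar> \<le> B"
  shows "\<bar>H (x + d) - H x - d * H' x\<bar> \<le> B * d\<^sup>2"
proof -
  have lip: "\<bar>H' (x + y) - H' x\<bar> \<le> B * \<bar>y\<bar>" for y
    using field_differentiable_bound[where f = H' and f' = H'' and S = UNIV and B = B and x = "x + y" and y = x] H(2) B
    by (auto intro: has_field_derivative_at_within)
  have "norm ((H (x + d) - d * H' x) - (H (x + 0) - 0 * H' x)) \<le> (B * \<bar>d\<bar>) * norm (d - 0)"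
  proof (rule field_differentiable_bound[where S = "closed_segment 0 d" and f' = "\<lambda>y. H' (x + y) - H' x"])
    fix y assume y: "y \<in> closed_segment 0 d"
    have "((\<lambda>y. H (x + y)) has_real_derivative H' (x + y) * 1) (at y)"
      by (rule DERIV_chain2[OF H(1)]) (auto intro!: derivative_eq_intros)
    then have "((\<lambda>y. H (x + y) - y * H' x) has_real_derivative H' (x + y) - H' x) (at y)"
      by (auto intro!: derivative_eq_intros)
    then show "((\<lambda>y. H (x + y) - y * H' x) has_real_derivative H' (x + y) - H' x) (at y within closed_segment 0 d)"
      by (rule has_field_derivative_at_within)
    have "\<bar>y\<bar> \<le> \<bar>d\<bar>" using y by (auto simp: closed_segment_eq_real_ivl split: if_splits)
    moreover have "B \<ge> 0" using B[of 0] by linarith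
    ultimately have "B * \<bar>y\<bar> \<le> B * \<bar>d\<bar>" by (rule mult_left_mono)
    then show "norm (H' (x + y) - H' x) \<le> B * \<bar>d\<bar>" using lip[of y] by simp
  qed auto
  then show ?thesis by (simp add: power2_eq_square algebra_simps)
qed

lemma C1_lipschitz_bounded:
  fixes h :: "real \<Rightarrow> real"
  assumes h: "\<And>x. (h has_real_derivative h' x) (at x)" and c: "continuous_on UNIV h'"
  obtains K where "K \<ge> 0" "\<And>a b. \<bar>a\<bar> \<le> R \<Longrightarrow> \<bar>b\<bar> \<le> R \<Longrightarrow> \<bar>h a - h b\<bar> \<le> K * \<bar>a - b\<bar>"
proof -
  obtain K where K: "K > 0" "\<And>x. x \<in> {-R..R} \<Longrightarrow> \<bar>h' x\<bar> \<le> K"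
    using compact_imp_bounded[OF compact_continuous_image[OF continuous_on_subset[OF c subset_UNIV] compact_Icc, of "-R" R]]
    unfolding bounded_pos real_norm_def by (metis image_eqI)
  have "\<bar>h a - h b\<bar> \<le> K * \<bar>a - b\<bar>" if "\<bar>a\<bar> \<le> R" "\<bar>b\<bar> \<le> R" for a b
    using field_differentiable_bound[where f = h and f' = h' and S = "{-R..R}" and B = K and x = a and y = b]
      h[THEN has_field_derivative_at_within] K that
    by (simp add: abs_le_iff)
  then show ?thesis using that[of K] K(1) by auto
qed

text \<open>Uniform continuity of h' on a compact interval makes the error a small multiple of v.
  This asks no second derivative of h, and it is the form that a strict subsolution can
  absorb.\<close>

lemma C1_uniform_linearization:
  fixes h :: "real \<Rightarrow> real"
  assumes h: "\<And>x. (h has_real_derivative h' x) (at x)" and c: "continuous_on UNIV h'" and e: "e > 0"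
  obtains d where "d > 0" "\<And>y v. \<bar>y\<bar> \<le> R \<Longrightarrow> 0 \<le> v \<Longrightarrow> v \<le> d \<Longrightarrow> \<bar>h (y + v) - h y - h' y * v\<bar> \<le> e * v"
proof -
  have "uniformly_continuous_on {-R - 1..R + 1} h'"
    by (rule compact_uniformly_continuous[OF continuous_on_subset[OF c subset_UNIV] compact_Icc])
  then obtain d where d: "d > 0"
      "\<And>x y. x \<in> {-R - 1..R + 1} \<Longrightarrow> y \<in> {-R - 1..R + 1} \<Longrightarrow> dist y x < d \<Longrightarrow> dist (h' y) (h' x) < e"
    unfolding uniformly_continuous_on_def using e by metis
  \<comment> \<open>The 1 keeps y + v inside the enlarged interval, and d / 2 yields the strict
    inequality in the modulus of continuity.\<close>
  have "\<bar>h (y + v) - h y - h' y * v\<bar> \<le> e * v" if y: "\<bar>y\<bar> \<le> R" and v: "0 \<le> v" "v \<le> min 1 (d / 2)" for y v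
  proof (cases "v = 0")
    case False
    then have "y < y + v" using v by simp
    then obtain z where z: "y < z" "z < y + v" "h (y + v) - h y = (y + v - y) * h' z"
      using MVT2[of y "y + v" h h'] h by blast
    have "dist (h' z) (h' y) < e"
      using z y v d(1) by (intro d(2)) (auto simp: dist_real_def)
    then have "\<bar>h' z - h' y\<bar> * v \<le> e * v"
      using v(1) by (intro mult_right_mono) (auto simp: dist_real_def)
    then show ?thesis
      using z(3) v(1) by (simp add: abs_mult[symmetric] algebra_simps) (metis abs_mult abs_of_nonneg left_diff_distrib mult.commute)
  qed simp
  then show ?thesis using that[of "min 1 (d / 2)"] d(1) by auto
qed

text \<open>At the junction 0 the quadratic bound sends the difference quotient from the right to 0,
  in agreement with the zero branch on the left.\<close>

lemma pos_part_deriv_glue: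
  assumes pos: "\<And>s. s > 0 \<Longrightarrow> (F has_real_derivative F' s) (at s)"
    and neg: "\<And>s. s \<le> 0 \<Longrightarrow> F s = 0 \<and> F' s = 0"
    and small: "\<And>s. s > 0 \<Longrightarrow> \<bar>F s\<bar> \<le> C * s\<^sup>2"
  shows "(F has_real_derivative F' s) (at s)"
proof -
  consider "s > 0" | "s < 0" | "s = 0" by linarith
  then show ?thesis
  proof cases
    case 2
    have ev: "eventually (\<lambda>z. 0 = F z) (nhds s)"
      using eventually_nhds_in_open[of "{..<0}" s] 2 neg by (auto elim!: eventually_mono)
    show ?thesis
      using DERIV_cong_ev[OF refl ev, of 0 0] 2 neg[of s] by simp
  next
    case 3
    have "((\<lambda>h. F h / h) \<longlongrightarrow> 0) (at 0)"
    proof (rule Lim_null_comparison)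
      have "norm (F h / h) \<le> \<bar>C\<bar> * \<bar>h\<bar>" for h
      proof (cases "h > 0")
        case True
        then have "\<bar>F h\<bar> / h \<le> C * h\<^sup>2 / h" using small by (intro divide_right_mono) auto
        also have "\<dots> \<le> \<bar>C\<bar> * \<bar>h\<bar>" using True by (simp add: power2_eq_square)
        finally show ?thesis using True by simp
      next
        case False
        then have "F h / h = 0" using neg[of h] by simp
        then show ?thesis by (simp only: norm_zero) (intro mult_nonneg_nonneg abs_ge_zero)
      qed
      then show "\<forall>\<^sub>F h in at 0. norm (F h / h) \<le> \<bar>C\<bar> * \<bar>h\<bar>" by simp
      show "((\<lambda>h. \<bar>C\<bar> * \<bar>h\<bar>) \<longlongrightarrow> 0) (at 0)" by (auto intro!: tendsto_eq_intros)
    qed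
    then show ?thesis using 3 neg[of 0] by (simp add: has_field_derivative_iff)
  qed (rule pos)
qed

lemma max0_square_has_derivative:
  "((\<lambda>y::real. (max 0 y)\<^sup>2) has_real_derivative 2 * max 0 y) (at y)"
proof (rule pos_part_deriv_glue[where C = 1])
  fix s :: real assume s: "s > 0"
  have ev: "eventually (\<lambda>z. z\<^sup>2 = (max 0 z)\<^sup>2) (nhds s)"
    using eventually_nhds_in_open[of "{0<..}" s] s by (auto elim!: eventually_mono)
  have "((\<lambda>y::real. y\<^sup>2) has_real_derivative 2 * s) (at s)"
    by (auto intro!: derivative_eq_intros)
  then show "((\<lambda>y. (max 0 y)\<^sup>2) has_real_derivative 2 * max 0 s) (at s)"
    using DERIV_cong_ev[OF refl ev refl] s by simp
qed auto

text \<open>The second derivative 6 max(0, s) is at most 6 M on the range, whence the constant 3 M.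
  The proof uses an explicit factorisation of the remainder for each pattern of signs.\<close>

lemma cube_pos_part_remainder:
  fixes a b M :: real
  assumes "\<bar>a\<bar> \<le> M" "\<bar>b\<bar> \<le> M"
  shows "\<bar>(max 0 b)^3 - (max 0 a)^3 - 3 * (max 0 a)\<^sup>2 * (b - a)\<bar> \<le> 3 * M * (b - a)\<^sup>2"
proof -
  have M: "M \<ge> 0" using assms by linarith
  consider "a \<ge> 0" "b \<ge> 0" | "a \<ge> 0" "b < 0" | "a < 0" "b \<ge> 0" | "a < 0" "b < 0" by linarith
  then show ?thesis
  proof cases
    case 1
    have e: "(max 0 b)^3 - (max 0 a)^3 - 3 * (max 0 a)\<^sup>2 * (b - a) = (b + 2 * a) * (b - a)\<^sup>2"
      using 1 by (simp add: max_def power2_eq_square power3_eq_cube algebra_simps)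
    have "\<bar>(b + 2 * a) * (b - a)\<^sup>2\<bar> = (b + 2 * a) * (b - a)\<^sup>2" using 1 by (simp add: abs_mult)
    also have "\<dots> \<le> 3 * M * (b - a)\<^sup>2" using assms by (intro mult_right_mono) auto
    finally show ?thesis unfolding e .
  next
    case 2
    have e: "(max 0 b)^3 - (max 0 a)^3 - 3 * (max 0 a)\<^sup>2 * (b - a) = a * (a * (2 * a + 3 * (- b)))"
      using 2 by (simp add: max_def power2_eq_square power3_eq_cube algebra_simps)
    have "\<bar>a * (a * (2 * a + 3 * (- b)))\<bar> = a * (a * (2 * a + 3 * (- b)))" using 2 by (intro abs_of_nonneg mult_nonneg_nonneg) auto
    also have "\<dots> \<le> M * (3 * (b - a)\<^sup>2)"
    proof (rule mult_mono)
      have "0 \<le> a * a + 3 * (b * b) - 3 * (a * b)" using 2 mult_nonneg_nonpos[of a b] zero_le_square[of a] zero_le_square[of b] by linarith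
      then show "a * (2 * a + 3 * (- b)) \<le> 3 * (b - a)\<^sup>2"
        by (simp add: power2_eq_square algebra_simps)
    qed (use 2 M assms in auto)
    finally show ?thesis unfolding e by (simp add: mult_ac)
  next
    case 3
    have e: "(max 0 b)^3 - (max 0 a)^3 - 3 * (max 0 a)\<^sup>2 * (b - a) = b * b\<^sup>2"
      using 3 by (simp add: max_def power2_eq_square power3_eq_cube)
    have "\<bar>b * b\<^sup>2\<bar> = b * b\<^sup>2" using 3 by (simp add: abs_mult)
    also have "\<dots> \<le> (3 * M) * (b - a)\<^sup>2"
      using 3 assms by (intro mult_mono power_mono) auto
    finally show ?thesis unfolding e .
  qed (use M in auto)
qed

lemma cube_pos_part_lipschitz:
  fixes a b M :: real
  assumes "\<bar>a\<bar> \<le> M" "\<bar>b\<bar> \<le> M"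
  shows "\<bar>(max 0 b)^3 - (max 0 a)^3\<bar> \<le> 3 * M\<^sup>2 * \<bar>b - a\<bar>"
proof -
  define p where "p = max 0 b" define q where "q = max 0 a"
  have pq: "0 \<le> p" "p \<le> M" "0 \<le> q" "q \<le> M" using assms unfolding p_def q_def by auto
  have "p^3 - q^3 = (p * p + p * q + q * q) * (p - q)"
    by (simp add: power3_eq_cube algebra_simps)
  then have "\<bar>p^3 - q^3\<bar> = (p * p + p * q + q * q) * \<bar>p - q\<bar>"
    using pq by (simp add: abs_mult)
  also have "\<dots> \<le> (3 * M\<^sup>2) * \<bar>b - a\<bar>"
  proof (rule mult_mono)
    have "p * p \<le> M * M" "p * q \<le> M * M" "q * q \<le> M * M" using pq by (auto intro: mult_mono)
    then show "p * p + p * q + q * q \<le> 3 * M\<^sup>2" by (simp add: power2_eq_square)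
    show "\<bar>p - q\<bar> \<le> \<bar>b - a\<bar>" unfolding p_def q_def by auto
  qed auto
  finally show ?thesis unfolding p_def q_def .
qed

lemma gronwall:
  fixes F :: "real \<Rightarrow> real"
  assumes T: "T \<ge> 0" and c: "continuous_on {0..T} F"
    and d: "\<And>t. 0 < t \<Longrightarrow> t < T \<Longrightarrow> \<exists>D. (F has_real_derivative D) (at t) \<and> D \<le> K * F t"
  shows "F T \<le> F 0 * exp (K * T)"
proof (cases "T = 0")
  case False
  then have T: "0 < T" using T by simp
  have "F T * exp (- K * T) \<le> F 0 * exp (- K * 0)"
  proof (rule DERIV_nonpos_imp_decreasing_open[OF less_imp_le[OF T]])
    fix t assume t: "0 < t" "t < T"
    then obtain D where D: "(F has_real_derivative D) (at t)" "D \<le> K * F t" using d by blast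
    have "((\<lambda>t. F t * exp (- K * t)) has_real_derivative (D - K * F t) * exp (- K * t)) (at t)"
      using D(1) by (auto intro!: derivative_eq_intros simp: algebra_simps)
    moreover have "(D - K * F t) * exp (- K * t) \<le> 0"
      using D(2) by (intro mult_nonpos_nonneg) auto
    ultimately show "\<exists>y. ((\<lambda>t. F t * exp (- K * t)) has_real_derivative y) (at t) \<and> y \<le> 0" by blast
  qed (intro continuous_intros c)
  then have "F T * exp (- K * T) * exp (K * T) \<le> F 0 * exp (K * T)"
    by (intro mult_right_mono) auto
  then show ?thesis by (simp add: mult.assoc exp_add[symmetric])
qed simp

section \<open>Perturbations of a periodic travelling wave\<close>

lemma integral_abs_le:
  fixes h :: "real \<Rightarrow> real"
  assumes L: "L > 0" and h: "continuous_on {0..L} h" and B: "\<And>x. x \<in> {0..L} \<Longrightarrow> \<bar>h x\<bar> \<le> B"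
  shows "\<bar>integral {0..L} h\<bar> \<le> B * L"
  using integral_bound[of 0 L h B] L h B by simp

lemma integral_diff_continuous:
  fixes u v :: "real \<Rightarrow> real"
  assumes "continuous_on {a..b} u" "continuous_on {a..b} v"
  shows "integral {a..b} (\<lambda>x. u x - v x) = integral {a..b} u - integral {a..b} v"
  by (intro Henstock_Kurzweil_Integration.integral_diff integrable_continuous_interval assms)

lemma integral_add_continuous:
  fixes u v :: "real \<Rightarrow> real"
  assumes "continuous_on {a..b} u" "continuous_on {a..b} v"
  shows "integral {a..b} (\<lambda>x. u x + v x) = integral {a..b} u + integral {a..b} v"
  by (intro Henstock_Kurzweil_Integration.integral_add integrable_continuous_interval assms)

lemma continuous_shift: "continuous_on UNIV h \<Longrightarrow> continuous_on S (\<lambda>x. h (x - a))" for h :: "real \<Rightarrow> real"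
  by (rule continuous_on_compose2[of UNIV h]) (auto intro!: continuous_intros)

lemma shift_has_derivative:
  assumes "\<And>x. (H has_real_derivative H' x) (at x)"
  shows "((\<lambda>x. H (x - a)) has_real_derivative H' (x - a)) (at x)"
proof -
  have "((\<lambda>x. H (x - a)) has_real_derivative H' (x - a) * 1) (at x)"
    by (rule DERIV_chain2[OF assms]) (auto intro!: derivative_eq_intros)
  then show ?thesis by simp
qed

lemma translation_lipschitz:
  assumes H: "\<And>x. (H has_real_derivative H' x) (at x)" and B: "\<And>x. \<bar>H' x\<bar> \<le> B"
  shows "\<bar>H (x - c * s) - H (x - c * t)\<bar> \<le> B * \<bar>c\<bar> * \<bar>s - t\<bar>"
proof -
  have "norm (H (x - c * s) - H (x - c * t)) \<le> B * norm ((x - c * s) - (x - c * t))"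
    by (rule field_differentiable_bound[where S = UNIV and f' = H'])
      (use H[THEN has_field_derivative_at_within] B in auto)
  also have "norm ((x - c * s) - (x - c * t)) = \<bar>c\<bar> * \<bar>s - t\<bar>"
    by (simp add: abs_mult[symmetric] right_diff_distrib abs_minus_commute)
  finally show ?thesis by (simp add: mult.assoc)
qed

text \<open>\<open>quadratic_remainder\<close> makes the error of the difference quotient O(|s - t|)
  uniformly in x. The lemma serves for the moving wave and for the moving weight.\<close>

lemma translation_integral_derivative:
  assumes L: "L > 0"
    and H: "\<And>x. (H has_real_derivative H' x) (at x)" "\<And>x. (H' has_real_derivative H'' x) (at x)"
    and B: "\<And>x. \<bar>H'' x\<bar> \<le> B" and Y: "continuous_on {0..L} Y"
  shows "((\<lambda>s. integral {0..L} (\<lambda>x. (H (x - c * s) - H (x - c * t)) * Y x) / (s - t))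
      \<longlongrightarrow> integral {0..L} (\<lambda>x. - c * H' (x - c * t) * Y x)) (at t)"
proof -
  obtain M where M: "\<And>x. x \<in> {0..L} \<Longrightarrow> \<bar>Y x\<bar> \<le> M"
    using compact_imp_bounded[OF compact_continuous_image[OF Y compact_Icc]]
    unfolding bounded_iff real_norm_def by (meson image_eqI)
  have Hc: "continuous_on UNIV H" "continuous_on UNIV H'"
    using H by (auto intro: has_real_derivative_continuous_on)
  note sc = continuous_shift[OF Hc(1)] continuous_shift[OF Hc(2)]
  have B0: "B \<ge> 0" using B[of 0] by linarith
  let ?A = "\<lambda>s. integral {0..L} (\<lambda>x. (H (x - c * s) - H (x - c * t)) * Y x) / (s - t)"
  let ?I = "integral {0..L} (\<lambda>x. - c * H' (x - c * t) * Y x)"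
  have "((\<lambda>s. ?A s - ?I) \<longlongrightarrow> 0) (at t)"
  proof (rule Lim_null_comparison)
    have "((\<lambda>s. B * c\<^sup>2 * \<bar>s - t\<bar> * M * L) \<longlongrightarrow> B * c\<^sup>2 * \<bar>t - t\<bar> * M * L) (at t)"
      by (intro tendsto_intros)
    then show "((\<lambda>s. B * c\<^sup>2 * \<bar>s - t\<bar> * M * L) \<longlongrightarrow> 0) (at t)" by simp
    show "\<forall>\<^sub>F s in at t. norm (?A s - ?I) \<le> B * c\<^sup>2 * \<bar>s - t\<bar> * M * L"
    proof -
      have "norm (?A s - ?I) \<le> B * c\<^sup>2 * \<bar>s - t\<bar> * M * L" if st: "s \<noteq> t" for s
      proof -
        let ?h = "\<lambda>x. ((H (x - c * s) - H (x - c * t)) - (s - t) * (- c * H' (x - c * t))) * Y x"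
        have hc: "continuous_on {0..L} ?h"
          by (intro continuous_intros sc Y)
        have "integral {0..L} ?h = integral {0..L} (\<lambda>x. (H (x - c * s) - H (x - c * t)) * Y x
            - (s - t) * (- c * H' (x - c * t) * Y x))"
          by (simp add: algebra_simps)
        also have "\<dots> = integral {0..L} (\<lambda>x. (H (x - c * s) - H (x - c * t)) * Y x)
            - integral {0..L} (\<lambda>x. (s - t) * (- c * H' (x - c * t) * Y x))"
          by (intro integral_diff_continuous continuous_intros sc Y)
        finally have eq: "?A s - ?I = integral {0..L} ?h / (s - t)"
          using st by (simp only: integral_mult_right diff_divide_distrib) simp
        have "\<bar>?h x\<bar> \<le> (B * c\<^sup>2 * (s - t)\<^sup>2) * M" if x: "x \<in> {0..L}" for x
        proof -
          have "\<bar>H ((x - c * t) + (c * t - c * s)) - H (x - c * t) - (c * t - c * s) * H' (x - c * t)\<bar> \<le> B * (c * t - c * s)\<^sup>2"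
            by (rule quadratic_remainder[OF H B])
          then have "\<bar>(H (x - c * s) - H (x - c * t)) - (s - t) * (- c * H' (x - c * t))\<bar> \<le> B * c\<^sup>2 * (s - t)\<^sup>2"
            by (simp add: power2_eq_square algebra_simps)
          then show ?thesis
            unfolding abs_mult[of _ "Y x"] using M[OF x] B0 by (intro mult_mono) auto
        qed
        then have "\<bar>integral {0..L} ?h\<bar> \<le> (B * c\<^sup>2 * (s - t)\<^sup>2) * M * L"
          by (rule integral_abs_le[OF L hc])
        then have "\<bar>integral {0..L} ?h\<bar> / \<bar>s - t\<bar> \<le> ((B * c\<^sup>2 * (s - t)\<^sup>2) * M * L) / \<bar>s - t\<bar>"
          by (rule divide_right_mono) simp
        also have "\<dots> = B * c\<^sup>2 * \<bar>s - t\<bar> * M * L"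
          using st by (simp add: field_simps power2_eq_square)
        finally show ?thesis unfolding eq by simp
      qed
      then show ?thesis
        by (auto simp: eventually_at_filter intro: always_eventually)
    qed
  qed
  then show ?thesis by (rule LIM_zero_cancel)
qed

section \<open>A periodic wave profile and its weak equation\<close>

locale periodic_wave =
  fixes f g f' g' \<phi> \<phi>' \<phi>'' :: "real \<Rightarrow> real" and c L :: real
  assumes L_pos: "L > 0"
    and f_deriv: "\<And>y. (f has_real_derivative f' y) (at y)" and f'_cont: "continuous_on UNIV f'"
    and g_deriv: "\<And>y. (g has_real_derivative g' y) (at y)" and g'_cont: "continuous_on UNIV g'"
    and \<phi>_deriv: "\<And>x. (\<phi> has_real_derivative \<phi>' x) (at x)"
    and \<phi>'_deriv: "\<And>x. (\<phi>' has_real_derivative \<phi>'' x) (at x)" and \<phi>''_cont: "continuous_on UNIV \<phi>''"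
    and \<phi>_per: "periodic L \<phi>"
    and profile: "\<And>x. \<phi>'' x + (c - f' (\<phi> x)) * \<phi>' x + g (\<phi> x) = 0"
begin

lemma f_cont: "continuous_on S f" and g_cont: "continuous_on S g"
  and \<phi>_cont: "continuous_on S \<phi>" and \<phi>'_cont: "continuous_on S \<phi>'"
  by (rule has_real_derivative_continuous_on, rule f_deriv g_deriv \<phi>_deriv \<phi>'_deriv)+

lemma f_compose: "continuous_on S h \<Longrightarrow> continuous_on S (\<lambda>x. f (h x))"
  and g_compose: "continuous_on S h \<Longrightarrow> continuous_on S (\<lambda>x. g (h x))"
  and f'_compose: "continuous_on S h \<Longrightarrow> continuous_on S (\<lambda>x. f' (h x))"
  and g'_compose: "continuous_on S h \<Longrightarrow> continuous_on S (\<lambda>x. g' (h x))"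
  by (erule continuous_on_compose2[OF f_cont _ subset_UNIV] continuous_on_compose2[OF g_cont _ subset_UNIV]
      continuous_on_compose2[OF f'_cont _ subset_UNIV] continuous_on_compose2[OF g'_cont _ subset_UNIV])+

lemma \<phi>'_per: "periodic L \<phi>'"
  using periodic_deriv[OF \<phi>_per \<phi>_deriv] .

lemma \<phi>''_per: "periodic L \<phi>''"
  using periodic_deriv[OF \<phi>'_per \<phi>'_deriv] .

lemma shift_per_eq: "periodic L h \<Longrightarrow> h (0 - a) = h (L - a)" for h :: "real \<Rightarrow> real"
  unfolding periodic_def by (metis add.commute add_uminus_conv_diff diff_0)

text \<open>Brings the moving wave into the form of the weak clause of
  \<open>regular_solution\<close>, so that one can be subtracted from the other.\<close>

lemma wave_weak:
  assumes Y: "\<And>x. (Y has_real_derivative Y' x) (at x)" "continuous_on UNIV Y'" "periodic L Y"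
  shows "integral {0..L} (\<lambda>x. - c * \<phi>' (x - c * t) * Y x)
     = integral {0..L} (\<lambda>x. (f (\<phi> (x - c * t)) - \<phi>' (x - c * t)) * Y' x + g (\<phi> (x - c * t)) * Y x)"
proof -
  let ?y = "\<lambda>x. x - c * t"
  \<comment> \<open>Flux of the wave times the test function. By the profile equation its derivative
    is the difference of the two integrands, and its endpoint values agree.\<close>
  let ?G = "\<lambda>x. (f (\<phi> (?y x)) - \<phi>' (?y x)) * Y x"
  let ?l = "\<lambda>x. - c * \<phi>' (?y x) * Y x"
  let ?r = "\<lambda>x. (f (\<phi> (?y x)) - \<phi>' (?y x)) * Y' x + g (\<phi> (?y x)) * Y x"
  note sc = continuous_shift[OF \<phi>_cont] continuous_shift[OF \<phi>'_cont]
  have Yc: "continuous_on S Y" "continuous_on S Y'" for S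
    by (rule has_real_derivative_continuous_on, rule Y(1), rule continuous_on_subset[OF Y(2) subset_UNIV])
  have "(?G has_real_derivative ?r x - ?l x) (at x)" for x
  proof -
    have "((\<lambda>x. f (\<phi> (?y x))) has_real_derivative f' (\<phi> (?y x)) * \<phi>' (?y x)) (at x)"
      by (rule DERIV_chain2[OF f_deriv shift_has_derivative[OF \<phi>_deriv]])
    then have "(?G has_real_derivative (f' (\<phi> (?y x)) * \<phi>' (?y x) - \<phi>'' (?y x)) * Y x
        + (f (\<phi> (?y x)) - \<phi>' (?y x)) * Y' x) (at x)"
      by (auto intro!: derivative_eq_intros Y(1) shift_has_derivative[OF \<phi>'_deriv])
    moreover have "f' (\<phi> (?y x)) * \<phi>' (?y x) - \<phi>'' (?y x) = c * \<phi>' (?y x) + g (\<phi> (?y x))"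
      using profile[of "?y x"] by (simp add: algebra_simps)
    ultimately show ?thesis by (simp add: algebra_simps)
  qed
  then have "((\<lambda>x. ?r x - ?l x) has_integral (?G L - ?G 0)) {0..L}"
    using L_pos
    by (intro fundamental_theorem_of_calculus)
      (auto simp: has_real_derivative_iff_has_vector_derivative[symmetric] intro: has_field_derivative_at_within)
  moreover have "?G L = ?G 0"
    using shift_per_eq[OF \<phi>_per, of "c * t"] shift_per_eq[OF \<phi>'_per, of "c * t"] Y(3)[unfolded periodic_def, rule_format, of 0] by simp
  ultimately have "integral {0..L} (\<lambda>x. ?r x - ?l x) = 0"
    by (simp add: integral_unique)
  moreover have "integral {0..L} (\<lambda>x. ?r x - ?l x) = integral {0..L} ?r - integral {0..L} ?l"
    by (intro integral_diff_continuous continuous_intros sc Yc f_compose g_compose)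
  ultimately show ?thesis by simp
qed

end

section \<open>The difference between a solution and the wave\<close>

locale perturbed_wave = periodic_wave +
  fixes U Q :: "real \<Rightarrow> real \<Rightarrow> real"
  assumes regular: "regular_solution f g L U Q"
begin

text \<open>The fixed frame is kept, so that the time regularity of \<open>U\<close> applies as it
  stands; the smooth wave, and later the smooth weight, are moved instead.\<close>

definition V :: "real \<Rightarrow> real \<Rightarrow> real" where "V t x = U t x - \<phi> (x - c * t)"
definition V' :: "real \<Rightarrow> real \<Rightarrow> real" where "V' t x = Q t x - \<phi>' (x - c * t)"

lemma U_deriv: "t \<ge> 0 \<Longrightarrow> (U t has_real_derivative Q t x) (at x)"
  and Q_cont: "t \<ge> 0 \<Longrightarrow> continuous_on UNIV (Q t)"
  and U_per: "t \<ge> 0 \<Longrightarrow> periodic L (U t)"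
  using regular unfolding regular_solution_def by auto

lemma U_cont: "t \<ge> 0 \<Longrightarrow> continuous_on S (U t)"
  using U_deriv by (auto intro: has_real_derivative_continuous_on)

lemma V_deriv: "t \<ge> 0 \<Longrightarrow> (V t has_real_derivative V' t x) (at x)"
  unfolding V_def[abs_def] V'_def
  by (intro DERIV_diff U_deriv shift_has_derivative[OF \<phi>_deriv])

lemma V'_cont: "t \<ge> 0 \<Longrightarrow> continuous_on S (V' t)"
  unfolding V'_def[abs_def]
  by (intro continuous_intros continuous_on_subset[OF Q_cont subset_UNIV] continuous_shift[OF \<phi>'_cont])

lemma V_cont: "t \<ge> 0 \<Longrightarrow> continuous_on S (V t)"
  using V_deriv by (auto intro: has_real_derivative_continuous_on)

lemma V_per: "t \<ge> 0 \<Longrightarrow> periodic L (V t)"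
  using U_per \<phi>_per unfolding V_def periodic_def
  by (simp add: diff_add_eq[symmetric])

lemma V_time_continuous:
  assumes t: "t \<ge> 0" and e: "e > 0"
  shows "\<forall>\<^sub>F s in at t within {0..}. \<forall>x\<in>{0..L}. \<bar>V s x - V t x\<bar> \<le> e"
proof -
  obtain B where B: "B > 0" "\<And>x. \<bar>\<phi>' x\<bar> \<le> B"
    using periodic_bounded[OF L_pos \<phi>'_per \<phi>'_cont] by blast
  have "\<forall>\<^sub>F s in at t within {0..}. \<forall>x\<in>{0..L}. \<bar>U s x - U t x\<bar> \<le> e / 2"
    using regular t e unfolding regular_solution_def by (meson half_gt_zero)
  moreover have "\<forall>\<^sub>F s in at t within {0..}. B * \<bar>c\<bar> * \<bar>s - t\<bar> < e / 2"
  proof -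
    have "((\<lambda>s. B * \<bar>c\<bar> * \<bar>s - t\<bar>) \<longlongrightarrow> B * \<bar>c\<bar> * \<bar>t - t\<bar>) (at t within {0..})"
      by (intro tendsto_intros)
    then show ?thesis using e by (intro order_tendstoD(2)[of _ 0]) auto
  qed
  ultimately show ?thesis
  proof eventually_elim
    case (elim s)
    show ?case
    proof
      fix x assume "x \<in> {0..L}"
      then have "\<bar>U s x - U t x\<bar> \<le> e / 2" using elim(1) by blast
      moreover have "\<bar>\<phi> (x - c * s) - \<phi> (x - c * t)\<bar> \<le> B * \<bar>c\<bar> * \<bar>s - t\<bar>"
        by (rule translation_lipschitz[OF \<phi>_deriv B(2)])
      ultimately show "\<bar>V s x - V t x\<bar> \<le> e" using elim(2) unfolding V_def by linarith
    qed
  qed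
qed

lemma V_time_continuous_at:
  assumes t: "t > 0" and e: "e > 0"
  shows "\<forall>\<^sub>F s in at t. s > 0 \<and> s \<noteq> t \<and> (\<forall>x\<in>{0..L}. \<bar>V s x - V t x\<bar> \<le> e)"
proof -
  have "at t within {0..} = at t"
    using t by (intro at_within_interior) (simp add: interior_real_atLeast)
  then have "\<forall>\<^sub>F s in at t. \<forall>x\<in>{0..L}. \<bar>V s x - V t x\<bar> \<le> e"
    using V_time_continuous[of t e] t e by simp
  moreover have "\<forall>\<^sub>F s in at t. s \<in> {0<..} - {t}"
    using t by (intro eventually_at_in_open) auto
  ultimately show ?thesis by eventually_elim auto
qed

text \<open>The difference of the two weak right-hand sides, with one space derivative moved onto
  the test function \<open>Y\<close>; \<open>Y'\<close> stands for the derivative of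
  \<open>Y\<close>.\<close>

definition V_rate :: "real \<Rightarrow> (real \<Rightarrow> real) \<Rightarrow> (real \<Rightarrow> real) \<Rightarrow> real" where
  "V_rate t Y Y' = integral {0..L} (\<lambda>x. (f (U t x) - f (\<phi> (x - c * t)) - V' t x) * Y' x
       + (g (U t x) - g (\<phi> (x - c * t))) * Y x)"

lemma V_time_derivative:
  assumes t: "t > 0" and Y: "\<And>x. (Y has_real_derivative Y' x) (at x)" "continuous_on UNIV Y'" "periodic L Y"
  shows "((\<lambda>s. integral {0..L} (\<lambda>x. (V s x - V t x) * Y x) / (s - t)) \<longlongrightarrow> V_rate t Y Y') (at t)"
proof -
  note sc = continuous_shift[OF \<phi>_cont] continuous_shift[OF \<phi>'_cont]
  have Yc: "continuous_on S Y" "continuous_on S Y'" for S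
    by (rule has_real_derivative_continuous_on, rule Y(1), rule continuous_on_subset[OF Y(2) subset_UNIV])
  obtain B where B: "\<And>x. \<bar>\<phi>'' x\<bar> \<le> B"
    using periodic_bounded[OF L_pos \<phi>''_per \<phi>''_cont] by blast
  let ?u = "\<lambda>s. integral {0..L} (\<lambda>x. (U s x - U t x) * Y x) / (s - t)"
  let ?w = "\<lambda>s. integral {0..L} (\<lambda>x. (\<phi> (x - c * s) - \<phi> (x - c * t)) * Y x) / (s - t)"
  have u: "(?u \<longlongrightarrow> integral {0..L} (\<lambda>x. (f (U t x) - Q t x) * Y' x + g (U t x) * Y x)) (at t)"
    using regular t Y unfolding regular_solution_def by blast
  have w: "(?w \<longlongrightarrow> integral {0..L} (\<lambda>x. - c * \<phi>' (x - c * t) * Y x)) (at t)"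
    by (rule translation_integral_derivative[OF L_pos \<phi>_deriv \<phi>'_deriv B Yc(1)])
  have t0: "t \<ge> 0" using t by simp
  have "integral {0..L} (\<lambda>x. (f (U t x) - Q t x) * Y' x + g (U t x) * Y x)
      - integral {0..L} (\<lambda>x. - c * \<phi>' (x - c * t) * Y x)
      = integral {0..L} (\<lambda>x. ((f (U t x) - Q t x) * Y' x + g (U t x) * Y x)
        - ((f (\<phi> (x - c * t)) - \<phi>' (x - c * t)) * Y' x + g (\<phi> (x - c * t)) * Y x))"
    unfolding wave_weak[OF Y]
    by (intro integral_diff_continuous[symmetric] continuous_intros sc Yc
        f_compose g_compose U_cont t0 continuous_on_subset[OF Q_cont[OF t0] subset_UNIV])
  also have "\<dots> = V_rate t Y Y'"
    unfolding V_rate_def V'_def by (intro Henstock_Kurzweil_Integration.integral_cong) (simp add: algebra_simps)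
  finally have "((\<lambda>s. ?u s - ?w s) \<longlongrightarrow> V_rate t Y Y') (at t)"
    using tendsto_diff[OF u w] by simp
  moreover have "\<forall>\<^sub>F s in at t. ?u s - ?w s = integral {0..L} (\<lambda>x. (V s x - V t x) * Y x) / (s - t)"
    using V_time_continuous_at[OF t zero_less_one]
  proof eventually_elim
    case (elim s)
    then have s: "s \<ge> 0" by simp
    have "integral {0..L} (\<lambda>x. (V s x - V t x) * Y x)
       = integral {0..L} (\<lambda>x. (U s x - U t x) * Y x - (\<phi> (x - c * s) - \<phi> (x - c * t)) * Y x)"
      unfolding V_def by (intro Henstock_Kurzweil_Integration.integral_cong) (simp add: algebra_simps)
    also have "\<dots> = integral {0..L} (\<lambda>x. (U s x - U t x) * Y x)
        - integral {0..L} (\<lambda>x. (\<phi> (x - c * s) - \<phi> (x - c * t)) * Y x)"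
      by (intro integral_diff_continuous continuous_intros sc Yc U_cont s t0)
    finally show ?case by (simp add: diff_divide_distrib)
  qed
  ultimately show ?thesis by (rule Lim_transform_eventually)
qed

text \<open>The wave travels with bounded speed, so its squared increments are of order (s - t)^2
  and add only O(|s - t|) to the quotient.\<close>

lemma V_quadratic_variation:
  assumes t: "t > 0"
  shows "((\<lambda>s. integral {0..L} (\<lambda>x. (V s x - V t x)\<^sup>2) / (s - t)) \<longlongrightarrow> 0) (at t)"
proof -
  have t0: "t \<ge> 0" using t by simp
  note sc = continuous_shift[OF \<phi>_cont]
  obtain B where B: "\<And>x. \<bar>\<phi>' x\<bar> \<le> B"
    using periodic_bounded[OF L_pos \<phi>'_per \<phi>'_cont] by blast
  let ?q = "\<lambda>s. integral {0..L} (\<lambda>x. (U s x - U t x)\<^sup>2) / (s - t)"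
  let ?C = "(B * \<bar>c\<bar>)\<^sup>2 * L"
  show ?thesis
  proof (rule Lim_null_comparison)
    have "(?q \<longlongrightarrow> 0) (at t)" using regular t unfolding regular_solution_def by blast
    then have "((\<lambda>s. 2 * \<bar>?q s\<bar> + 2 * ?C * \<bar>s - t\<bar>) \<longlongrightarrow> 2 * \<bar>0\<bar> + 2 * ?C * \<bar>t - t\<bar>) (at t)"
      by (intro tendsto_intros)
    then show "((\<lambda>s. 2 * \<bar>?q s\<bar> + 2 * ?C * \<bar>s - t\<bar>) \<longlongrightarrow> 0) (at t)" by simp
    show "\<forall>\<^sub>F s in at t. norm (integral {0..L} (\<lambda>x. (V s x - V t x)\<^sup>2) / (s - t)) \<le> 2 * \<bar>?q s\<bar> + 2 * ?C * \<bar>s - t\<bar>"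
      using V_time_continuous_at[OF t zero_less_one]
    proof eventually_elim
      case (elim s)
      then have s: "s \<ge> 0" and st: "\<bar>s - t\<bar> > 0" by auto
      have ii: "(\<lambda>x. (U s x - U t x)\<^sup>2) integrable_on {0..L}"
        by (intro integrable_continuous_interval continuous_intros U_cont s t0)
      have "integral {0..L} (\<lambda>x. (V s x - V t x)\<^sup>2)
          \<le> integral {0..L} (\<lambda>x. 2 * (U s x - U t x)\<^sup>2 + 2 * (B * \<bar>c\<bar> * \<bar>s - t\<bar>)\<^sup>2)"
      proof (rule integral_le)
        show "(V s x - V t x)\<^sup>2 \<le> 2 * (U s x - U t x)\<^sup>2 + 2 * (B * \<bar>c\<bar> * \<bar>s - t\<bar>)\<^sup>2" for x
        proof -
          have "\<bar>\<phi> (x - c * s) - \<phi> (x - c * t)\<bar>\<^sup>2 \<le> (B * \<bar>c\<bar> * \<bar>s - t\<bar>)\<^sup>2"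
            by (intro power_mono translation_lipschitz[OF \<phi>_deriv B]) auto
          moreover have "(a - b)\<^sup>2 \<le> 2 * a\<^sup>2 + 2 * b\<^sup>2" for a b :: real
            using zero_le_power2[of "a + b"] by (simp add: power2_eq_square algebra_simps)
          from this[of "U s x - U t x" "\<phi> (x - c * s) - \<phi> (x - c * t)"]
          have "(V s x - V t x)\<^sup>2 \<le> 2 * (U s x - U t x)\<^sup>2 + 2 * (\<phi> (x - c * s) - \<phi> (x - c * t))\<^sup>2"
            unfolding V_def by (simp add: algebra_simps)
          ultimately show ?thesis by simp
        qed
      qed (intro integrable_continuous_interval continuous_intros U_cont V_cont s t0)+
      also have "\<dots> = 2 * integral {0..L} (\<lambda>x. (U s x - U t x)\<^sup>2) + 2 * (B * \<bar>c\<bar> * \<bar>s - t\<bar>)\<^sup>2 * L"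
        using ii L_pos by (subst Henstock_Kurzweil_Integration.integral_add) auto
      finally have "integral {0..L} (\<lambda>x. (V s x - V t x)\<^sup>2) / \<bar>s - t\<bar>
        \<le> (2 * integral {0..L} (\<lambda>x. (U s x - U t x)\<^sup>2) + 2 * (B * \<bar>c\<bar> * \<bar>s - t\<bar>)\<^sup>2 * L) / \<bar>s - t\<bar>"
        by (rule divide_right_mono) simp
      also have "\<dots> = 2 * (integral {0..L} (\<lambda>x. (U s x - U t x)\<^sup>2) / \<bar>s - t\<bar>) + 2 * ?C * \<bar>s - t\<bar>"
        using st by (simp add: add_divide_distrib power_mult_distrib power2_eq_square)
      also have "integral {0..L} (\<lambda>x. (U s x - U t x)\<^sup>2) / \<bar>s - t\<bar> \<le> \<bar>?q s\<bar>"
        by (simp add: divide_right_mono)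
      finally have "integral {0..L} (\<lambda>x. (V s x - V t x)\<^sup>2) / \<bar>s - t\<bar> \<le> 2 * \<bar>?q s\<bar> + 2 * ?C * \<bar>s - t\<bar>"
        by simp
      moreover have "integral {0..L} (\<lambda>x. (V s x - V t x)\<^sup>2) \<ge> 0"
        by (intro Henstock_Kurzweil_Integration.integral_nonneg integrable_continuous_interval continuous_intros V_cont s t0) auto
      ultimately show ?case by simp
    qed
  qed
qed

end

lemma antiderivative_exists:
  fixes h :: "real \<Rightarrow> real"
  assumes h: "continuous_on UNIV h"
  obtains H where "\<And>x. (H has_real_derivative h x) (at x)"
proof
  fix x :: real
  define b where "b = \<bar>x\<bar> + 1"
  have "((\<lambda>u. LBINT y=ereal 0..ereal u. h y) has_vector_derivative h x) (at x within {-b..b})"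
    by (rule interval_integral_FTC2) (auto simp: b_def intro: continuous_on_subset[OF h])
  moreover have "at x within {-b..b} = at x"
    by (rule at_within_interior) (auto simp: b_def)
  ultimately show "((\<lambda>u. LBINT y=ereal 0..ereal u. h y) has_real_derivative h x) (at x)"
    by (simp add: has_real_derivative_iff_has_vector_derivative)
qed

context periodic_wave
begin

text \<open>
  The profile and its translate have the same mean, so they nearly coincide in \<open>L\<^sup>1\<close>, hence
  uniformly by the Lipschitz bound.
\<close>

lemma translate_above_imp_close:
  assumes e: "e > 0"
  obtains d where "d > 0"
    "\<And>r x. (\<And>x. \<phi> x \<le> \<phi> (x + r) + d) \<Longrightarrow> \<phi> (x + r) - \<phi> x \<le> e"
proof -
  obtain B where B: "B > 0" "\<And>x. \<bar>\<phi>' x\<bar> \<le> B"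
    using periodic_bounded[OF L_pos \<phi>'_per \<phi>'_cont] by blast
  obtain P where P: "\<And>x. (P has_real_derivative \<phi> x) (at x)"
    using antiderivative_exists[OF \<phi>_cont] by blast
  \<comment> \<open>If the gap \<phi>(y + r) - \<phi> y exceeds e at y = x, it is at least e / 2 on
    an interval of length \<tau>, because each of the two terms varies by at most B \<tau> \<le> e /
    4.\<close>
  define \<tau> where "\<tau> = min L (e / (4 * B))"
  \<comment> \<open>The gain \<tau> e / 2 on that interval then outweighs the possible loss d L =
    \<tau> e / 4 on the rest of the period.\<close>
  define d where "d = \<tau> * e / (4 * L)"
  have \<tau>: "0 < \<tau>" "\<tau> \<le> L" "2 * B * \<tau> \<le> e / 2"
    using L_pos e B(1) by (auto simp: \<tau>_def min_def field_simps)
  have d: "d > 0" using \<tau> e L_pos by (simp add: d_def)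
  have "\<phi> (x + r) - \<phi> x \<le> e" if above: "\<And>x. \<phi> x \<le> \<phi> (x + r) + d" for r x
  proof (rule ccontr)
    assume "\<not> \<phi> (x + r) - \<phi> x \<le> e"
    then have x: "\<phi> (x + r) - \<phi> x > e" by simp
    have Pr: "((\<lambda>y. P (y + a)) has_real_derivative \<phi> (y + a)) (at y)" for a y
      using P[of "y + a"] by (simp add: DERIV_shift)
    define E where "E y = P (y + r) - P y" for y
    have E: "(E has_real_derivative \<phi> (y + r) - \<phi> y) (at y)" for y
      unfolding E_def by (intro DERIV_diff Pr P)
    \<comment> \<open>This is the equality of means: the integral over a period does not depend on
      where the period starts, so the gap has integral 0.\<close>
    have "P (y + L) - P y = P (0 + L) - P 0" for y
    proof (rule DERIV_isconst_all[of "\<lambda>y. P (y + L) - P y"])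
      have "((\<lambda>y. P (y + L) - P y) has_real_derivative \<phi> (y + L) - \<phi> y) (at y)" for y
        by (intro DERIV_diff Pr P)
      then show "\<forall>y. ((\<lambda>y. P (y + L) - P y) has_real_derivative 0) (at y)"
        using \<phi>_per by (simp add: periodic_def)
    qed
    from this[of "x + r"] this[of x] have EL: "E (x + L) = E x"
      by (simp add: E_def add_ac)
    have lip: "\<bar>\<phi> a - \<phi> b\<bar> \<le> B * \<bar>a - b\<bar>" for a b
      using translation_lipschitz[OF \<phi>_deriv B(2), of a 1 0 "a - b"] by (simp add: abs_minus_commute)
    obtain z where z: "x < z" "z < x + \<tau>" "E (x + \<tau>) - E x = (x + \<tau> - x) * (\<phi> (z + r) - \<phi> z)"
      using MVT2[of x "x + \<tau>" E "\<lambda>y. \<phi> (y + r) - \<phi> y"] E \<tau>(1) by auto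
    have "B * \<bar>x - z\<bar> \<le> B * \<tau>" using z B(1) by (intro mult_left_mono) auto
    then have "\<phi> (z + r) - \<phi> z \<ge> e / 2"
      using lip[of "x + r" "z + r"] lip[of x z] x \<tau>(3) by simp
    then have 1: "E (x + \<tau>) - E x \<ge> \<tau> * (e / 2)"
      using z(3) \<tau>(1) by simp
    have 2: "E (x + L) - E (x + \<tau>) \<ge> - d * (L - \<tau>)"
    proof (cases "\<tau> = L")
      case False
      then obtain y where y: "E (x + L) - E (x + \<tau>) = (x + L - (x + \<tau>)) * (\<phi> (y + r) - \<phi> y)"
        using MVT2[of "x + \<tau>" "x + L" E "\<lambda>y. \<phi> (y + r) - \<phi> y"] E \<tau>(2) by auto
      have "(L - \<tau>) * (\<phi> (y + r) - \<phi> y) \<ge> (L - \<tau>) * (- d)"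
        using above[of y] \<tau>(2) by (intro mult_left_mono) auto
      then show ?thesis using y by (simp add: mult.commute)
    qed simp
    have "d * (L - \<tau>) \<le> d * L" using d \<tau> by simp
    also have "d * L = \<tau> * e / 4" using L_pos by (simp add: d_def)
    finally show False using 1 2 EL \<tau>(1) e mult_pos_pos[OF \<tau>(1) e] by simp
  qed
  then show ?thesis using that d by blast
qed

end

section \<open>Comparison principle and growth of a weighted integral\<close>

context perturbed_wave
begin

lemma V_bounded:
  assumes "t \<ge> 0"
  obtains M where "M > 0" "\<And>x. x \<in> {0..L} \<Longrightarrow> \<bar>V t x\<bar> \<le> M"
  using compact_imp_bounded[OF compact_continuous_image[OF V_cont[OF assms] compact_Icc, of 0 L]]
  unfolding bounded_pos real_norm_def by (metis image_eqI)

text \<open>With the cube the derivative in V is a C^1 function of x, hence an admissible test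
  function; the square would give one with a corner.\<close>

definition neg_energy :: "real \<Rightarrow> real" where
  "neg_energy t = integral {0..L} (\<lambda>x. (max 0 (- V t x)) ^ 3)"

lemma neg_cont: "t \<ge> 0 \<Longrightarrow> continuous_on S (\<lambda>x. max 0 (- V t x))"
  by (intro continuous_intros V_cont continuous_on_max)

text \<open>The derivative below is available at positive times only, so continuity down to time 0
  is needed to start Gronwall's inequality.\<close>

lemma neg_energy_continuous:
  assumes t: "t \<ge> 0"
  shows "(neg_energy \<longlongrightarrow> neg_energy t) (at t within {0..})"
proof (rule tendstoI)
  fix e :: real assume e: "e > 0"
  obtain M where M: "M > 0" "\<And>x. x \<in> {0..L} \<Longrightarrow> \<bar>V t x\<bar> \<le> M"
    using V_bounded[OF t] by blast
  define C where "C = 3 * (M + 1)\<^sup>2 * L"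
  have C: "C > 0" using M L_pos by (simp add: C_def)
  define d where "d = min 1 (e / (2 * C))"
  have d: "d > 0" "d \<le> 1" "C * d < e"
    using e C by (auto simp: d_def min_def field_simps)
  have "\<forall>\<^sub>F s in at t within {0..}. s \<in> {0..}"
    by (simp add: eventually_at_filter)
  then show "\<forall>\<^sub>F s in at t within {0..}. dist (neg_energy s) (neg_energy t) < e"
    using V_time_continuous[OF t d(1)]
  proof eventually_elim
    case (elim s)
    then have s: "s \<ge> 0" by simp
    let ?h = "\<lambda>x. (max 0 (- V s x)) ^ 3 - (max 0 (- V t x)) ^ 3"
    have "\<bar>?h x\<bar> \<le> 3 * (M + 1)\<^sup>2 * d" if x: "x \<in> {0..L}" for x
    proof -
      have V: "\<bar>V s x - V t x\<bar> \<le> d" using elim x by blast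
      then have "\<bar>- V t x\<bar> \<le> M + 1" "\<bar>- V s x\<bar> \<le> M + 1" using M(2)[OF x] d(2) by auto
      then have "\<bar>?h x\<bar> \<le> 3 * (M + 1)\<^sup>2 * \<bar>- V s x - - V t x\<bar>"
        by (rule cube_pos_part_lipschitz)
      also have "\<dots> \<le> 3 * (M + 1)\<^sup>2 * d"
        using V by (intro mult_left_mono) auto
      finally show ?thesis .
    qed
    then have "\<bar>integral {0..L} ?h\<bar> \<le> 3 * (M + 1)\<^sup>2 * d * L"
      by (intro integral_abs_le L_pos continuous_intros neg_cont s t)
    moreover have "integral {0..L} ?h = neg_energy s - neg_energy t"
      unfolding neg_energy_def
      by (intro integral_diff_continuous continuous_intros neg_cont s t)
    ultimately show ?case using d(3) by (simp add: dist_real_def C_def mult_ac)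
  qed
qed

text \<open>A chain rule without a pointwise time derivative. The Taylor remainder is at most a
  constant times the squared increment and vanishes by \<open>V_quadratic_variation\<close>; the
  linear part is a weak derivative, and the minus sign comes from -V.\<close>

lemma neg_energy_derivative:
  assumes t: "t > 0"
  shows "(neg_energy has_real_derivative
      - V_rate t (\<lambda>x. 3 * (max 0 (- V t x))\<^sup>2) (\<lambda>x. 3 * (2 * max 0 (- V t x) * (- V' t x)))) (at t)"
proof -
  have t0: "t \<ge> 0" using t by simp
  let ?Y = "\<lambda>x. 3 * (max 0 (- V t x))\<^sup>2"
  let ?Y' = "\<lambda>x. 3 * (2 * max 0 (- V t x) * (- V' t x))"
  have Y: "(?Y has_real_derivative ?Y' x) (at x)" for x
    by (rule DERIV_cmult, rule DERIV_chain2[OF max0_square_has_derivative], rule DERIV_minus, rule V_deriv[OF t0])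
  have Y'c: "continuous_on UNIV ?Y'"
    by (intro continuous_intros neg_cont V'_cont t0)
  have Yp: "periodic L ?Y" using V_per[OF t0] by (simp add: periodic_def)
  have Yc: "continuous_on {0..L} ?Y" by (intro continuous_intros neg_cont t0)
  obtain M where M: "M > 0" "\<And>x. x \<in> {0..L} \<Longrightarrow> \<bar>V t x\<bar> \<le> M"
    using V_bounded[OF t0] by blast
  let ?q = "\<lambda>s. integral {0..L} (\<lambda>x. (V s x - V t x)\<^sup>2) / (s - t)"
  let ?l = "\<lambda>s. integral {0..L} (\<lambda>x. (V s x - V t x) * ?Y x) / (s - t)"
  have "((\<lambda>s. (neg_energy s - neg_energy t) / (s - t) + ?l s) \<longlongrightarrow> 0) (at t)"
  proof (rule Lim_null_comparison)
    have "((\<lambda>s. 3 * (M + 1) * \<bar>?q s\<bar>) \<longlongrightarrow> 3 * (M + 1) * \<bar>0\<bar>) (at t)"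
      by (intro tendsto_intros V_quadratic_variation t)
    then show "((\<lambda>s. 3 * (M + 1) * \<bar>?q s\<bar>) \<longlongrightarrow> 0) (at t)" by simp
    show "\<forall>\<^sub>F s in at t. norm ((neg_energy s - neg_energy t) / (s - t) + ?l s) \<le> 3 * (M + 1) * \<bar>?q s\<bar>"
      using V_time_continuous_at[OF t zero_less_one]
    proof eventually_elim
      case (elim s)
      then have s: "s \<ge> 0" by simp
      let ?r = "\<lambda>x. (max 0 (- V s x)) ^ 3 - (max 0 (- V t x)) ^ 3 + (V s x - V t x) * ?Y x"
      have ir: "integral {0..L} ?r = neg_energy s - neg_energy t + integral {0..L} (\<lambda>x. (V s x - V t x) * ?Y x)"
      proof -
        have "integral {0..L} ?r = integral {0..L} (\<lambda>x. (max 0 (- V s x)) ^ 3 - (max 0 (- V t x)) ^ 3)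
            + integral {0..L} (\<lambda>x. (V s x - V t x) * ?Y x)"
          by (intro integral_add_continuous continuous_intros neg_cont V_cont Yc s t0)
        also have "integral {0..L} (\<lambda>x. (max 0 (- V s x)) ^ 3 - (max 0 (- V t x)) ^ 3) = neg_energy s - neg_energy t"
          unfolding neg_energy_def
          by (intro integral_diff_continuous continuous_intros neg_cont s t0)
        finally show ?thesis .
      qed
      have pt: "\<bar>?r x\<bar> \<le> 3 * (M + 1) * (V s x - V t x)\<^sup>2" if x: "x \<in> {0..L}" for x
      proof -
        have "\<bar>V s x - V t x\<bar> \<le> 1" using elim x by blast
        then have "\<bar>- V t x\<bar> \<le> M + 1" "\<bar>- V s x\<bar> \<le> M + 1" using M(2)[OF x] by auto
        then have "\<bar>(max 0 (- V s x))^3 - (max 0 (- V t x))^3 - 3 * (max 0 (- V t x))\<^sup>2 * (- V s x - - V t x)\<bar>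
            \<le> 3 * (M + 1) * (- V s x - - V t x)\<^sup>2"
          by (rule cube_pos_part_remainder)
        then show ?thesis by (simp add: power2_commute algebra_simps)
      qed
      have "\<bar>integral {0..L} ?r\<bar> \<le> integral {0..L} (\<lambda>x. 3 * (M + 1) * (V s x - V t x)\<^sup>2)"
        using integral_norm_bound_integral[of ?r "{0..L}" "\<lambda>x. 3 * (M + 1) * (V s x - V t x)\<^sup>2"] pt
        by (simp add: integrable_continuous_interval continuous_intros neg_cont V_cont Yc s t0)
      also have "\<dots> = 3 * (M + 1) * integral {0..L} (\<lambda>x. (V s x - V t x)\<^sup>2)"
        by (rule integral_mult_right)
      finally have "\<bar>integral {0..L} ?r\<bar> / \<bar>s - t\<bar> \<le> 3 * (M + 1) * integral {0..L} (\<lambda>x. (V s x - V t x)\<^sup>2) / \<bar>s - t\<bar>"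
        by (rule divide_right_mono) simp
      also have "\<dots> \<le> 3 * (M + 1) * \<bar>?q s\<bar>"
      proof -
        have "integral {0..L} (\<lambda>x. (V s x - V t x)\<^sup>2) / \<bar>s - t\<bar> \<le> \<bar>?q s\<bar>"
          by (simp add: divide_right_mono)
        then have "3 * (M + 1) * (integral {0..L} (\<lambda>x. (V s x - V t x)\<^sup>2) / \<bar>s - t\<bar>) \<le> 3 * (M + 1) * \<bar>?q s\<bar>"
          using M(1) by (intro mult_left_mono) auto
        then show ?thesis by simp
      qed
      finally show ?case
        unfolding add_divide_distrib[symmetric] ir[symmetric] real_norm_def abs_divide .
    qed
  qed
  then have "((\<lambda>s. ((neg_energy s - neg_energy t) / (s - t) + ?l s) - ?l s) \<longlongrightarrow> 0 - V_rate t ?Y ?Y') (at t)"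
    by (intro tendsto_diff V_time_derivative[OF t Y Y'c Yp])
  then show ?thesis by (simp add: has_field_derivative_iff)
qed

text \<open>Here p is the slope of V and F the difference of the fluxes. Completing the square, the
  diffusion term p^2 pays for the flux term and leaves F^2 / 4.\<close>

lemma young_pointwise:
  fixes m p F K :: real
  assumes m: "m \<ge> 0" and F: "\<bar>F\<bar> \<le> K * m"
  shows "6 * m * (p * F - p\<^sup>2) \<le> 3 / 2 * K\<^sup>2 * m ^ 3"
proof -
  have "p * F - p\<^sup>2 \<le> F\<^sup>2 / 4"
    using zero_le_power2[of "p - F / 2"] by (simp add: power2_eq_square algebra_simps)
  also have "F\<^sup>2 \<le> (K * m)\<^sup>2"
    using F by (metis abs_le_square_iff abs_of_nonneg abs_ge_zero order_trans)
  finally have "p * F - p\<^sup>2 \<le> (K * m)\<^sup>2 / 4" by simp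
  then have "6 * m * (p * F - p\<^sup>2) \<le> 6 * m * ((K * m)\<^sup>2 / 4)"
    using m by (intro mult_left_mono) auto
  then show ?thesis by (simp add: power2_eq_square power3_eq_cube mult_ac)
qed

text \<open>\<open>neg_energy\<close> starts at 0 and satisfies a linear differential inequality, so
  it stays 0. The bounds on U and \<phi> confine the arguments of f and g to a compact interval, on
  which both are Lipschitz.\<close>

theorem comparison:
  assumes R: "\<And>t x. t > 0 \<Longrightarrow> x \<in> {0..L} \<Longrightarrow> \<bar>U t x\<bar> \<le> R"
    and init: "\<And>x. x \<in> {0..L} \<Longrightarrow> V 0 x \<ge> 0"
    and T: "T \<ge> 0" and x: "x \<in> {0..L}"
  shows "V T x \<ge> 0"
proof -
  obtain B where B: "B > 0" "\<And>x. \<bar>\<phi> x\<bar> \<le> B"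
    using periodic_bounded[OF L_pos \<phi>_per \<phi>_cont] by blast
  define S where "S = max R B"
  obtain Kf where Kf: "Kf \<ge> 0" "\<And>a b. \<bar>a\<bar> \<le> S \<Longrightarrow> \<bar>b\<bar> \<le> S \<Longrightarrow> \<bar>f a - f b\<bar> \<le> Kf * \<bar>a - b\<bar>"
    using C1_lipschitz_bounded[OF f_deriv f'_cont, of S] by blast
  obtain Kg where Kg: "Kg \<ge> 0" "\<And>a b. \<bar>a\<bar> \<le> S \<Longrightarrow> \<bar>b\<bar> \<le> S \<Longrightarrow> \<bar>g a - g b\<bar> \<le> Kg * \<bar>a - b\<bar>"
    using C1_lipschitz_bounded[OF g_deriv g'_cont, of S] by blast
  \<comment> \<open>The first term is what \<open>young_pointwise\<close> leaves of the flux, the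
    second comes from the reaction.\<close>
  define K where "K = 3 / 2 * Kf\<^sup>2 + 3 * Kg"
  have rate: "- V_rate t (\<lambda>x. 3 * (max 0 (- V t x))\<^sup>2) (\<lambda>x. 3 * (2 * max 0 (- V t x) * (- V' t x))) \<le> K * neg_energy t"
    if t: "t > 0" for t
  proof -
    have t0: "t \<ge> 0" using t by simp
    note sc = continuous_shift[OF \<phi>_cont]
    let ?m = "\<lambda>x. max 0 (- V t x)"
    let ?F = "\<lambda>x. f (U t x) - f (\<phi> (x - c * t))" and ?G = "\<lambda>x. g (U t x) - g (\<phi> (x - c * t))"
    let ?I = "\<lambda>x. (?F x - V' t x) * (3 * (2 * ?m x * (- V' t x))) + ?G x * (3 * (?m x)\<^sup>2)"
    have Ic: "continuous_on {0..L} ?I"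
      by (intro continuous_intros neg_cont V'_cont f_compose g_compose U_cont sc t0)
    have "- integral {0..L} ?I = integral {0..L} (\<lambda>x. - ?I x)"
      by (rule Henstock_Kurzweil_Integration.integral_neg[symmetric])
    also have "\<dots> \<le> integral {0..L} (\<lambda>x. K * (?m x) ^ 3)"
    proof (rule integral_le)
      show "- ?I x \<le> K * (?m x) ^ 3" if x: "x \<in> {0..L}" for x
      proof (cases "V t x < 0")
        case True
        then have m: "?m x = - V t x" "?m x \<ge> 0" by auto
        have ab: "\<bar>U t x\<bar> \<le> S" "\<bar>\<phi> (x - c * t)\<bar> \<le> S"
          using R[OF t x] B(2)[of "x - c * t"] by (auto simp: S_def)
        have d: "\<bar>U t x - \<phi> (x - c * t)\<bar> = ?m x" using True by (simp add: V_def[symmetric])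
        have F: "\<bar>?F x\<bar> \<le> Kf * ?m x" and G: "\<bar>?G x\<bar> \<le> Kg * ?m x"
          using Kf(2)[OF ab] Kg(2)[OF ab] unfolding d by auto
        have "- ?I x = 6 * ?m x * (V' t x * ?F x - (V' t x)\<^sup>2) + 3 * (?m x)\<^sup>2 * (- ?G x)"
          by (simp add: power2_eq_square algebra_simps)
        also have "\<dots> \<le> 3 / 2 * Kf\<^sup>2 * (?m x) ^ 3 + 3 * (?m x)\<^sup>2 * (Kg * ?m x)"
          using G by (intro add_mono young_pointwise m(2) F mult_left_mono) auto
        also have "\<dots> = K * (?m x) ^ 3"
          by (simp add: K_def power2_eq_square power3_eq_cube algebra_simps)
        finally show ?thesis .
      qed (simp add: max_def)
    qed (intro integrable_continuous_interval continuous_on_minus Ic continuous_intros neg_cont t0)+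
    also have "\<dots> = K * neg_energy t" unfolding neg_energy_def by (rule integral_mult_right)
    finally show ?thesis unfolding V_rate_def .
  qed
  have "neg_energy T \<le> neg_energy 0 * exp (K * T)"
  proof (rule gronwall[OF T])
    show "continuous_on {0..T} neg_energy"
      unfolding continuous_on_def
      by (intro ballI tendsto_within_subset[OF neg_energy_continuous]) auto
    show "\<exists>D. (neg_energy has_real_derivative D) (at t) \<and> D \<le> K * neg_energy t" if "0 < t" for t
      using neg_energy_derivative[OF that] rate[OF that] by blast
  qed
  also have "neg_energy 0 = integral {0..L} (\<lambda>x. 0)"
    unfolding neg_energy_def using init by (intro Henstock_Kurzweil_Integration.integral_cong) (force simp: max_def)
  finally have le: "neg_energy T \<le> 0" by simp
  have c3: "continuous_on {0..L} (\<lambda>x. (max 0 (- V T x)) ^ 3)"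
    by (intro continuous_intros neg_cont T)
  have "neg_energy T \<ge> 0"
    unfolding neg_energy_def
    by (intro Henstock_Kurzweil_Integration.integral_nonneg integrable_continuous_interval c3) auto
  with le have "((\<lambda>x. (max 0 (- V T x)) ^ 3) has_integral 0) (cbox 0 L)"
    using integrable_integral[OF integrable_continuous_interval[OF c3]] unfolding neg_energy_def by simp
  then have "(max 0 (- V T x)) ^ 3 = 0"
    using has_integral_0_cbox_imp_0[of 0 L "\<lambda>x. (max 0 (- V T x)) ^ 3" x] c3 L_pos x by simp
  then show ?thesis by simp
qed

text \<open>Moving all space derivatives onto the travelling weight produces the adjoint
  linearisation of Z, paired with V. The Taylor remainders cost at most \<eta> V (|Z'| + Z), exactly
  the margin in \<open>sub\<close>, and V \<ge> 0 preserves the inequality under the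
  integral.\<close>

lemma weighted_integral_growth:
  assumes Z: "\<And>x. (Z has_real_derivative Z' x) (at x)" "\<And>x. (Z' has_real_derivative Z'' x) (at x)"
      "continuous_on UNIV Z''" "periodic L Z" "\<And>x. Z x \<ge> 0"
    and sub: "\<And>x. \<mu> * Z x + \<eta> * (\<bar>Z' x\<bar> + Z x) \<le> Z'' x - (c - f' (\<phi> x)) * Z' x + g' (\<phi> x) * Z x"
    and lin_f: "\<And>y v. 0 \<le> v \<Longrightarrow> v \<le> \<delta> \<Longrightarrow> \<bar>f (\<phi> y + v) - f (\<phi> y) - f' (\<phi> y) * v\<bar> \<le> \<eta> * v"
    and lin_g: "\<And>y v. 0 \<le> v \<Longrightarrow> v \<le> \<delta> \<Longrightarrow> \<bar>g (\<phi> y + v) - g (\<phi> y) - g' (\<phi> y) * v\<bar> \<le> \<eta> * v"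
    and V: "\<And>t x. t > 0 \<Longrightarrow> x \<in> {0..L} \<Longrightarrow> 0 \<le> V t x \<and> V t x \<le> \<delta>"
    and T: "T \<ge> 0"
  shows "integral {0..L} (\<lambda>x. V T x * Z (x - c * T)) \<ge> integral {0..L} (\<lambda>x. V 0 x * Z (x - c * 0)) * exp (\<mu> * T)"
proof -
  define h where "h t = integral {0..L} (\<lambda>x. V t x * Z (x - c * t))" for t
  have Zc: "continuous_on UNIV Z" "continuous_on UNIV Z'"
    using Z(1,2) by (auto intro: has_real_derivative_continuous_on)
  have Z'p: "periodic L Z'" using periodic_deriv[OF Z(4,1)] .
  have Z''p: "periodic L Z''" using periodic_deriv[OF Z'p Z(2)] .
  obtain B where B: "B > 0" "\<And>x. \<bar>Z x\<bar> \<le> B" using periodic_bounded[OF L_pos Z(4) Zc(1)] by blast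
  obtain B' where B': "B' > 0" "\<And>x. \<bar>Z' x\<bar> \<le> B'" using periodic_bounded[OF L_pos Z'p Zc(2)] by blast
  obtain B'' where B'': "B'' > 0" "\<And>x. \<bar>Z'' x\<bar> \<le> B''" using periodic_bounded[OF L_pos Z''p Z(3)] by blast
  define C where "C = B' * \<bar>c\<bar>"
  have C: "C \<ge> 0" using B' by (simp add: C_def)
  have Zlip: "\<bar>Z (x - c * s) - Z (x - c * t)\<bar> \<le> C * \<bar>s - t\<bar>" for x s t
    unfolding C_def by (rule translation_lipschitz[OF Z(1) B'(2)])
  note sc = continuous_shift[OF \<phi>_cont] continuous_shift[OF Zc(1)] continuous_shift[OF Zc(2)] continuous_shift[OF Z(3)]
  \<comment> \<open>The product rule for increments. The last integral is negligible against s - t: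
    the weight is Lipschitz in time and the increment of V tends to 0 uniformly.\<close>
  have cross: "h s - h t = integral {0..L} (\<lambda>x. (V s x - V t x) * Z (x - c * t))
      + integral {0..L} (\<lambda>x. (Z (x - c * s) - Z (x - c * t)) * V t x)
      + integral {0..L} (\<lambda>x. (Z (x - c * s) - Z (x - c * t)) * (V s x - V t x))"
    if s: "s \<ge> 0" and t: "t \<ge> 0" for s t
  proof -
    have "h s - h t = integral {0..L} (\<lambda>x. V s x * Z (x - c * s) - V t x * Z (x - c * t))"
      unfolding h_def
      by (intro integral_diff_continuous[symmetric] continuous_intros sc V_cont s t)
    also have "\<dots> = integral {0..L} (\<lambda>x. ((V s x - V t x) * Z (x - c * t) + (Z (x - c * s) - Z (x - c * t)) * V t x)
        + (Z (x - c * s) - Z (x - c * t)) * (V s x - V t x))"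
      by (intro Henstock_Kurzweil_Integration.integral_cong) (simp add: algebra_simps)
    also have "\<dots> = integral {0..L} (\<lambda>x. (V s x - V t x) * Z (x - c * t) + (Z (x - c * s) - Z (x - c * t)) * V t x)
      + integral {0..L} (\<lambda>x. (Z (x - c * s) - Z (x - c * t)) * (V s x - V t x))"
      by (intro integral_add_continuous continuous_intros sc V_cont s t)
    also have "integral {0..L} (\<lambda>x. (V s x - V t x) * Z (x - c * t) + (Z (x - c * s) - Z (x - c * t)) * V t x)
      = integral {0..L} (\<lambda>x. (V s x - V t x) * Z (x - c * t)) + integral {0..L} (\<lambda>x. (Z (x - c * s) - Z (x - c * t)) * V t x)"
      by (intro integral_add_continuous continuous_intros sc V_cont s t)
    finally show ?thesis .
  qed
  have h_cont: "(h \<longlongrightarrow> h t) (at t within {0..})" if t: "t \<ge> 0" for t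
  proof (rule tendstoI)
    fix e :: real assume e: "e > 0"
    obtain M where M: "M > 0" "\<And>x. x \<in> {0..L} \<Longrightarrow> \<bar>V t x\<bar> \<le> M"
      using V_bounded[OF t] by blast
    define d where "d = e / (4 * B * L)"
    have d: "d > 0" "B * d * L = e / 4" using e B L_pos by (simp_all add: d_def)
    have lim: "((\<lambda>s. C * \<bar>s - t\<bar> * (M + d) * L) \<longlongrightarrow> C * \<bar>t - t\<bar> * (M + d) * L) (at t within {0..})"
      by (intro tendsto_intros)
    then have small: "\<forall>\<^sub>F s in at t within {0..}. C * \<bar>s - t\<bar> * (M + d) * L < e / 4"
      using e by (intro order_tendstoD(2)[of _ 0]) auto
    have "\<forall>\<^sub>F s in at t within {0..}. s \<in> {0..}"
      by (simp add: eventually_at_filter)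
    then show "\<forall>\<^sub>F s in at t within {0..}. dist (h s) (h t) < e"
      using V_time_continuous[OF t d(1)] small
    proof eventually_elim
      case (elim s)
      then have s: "s \<ge> 0" by simp
      have Vd: "\<bar>V s x - V t x\<bar> \<le> d" if "x \<in> {0..L}" for x using elim that by blast
      have 1: "\<bar>integral {0..L} (\<lambda>x. (V s x - V t x) * Z (x - c * t))\<bar> \<le> (d * B) * L"
        using Vd B d
        by (intro integral_abs_le L_pos continuous_intros sc V_cont s t) (auto simp: abs_mult intro!: mult_mono)
      have 2: "\<bar>integral {0..L} (\<lambda>x. (Z (x - c * s) - Z (x - c * t)) * V t x)\<bar> \<le> (C * \<bar>s - t\<bar> * M) * L"
        using Zlip M C
        by (intro integral_abs_le L_pos continuous_intros sc V_cont s t) (auto simp: abs_mult intro!: mult_mono)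
      have 3: "\<bar>integral {0..L} (\<lambda>x. (Z (x - c * s) - Z (x - c * t)) * (V s x - V t x))\<bar> \<le> (C * \<bar>s - t\<bar> * d) * L"
        using Zlip Vd C
        by (intro integral_abs_le L_pos continuous_intros sc V_cont s t) (auto simp: abs_mult intro!: mult_mono)
      have "\<bar>h s - h t\<bar> \<le> B * d * L + C * \<bar>s - t\<bar> * (M + d) * L"
        unfolding cross[OF s t] using 1 2 3 by (simp add: algebra_simps)
      then show ?case using elim(3) d(2) e by (simp add: dist_real_def)
    qed
  qed
  have h_deriv: "\<exists>D. (h has_real_derivative D) (at t) \<and> \<mu> * h t \<le> D" if t: "t > 0" for t
  proof -
    have t0: "t \<ge> 0" using t by simp
    let ?Z = "\<lambda>x. Z (x - c * t)" and ?Z' = "\<lambda>x. Z' (x - c * t)" and ?Z'' = "\<lambda>x. Z'' (x - c * t)"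
    have Zt: "(?Z has_real_derivative ?Z' x) (at x)" "(?Z' has_real_derivative ?Z'' x) (at x)" for x
      by (rule shift_has_derivative[OF Z(1)], rule shift_has_derivative[OF Z(2)])
    have Ztp: "periodic L ?Z" using Z(4) by (simp add: periodic_def diff_add_eq[symmetric])
    let ?a = "\<lambda>s. integral {0..L} (\<lambda>x. (V s x - V t x) * ?Z x) / (s - t)"
    let ?b = "\<lambda>s. integral {0..L} (\<lambda>x. (Z (x - c * s) - ?Z x) * V t x) / (s - t)"
    let ?r = "\<lambda>s. integral {0..L} (\<lambda>x. (Z (x - c * s) - ?Z x) * (V s x - V t x)) / (s - t)"
    let ?D = "V_rate t ?Z ?Z' + integral {0..L} (\<lambda>x. - c * ?Z' x * V t x)"
    have a: "(?a \<longlongrightarrow> V_rate t ?Z ?Z') (at t)"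
      by (rule V_time_derivative[OF t Zt(1) sc(3) Ztp])
    have b: "(?b \<longlongrightarrow> integral {0..L} (\<lambda>x. - c * ?Z' x * V t x)) (at t)"
      by (rule translation_integral_derivative[OF L_pos Z(1,2) B''(2) V_cont[OF t0]])
    have r: "(?r \<longlongrightarrow> 0) (at t)"
    proof (rule tendstoI)
      fix e :: real assume e: "e > 0"
      \<comment> \<open>Chosen for C d L < e; the summand 1 covers the case C = 0, which occurs for
        a standing wave.\<close>
      define d where "d = e / 2 / ((C + 1) * L)"
      have C1: "C + 1 > 0" using C by simp
      then have d: "d > 0" using e L_pos by (simp add: d_def)
      have "(C + 1) * d * L = e / 2" using C1 L_pos unfolding d_def
        by (metis less_irrefl mult.assoc mult.commute mult_eq_0_iff nonzero_divide_eq_eq)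
      moreover have "C * d * L \<le> (C + 1) * d * L" using d L_pos by simp
      ultimately have CdL: "C * d * L < e" using e by linarith
      show "\<forall>\<^sub>F s in at t. dist (?r s) 0 < e"
        using V_time_continuous_at[OF t d]
      proof eventually_elim
        case (elim s)
        then have s: "s \<ge> 0" and st: "\<bar>s - t\<bar> > 0" by auto
        have Vd: "\<bar>V s x - V t x\<bar> \<le> d" if "x \<in> {0..L}" for x using elim that by blast
        have "\<bar>integral {0..L} (\<lambda>x. (Z (x - c * s) - ?Z x) * (V s x - V t x))\<bar> \<le> (C * \<bar>s - t\<bar> * d) * L"
          using Zlip Vd C
          by (intro integral_abs_le L_pos continuous_intros sc V_cont s t0) (auto simp: abs_mult intro!: mult_mono)
        then have "\<bar>integral {0..L} (\<lambda>x. (Z (x - c * s) - ?Z x) * (V s x - V t x))\<bar> / \<bar>s - t\<bar> \<le> ((C * \<bar>s - t\<bar> * d) * L) / \<bar>s - t\<bar>"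
          by (rule divide_right_mono) simp
        also have "\<dots> = C * d * L" using st by simp
        finally show ?case using CdL by (simp add: dist_real_def)
      qed
    qed
    have "((\<lambda>s. ?a s + ?b s + ?r s) \<longlongrightarrow> ?D + 0) (at t)"
      by (intro tendsto_add a b r)
    moreover have "\<forall>\<^sub>F s in at t. ?a s + ?b s + ?r s = (h s - h t) / (s - t)"
      using V_time_continuous_at[OF t zero_less_one]
      by eventually_elim (simp add: cross[OF less_imp_le t0] add_divide_distrib)
    ultimately have "((\<lambda>s. (h s - h t) / (s - t)) \<longlongrightarrow> ?D) (at t)"
      by (simp add: Lim_transform_eventually)
    then have "(h has_real_derivative ?D) (at t)"
      by (simp add: has_field_derivative_iff)
    moreover have "\<mu> * h t \<le> ?D"
    proof -
      let ?F = "\<lambda>x. f (U t x) - f (\<phi> (x - c * t))" and ?G = "\<lambda>x. g (U t x) - g (\<phi> (x - c * t))"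
      \<comment> \<open>Integration by parts, kept as an integral equal to 0: adding it to the
        integrand exchanges the slope term for V Z''.\<close>
      have "((\<lambda>x. V t x * ?Z'' x + V' t x * ?Z' x) has_integral (V t L * ?Z' L - V t 0 * ?Z' 0)) {0..L}"
        using L_pos
        by (intro fundamental_theorem_of_calculus)
          (auto simp: has_real_derivative_iff_has_vector_derivative[symmetric]
            intro!: has_field_derivative_at_within[OF DERIV_mult'] V_deriv t0 Zt)
      moreover have "V t L * ?Z' L = V t 0 * ?Z' 0"
        using shift_per_eq[OF Z'p, of "c * t"] V_per[OF t0, unfolded periodic_def, rule_format, of 0] by simp
      ultimately have parts: "integral {0..L} (\<lambda>x. V t x * ?Z'' x + V' t x * ?Z' x) = 0"
        by (simp add: integral_unique)
      have "\<mu> * h t = integral {0..L} (\<lambda>x. \<mu> * (V t x * ?Z x))"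
        unfolding h_def by simp
      also have "\<dots> \<le> integral {0..L} (\<lambda>x. (((?F x - V' t x) * ?Z' x + ?G x * ?Z x) + (- c * ?Z' x * V t x))
          + (V t x * ?Z'' x + V' t x * ?Z' x))"
      proof (rule integral_le)
        fix x assume x: "x \<in> {0..L}"
        let ?y = "x - c * t"
        have v: "0 \<le> V t x" "V t x \<le> \<delta>" using V[OF t x] by auto
        have U: "U t x = \<phi> ?y + V t x" by (simp add: V_def)
        have "(f' (\<phi> ?y) * V t x - ?F x) * ?Z' x \<le> \<eta> * V t x * \<bar>?Z' x\<bar>"
        proof -
          have "(f' (\<phi> ?y) * V t x - ?F x) * ?Z' x \<le> \<bar>f' (\<phi> ?y) * V t x - ?F x\<bar> * \<bar>?Z' x\<bar>"
            by (metis abs_ge_self abs_mult)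
          also have "\<dots> \<le> \<eta> * V t x * \<bar>?Z' x\<bar>"
            using lin_f[OF v, of ?y] unfolding U by (intro mult_right_mono) auto
          finally show ?thesis .
        qed
        moreover have "(g' (\<phi> ?y) * V t x - ?G x) * ?Z x \<le> \<eta> * V t x * ?Z x"
          using lin_g[OF v, of ?y] Z(5)[of ?y] unfolding U by (intro mult_right_mono) auto
        moreover have "V t x * (\<mu> * ?Z x + \<eta> * (\<bar>?Z' x\<bar> + ?Z x))
            \<le> V t x * (?Z'' x - (c - f' (\<phi> ?y)) * ?Z' x + g' (\<phi> ?y) * ?Z x)"
          using sub[of ?y] v(1) by (rule mult_left_mono)
        ultimately show "\<mu> * (V t x * ?Z x) \<le> (((?F x - V' t x) * ?Z' x + ?G x * ?Z x) + (- c * ?Z' x * V t x))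
          + (V t x * ?Z'' x + V' t x * ?Z' x)"
          by (simp add: algebra_simps)
      qed (intro integrable_continuous_interval continuous_intros sc V_cont V'_cont f_compose g_compose U_cont t0)+
      also have "\<dots> = integral {0..L} (\<lambda>x. ((?F x - V' t x) * ?Z' x + ?G x * ?Z x) + (- c * ?Z' x * V t x))
          + integral {0..L} (\<lambda>x. V t x * ?Z'' x + V' t x * ?Z' x)"
        by (intro integral_add_continuous continuous_intros
            sc V_cont V'_cont f_compose g_compose U_cont t0)
      also have "integral {0..L} (\<lambda>x. ((?F x - V' t x) * ?Z' x + ?G x * ?Z x) + (- c * ?Z' x * V t x)) = ?D"
        unfolding V_rate_def
        by (intro integral_add_continuous continuous_intros
            sc V_cont V'_cont f_compose g_compose U_cont t0)
      finally show ?thesis using parts by simp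
    qed
    ultimately show ?thesis by blast
  qed
  \<comment> \<open>The upper bound of Gronwall for -h is the lower bound for h.\<close>
  have "- h T \<le> - h 0 * exp (\<mu> * T)"
  proof (rule gronwall[OF T])
    show "continuous_on {0..T} (\<lambda>t. - h t)"
      unfolding continuous_on_def
      by (intro ballI tendsto_minus tendsto_within_subset[OF h_cont]) auto
    show "\<exists>D. ((\<lambda>t. - h t) has_real_derivative D) (at t) \<and> D \<le> \<mu> * - h t" if t: "0 < t" for t
    proof -
      obtain D where "(h has_real_derivative D) (at t)" "\<mu> * h t \<le> D" using h_deriv[OF t] by blast
      then show ?thesis by (intro exI[of _ "- D"]) (auto intro: DERIV_minus)
    qed
  qed
  then show ?thesis unfolding h_def by simp
qed

end

section \<open>A strict subsolution of the adjoint linearisation\<close>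

text \<open>
  The formula is chosen so that \<open>\<zeta> = smooth_pos k\<close> is convex and \<open>C\<^sup>2\<close> with
  \<open>0 \<le> s \<zeta>' - \<zeta> \<le> 2 k \<zeta>'\<close>: composition with \<open>\<zeta>\<close> then almost preserves
  linear differential inequalities of second order.
\<close>

definition smooth_pos :: "real \<Rightarrow> real \<Rightarrow> real" where
  "smooth_pos k s = (max 0 s) ^ 3 / (max 0 s + k) ^ 2"

definition smooth_pos' :: "real \<Rightarrow> real \<Rightarrow> real" where
  "smooth_pos' k s = (max 0 s) ^ 2 * (max 0 s + 3 * k) / (max 0 s + k) ^ 3"

definition smooth_pos'' :: "real \<Rightarrow> real \<Rightarrow> real" where
  "smooth_pos'' k s = 6 * k\<^sup>2 * max 0 s / (max 0 s + k) ^ 4"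

lemma smooth_pos_eq_0:
  "s \<le> 0 \<Longrightarrow> smooth_pos k s = 0" "s \<le> 0 \<Longrightarrow> smooth_pos' k s = 0" "s \<le> 0 \<Longrightarrow> smooth_pos'' k s = 0"
  by (simp_all add: smooth_pos_def smooth_pos'_def smooth_pos''_def max_def)

lemma smooth_pos_deriv:
  assumes k: "k > 0"
  shows "(smooth_pos k has_real_derivative smooth_pos' k s) (at s)"
proof (rule pos_part_deriv_glue[where C = "1 / k"])
  fix s :: real assume s: "s > 0"
  have sk: "s + k > 0" using s k by simp
  have "((\<lambda>s. s ^ 3 / (s + k) ^ 2) has_real_derivative s ^ 2 * (s + 3 * k) / (s + k) ^ 3) (at s)"
  proof -
    have "((\<lambda>s. s ^ 3 / (s + k) ^ 2) has_real_derivative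
      (3 * s ^ 2 * (s + k) ^ 2 - s ^ 3 * (2 * (s + k))) / ((s + k) ^ 2 * (s + k) ^ 2)) (at s)"
      using sk by (auto intro!: derivative_eq_intros)
    also have "(3 * s ^ 2 * (s + k) ^ 2 - s ^ 3 * (2 * (s + k))) = (s + k) * (s ^ 2 * (s + 3 * k))"
      by (simp add: power2_eq_square power3_eq_cube algebra_simps)
    also have "\<dots> / ((s + k) ^ 2 * (s + k) ^ 2) = s ^ 2 * (s + 3 * k) / (s + k) ^ 3"
      using sk by (simp add: power2_eq_square power3_eq_cube mult_ac)
    finally show ?thesis .
  qed
  moreover have "eventually (\<lambda>s. s ^ 3 / (s + k) ^ 2 = smooth_pos k s) (nhds s)"
    using eventually_nhds_in_open[of "{0<..}" s] s by (auto simp: smooth_pos_def elim!: eventually_mono)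
  ultimately show "(smooth_pos k has_real_derivative smooth_pos' k s) (at s)"
    using s DERIV_cong_ev[OF refl, of "\<lambda>s. s ^ 3 / (s + k) ^ 2" "smooth_pos k" s] by (simp add: smooth_pos'_def)
  have "\<bar>smooth_pos k s\<bar> = s\<^sup>2 * ((s / (s + k)) * (1 / (s + k)))"
    using s sk by (simp add: smooth_pos_def power2_eq_square power3_eq_cube)
  also have "\<dots> \<le> s\<^sup>2 * (1 * (1 / k))"
    using s k by (intro mult_left_mono mult_mono) (auto simp: field_simps)
  finally show "\<bar>smooth_pos k s\<bar> \<le> 1 / k * s\<^sup>2" by simp
qed (simp add: smooth_pos_eq_0)

lemma smooth_pos'_deriv:
  assumes k: "k > 0"
  shows "(smooth_pos' k has_real_derivative smooth_pos'' k s) (at s)"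
proof (rule pos_part_deriv_glue[where C = "3 / k\<^sup>2"])
  fix s :: real assume s: "s > 0"
  have sk: "s + k > 0" using s k by simp
  have "((\<lambda>s. s ^ 2 * (s + 3 * k) / (s + k) ^ 3) has_real_derivative 6 * k\<^sup>2 * s / (s + k) ^ 4) (at s)"
  proof -
    have "((\<lambda>s. s ^ 2 * (s + 3 * k) / (s + k) ^ 3) has_real_derivative
      ((2 * s * (s + 3 * k) + s ^ 2) * (s + k) ^ 3 - s ^ 2 * (s + 3 * k) * (3 * (s + k) ^ 2)) / ((s + k) ^ 3 * (s + k) ^ 3)) (at s)"
      using sk by (auto intro!: derivative_eq_intros)
    also have "((2 * s * (s + 3 * k) + s ^ 2) * (s + k) ^ 3 - s ^ 2 * (s + 3 * k) * (3 * (s + k) ^ 2))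
        = (s + k) ^ 2 * (6 * k\<^sup>2 * s)"
      by (simp add: power2_eq_square power3_eq_cube algebra_simps)
    also have "\<dots> / ((s + k) ^ 3 * (s + k) ^ 3) = 6 * k\<^sup>2 * s / (s + k) ^ 4"
    proof -
      have split: "(s + k) ^ 3 * (s + k) ^ 3 = (s + k) ^ 2 * (s + k) ^ 4" by (simp flip: power_add)
      show ?thesis unfolding split by (rule mult_divide_mult_cancel_left) (use sk in simp)
    qed
    finally show ?thesis .
  qed
  moreover have "eventually (\<lambda>s. s ^ 2 * (s + 3 * k) / (s + k) ^ 3 = smooth_pos' k s) (nhds s)"
    using eventually_nhds_in_open[of "{0<..}" s] s by (auto simp: smooth_pos'_def elim!: eventually_mono)
  ultimately show "(smooth_pos' k has_real_derivative smooth_pos'' k s) (at s)"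
    using s DERIV_cong_ev[OF refl, of "\<lambda>s. s ^ 2 * (s + 3 * k) / (s + k) ^ 3" "smooth_pos' k" s] by (simp add: smooth_pos''_def)
  have "\<bar>smooth_pos' k s\<bar> = s\<^sup>2 * (((s + 3 * k) / (s + k)) * (1 / (s + k)\<^sup>2))"
    using s k by (simp add: smooth_pos'_def power2_eq_square power3_eq_cube)
  also have "\<dots> \<le> s\<^sup>2 * (3 * (1 / k\<^sup>2))"
    using s k by (intro mult_left_mono mult_mono) (auto simp: field_simps intro!: power_mono)
  finally show "\<bar>smooth_pos' k s\<bar> \<le> 3 / k\<^sup>2 * s\<^sup>2" by (simp add: mult.commute)
qed (simp add: smooth_pos_eq_0)

lemma smooth_pos''_continuous: "k > 0 \<Longrightarrow> continuous_on UNIV (smooth_pos'' k)"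
  unfolding smooth_pos''_def
  by (intro continuous_intros continuous_on_max) (auto simp: max_def)

text \<open>The last two inequalities rest on the identity s \<zeta>' - \<zeta> = 2 k (s / (s +
  k))^3, whose last factor is at most \<zeta>'.\<close>

lemma smooth_pos_props:
  assumes k: "k > 0" and s: "s > 0"
  shows "smooth_pos k s > 0" "smooth_pos' k s \<ge> 0" "smooth_pos'' k s \<ge> 0"
    "smooth_pos k s \<le> s * smooth_pos' k s"
    "s * smooth_pos' k s - smooth_pos k s \<le> 2 * k * smooth_pos' k s"
proof -
  have sk: "s + k > 0" using s k by simp
  show "smooth_pos k s > 0" "smooth_pos' k s \<ge> 0" "smooth_pos'' k s \<ge> 0"
    using s k by (auto simp: smooth_pos_def smooth_pos'_def smooth_pos''_def)
  have "smooth_pos k s = s ^ 3 * (s + k) / (s + k) ^ 3"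
    using s sk by (simp add: smooth_pos_def power2_eq_square power3_eq_cube)
  then have "s * smooth_pos' k s - smooth_pos k s = (s * (s\<^sup>2 * (s + 3 * k)) - s ^ 3 * (s + k)) / (s + k) ^ 3"
    using s by (simp add: smooth_pos'_def diff_divide_distrib)
  also have "s * (s\<^sup>2 * (s + 3 * k)) - s ^ 3 * (s + k) = 2 * k * s ^ 3"
    by (simp add: power2_eq_square power3_eq_cube algebra_simps)
  finally have eq: "s * smooth_pos' k s - smooth_pos k s = 2 * k * (s ^ 3 / (s + k) ^ 3)" by simp
  have "s ^ 3 / (s + k) ^ 3 \<ge> 0" using s k by simp
  then show "smooth_pos k s \<le> s * smooth_pos' k s" using eq k mult_nonneg_nonneg[of "2 * k"] by smt
  have "s ^ 3 / (s + k) ^ 3 \<le> s\<^sup>2 * (s + 3 * k) / (s + k) ^ 3"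
    using s k by (intro divide_right_mono) (auto simp: power2_eq_square power3_eq_cube intro!: mult_left_mono)
  then have "s ^ 3 / (s + k) ^ 3 \<le> smooth_pos' k s" using s by (simp add: smooth_pos'_def)
  then show "s * smooth_pos' k s - smooth_pos k s \<le> 2 * k * smooth_pos' k s"
    unfolding eq using k by (intro mult_left_mono) auto
qed

section \<open>Periodic continuation from one window\<close>

definition periodize :: "real \<Rightarrow> real \<Rightarrow> (real \<Rightarrow> real) \<Rightarrow> real \<Rightarrow> real" where
  "periodize a L w x = w (x - of_int \<lfloor>(x - a) / L\<rfloor> * L)"

lemma periodic_periodize: "L > 0 \<Longrightarrow> periodic L (periodize a L w)"
proof -
  assume L: "L > 0"
  have "\<lfloor>(x + L - a) / L\<rfloor> = \<lfloor>(x - a) / L\<rfloor> + 1" for x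
  proof -
    have "(x + L - a) / L = (x - a) / L + 1" using L by (simp add: field_simps)
    then show ?thesis by simp
  qed
  then show ?thesis unfolding periodic_def periodize_def by (simp add: algebra_simps)
qed

lemma periodize_eq_shift:
  assumes L: "L > 0" and y: "y - of_int n * L \<in> {a..<a + L}"
  shows "periodize a L w y = w (y - of_int n * L)"
proof -
  have "of_int n \<le> (y - a) / L" "(y - a) / L < of_int n + 1"
    using L y by (auto simp: field_simps)
  then have "\<lfloor>(y - a) / L\<rfloor> = n" by linarith
  then show ?thesis by (simp add: periodize_def)
qed

text \<open>Near every point the continuation is a single translate of w, so differentiability and
  continuity carry over. Only the joints need an argument: there the two competing translates both
  vanish.\<close>

lemma periodize_eventually:
  assumes L: "L > 0" and r: "r > 0"
    and van: "\<And>x. \<bar>x - a\<bar> < r \<Longrightarrow> w x = 0" "\<And>x. \<bar>x - (a + L)\<bar> < r \<Longrightarrow> w x = 0"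
  shows "\<forall>\<^sub>F y in nhds x. periodize a L w y = w (y - of_int \<lfloor>(x - a) / L\<rfloor> * L)"
proof -
  define n where "n = \<lfloor>(x - a) / L\<rfloor>"
  define b where "b = x - of_int n * L"
  have b: "a \<le> b" "b < a + L"
    using floor_shift_in_window[OF L, of x a] by (auto simp: b_def n_def)
  \<comment> \<open>Inside a window the radius avoids both ends. At a joint it stays within the zone
    of length r where w vanishes, and within one neighbouring window.\<close>
  define d where "d = min (min r L) (if b = a then L else min (b - a) (a + L - b))"
  have d: "d > 0" "d \<le> r" "d \<le> L" using L r b by (auto simp: d_def)
  have "\<forall>\<^sub>F y in nhds x. y \<in> {x - d<..<x + d}"
    using d(1) by (intro eventually_nhds_in_open) auto
  then show ?thesis
  proof eventually_elim
    case (elim y)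
    show ?case
    proof (cases "y - of_int n * L \<in> {a..<a + L}")
      case True
      then show ?thesis using periodize_eq_shift[OF L True] by (simp add: n_def)
    next
      case False
      have "b = a"
      proof (rule ccontr)
        assume "b \<noteq> a"
        then have "d \<le> b - a" "d \<le> a + L - b" by (auto simp: d_def)
        then show False using False elim by (auto simp: b_def)
      qed
      then have x: "x = a + of_int n * L" by (simp add: b_def)
      have y: "y - of_int n * L < a" using False elim d(3) by (auto simp: x)
      have z: "y - of_int (n - 1) * L = y - of_int n * L + L" by (simp add: algebra_simps)
      have "y - of_int (n - 1) * L \<in> {a..<a + L}"
        unfolding z using y elim d(3) by (auto simp: x)
      then have "periodize a L w y = w (y - of_int (n - 1) * L)"
        by (rule periodize_eq_shift[OF L])
      also have "\<dots> = 0"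
        unfolding z using elim d(2) y by (intro van(2)) (auto simp: x)
      also have "0 = w (y - of_int n * L)"
        using elim d(2) y by (intro van(1)[symmetric]) (auto simp: x)
      finally show ?thesis by (simp add: n_def)
    qed
  qed
qed

lemma periodize_deriv:
  assumes L: "L > 0" and r: "r > 0"
    and van: "\<And>x. \<bar>x - a\<bar> < r \<Longrightarrow> w x = 0" "\<And>x. \<bar>x - (a + L)\<bar> < r \<Longrightarrow> w x = 0"
    and w: "\<And>x. (w has_real_derivative w' x) (at x)"
  shows "(periodize a L w has_real_derivative periodize a L w' x) (at x)"
proof -
  have "(periodize a L w has_real_derivative periodize a L w' x) (at x) \<longleftrightarrow>
      ((\<lambda>y. w (y - of_int \<lfloor>(x - a) / L\<rfloor> * L)) has_real_derivative periodize a L w' x) (at x)"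
    by (rule DERIV_cong_ev[OF refl _ refl]) (rule periodize_eventually[where a = a and w = w, OF L r van])
  then show ?thesis
    using shift_has_derivative[OF w] by (simp add: periodize_def[of a L w'])
qed

lemma periodize_continuous:
  assumes L: "L > 0" and r: "r > 0"
    and van: "\<And>x. \<bar>x - a\<bar> < r \<Longrightarrow> w x = 0" "\<And>x. \<bar>x - (a + L)\<bar> < r \<Longrightarrow> w x = 0"
    and w: "continuous_on UNIV w"
  shows "continuous_on UNIV (periodize a L w)"
proof (rule continuous_at_imp_continuous_on, intro ballI)
  fix x
  have "isCont (\<lambda>y. w (y - of_int \<lfloor>(x - a) / L\<rfloor> * L)) x"
    using continuous_shift[OF w, of UNIV] by (simp add: continuous_on_eq_continuous_at)
  then show "isCont (periodize a L w) x"
    using isCont_cong[OF periodize_eventually[where a = a and w = w, OF L r van]] by simp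
qed

context periodic_wave
begin

text \<open>
  With \<open>a = c - f'(\<phi>)\<close> and \<open>A' = a\<close>, the function \<open>exp A * \<phi>'\<close> lies in the kernel of the adjoint
  linearisation \<open>y'' - a y' + g'(\<phi>) y\<close>. Adding a small multiple of a growing exponential makes it a
  strict subsolution; its (smoothed) positive part, on a window of length \<open>L\<close> at whose ends it is negative, is
  the required weight.
\<close>

theorem subsolution_weight:
  assumes x1: "\<phi>' x1 < 0" and x2: "\<phi>' x2 > 0"
  obtains Z Z' Z'' \<mu> where
    "\<And>x. (Z has_real_derivative Z' x) (at x)" "\<And>x. (Z' has_real_derivative Z'' x) (at x)"
    "continuous_on UNIV Z''" "periodic L Z" "\<And>x. Z x \<ge> 0" "\<exists>x. Z x > 0" "\<mu> > 0"
    "\<And>x. \<mu> * Z x + \<mu> * (\<bar>Z' x\<bar> + Z x) \<le> Z'' x - (c - f' (\<phi> x)) * Z' x + g' (\<phi> x) * Z x"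
proof -
  define a where "a x = c - f' (\<phi> x)" for x
  define q where "q x = g' (\<phi> x)" for x
  have ac: "continuous_on UNIV a" and qc: "continuous_on UNIV q"
    unfolding a_def q_def by (intro continuous_intros f'_compose g'_compose \<phi>_cont)+
  have ap: "periodic L a" and qp: "periodic L q"
    using \<phi>_per by (auto simp: periodic_def a_def q_def)
  obtain am where am: "am > 0" "\<And>x. \<bar>a x\<bar> \<le> am" using periodic_bounded[OF L_pos ap ac] by blast
  obtain qm where qm: "qm > 0" "\<And>x. \<bar>q x\<bar> \<le> qm" using periodic_bounded[OF L_pos qp qc] by blast
  obtain A where A: "\<And>x. (A has_real_derivative a x) (at x)" using antiderivative_exists[OF ac] by blast
  define y where "y x = exp (A x) * \<phi>' x" for x
  \<comment> \<open>The profile equation has eliminated \<phi>'' here, so y can be differentiated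
    once more without a third derivative of \<phi>.\<close>
  define y' where "y' x = - exp (A x) * g (\<phi> x)" for x
  define y'' where "y'' x = - exp (A x) * (a x * g (\<phi> x) + q x * \<phi>' x)" for x
  have dy: "(y has_real_derivative y' x) (at x)" for x
  proof -
    have "(y has_real_derivative exp (A x) * a x * \<phi>' x + exp (A x) * \<phi>'' x) (at x)"
      unfolding y_def by (auto intro!: derivative_eq_intros A \<phi>'_deriv)
    also have "exp (A x) * a x * \<phi>' x + exp (A x) * \<phi>'' x = exp (A x) * (\<phi>'' x + a x * \<phi>' x)"
      by (simp add: algebra_simps)
    also have "\<phi>'' x + a x * \<phi>' x = - g (\<phi> x)" using profile[of x] by (simp add: a_def)
    finally show ?thesis by (simp add: y'_def)
  qed
  have dg: "((\<lambda>x. g (\<phi> x)) has_real_derivative q x * \<phi>' x) (at x)" for x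
    unfolding q_def by (rule DERIV_chain2[OF g_deriv \<phi>_deriv])
  have dy': "(y' has_real_derivative y'' x) (at x)" for x
    unfolding y'_def y''_def
    by (auto intro!: derivative_eq_intros A dg simp: algebra_simps)
  \<comment> \<open>Large enough for k^2 - a k + q \<ge> 1 everywhere.\<close>
  define k where "k = 1 + am + qm"
  define e where "e x = exp (k * (x - x1))" for x
  have de: "(e has_real_derivative k * e x) (at x)" for x
    unfolding e_def by (auto intro!: derivative_eq_intros)
  have e_pos: "e x > 0" for x by (simp add: e_def)
  have yneg: "y x1 < 0" "y (x1 + L) < 0"
    using x1 \<phi>'_per by (auto simp: y_def mult_pos_neg periodic_def)
  \<comment> \<open>Small enough that z stays negative at both ends of the window. The ends need
    separate bounds because exp A, and hence y, need not be periodic.\<close>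
  define \<delta> where "\<delta> = min (- y x1 / e x1) (- y (x1 + L) / e (x1 + L)) / 2"
  have \<delta>: "\<delta> > 0" "\<delta> < - y x1 / e x1" "\<delta> < - y (x1 + L) / e (x1 + L)"
  proof -
    have "min \<alpha> \<beta> / 2 > 0" "min \<alpha> \<beta> / 2 < \<alpha>" "min \<alpha> \<beta> / 2 < \<beta>" if "\<alpha> > 0" "\<beta> > 0" for \<alpha> \<beta> :: real
      using that by auto
    moreover have "- y x1 / e x1 > 0" "- y (x1 + L) / e (x1 + L) > 0"
      using yneg e_pos by (simp_all add: divide_neg_pos)
    ultimately show "\<delta> > 0" "\<delta> < - y x1 / e x1" "\<delta> < - y (x1 + L) / e (x1 + L)"
      unfolding \<delta>_def by blast+
  qed
  define z where "z x = y x + \<delta> * e x" for x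
  define z' where "z' x = y' x + \<delta> * (k * e x)" for x
  define z'' where "z'' x = y'' x + \<delta> * (k * (k * e x))" for x
  have dz: "(z has_real_derivative z' x) (at x)" "(z' has_real_derivative z'' x) (at x)" for x
    unfolding z_def[abs_def] z'_def[abs_def] z''_def by (intro DERIV_add DERIV_cmult dy dy' de)+
  have zneg: "z x1 < 0" "z (x1 + L) < 0"
    using \<delta> e_pos[of x1] e_pos[of "x1 + L"] by (simp_all add: z_def field_simps)
  have zpos: "z x > 0" if "\<phi>' x > 0" for x
    using that \<delta>(1) e_pos[of x] by (simp add: z_def y_def add_pos_pos)
  have zc: "continuous_on S z" "continuous_on S z'" for S
    by (rule has_real_derivative_continuous_on, rule dz)+
  have z''c: "continuous_on S z''" for S
    unfolding z''_def y''_def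
    by (intro continuous_intros continuous_on_subset[OF ac] continuous_on_subset[OF qc] g_compose \<phi>_cont \<phi>'_cont
        has_real_derivative_continuous_on[OF A] has_real_derivative_continuous_on[OF de]) auto
  \<comment> \<open>The term y is in the kernel, so only the exponential contributes, and it is at
    least 1 to the right of x1.\<close>
  have sub: "z'' x - a x * z' x + q x * z x \<ge> \<delta>" if x: "x \<ge> x1" for x
  proof -
    have "z'' x - a x * z' x + q x * z x = \<delta> * (e x * (k * k - a x * k + q x))"
      by (simp add: z_def z'_def z''_def y_def y'_def y''_def algebra_simps)
    moreover have "e x * (k * k - a x * k + q x) \<ge> 1 * 1"
    proof (rule mult_mono)
      have k1: "k \<ge> 1" using am qm by (simp add: k_def)
      show "1 \<le> e x" using x k1 by (simp add: e_def)
      have "a x * k \<le> am * k" using am(2)[of x] k1 by (intro mult_right_mono) auto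
      then have "k * k - a x * k \<ge> k * (1 + qm)" by (simp add: k_def algebra_simps)
      moreover have "k * (1 + qm) \<ge> 1 * (1 + qm)" using k1 qm by (intro mult_right_mono) auto
      ultimately show "1 \<le> k * k - a x * k + q x" using qm(2)[of x] by simp
    qed (use e_pos[of x] in auto)
    ultimately show ?thesis using \<delta>(1) by simp
  qed
  obtain r where r: "r > 0" "\<And>x. \<bar>x - x1\<bar> < r \<Longrightarrow> z x < 0" "\<And>x. \<bar>x - (x1 + L)\<bar> < r \<Longrightarrow> z x < 0"
  proof -
    have "\<forall>\<^sub>F x in nhds b. z x < 0" if "z b < 0" for b
    proof -
      have "isCont z b" using dz(1) DERIV_isCont by blast
      then show ?thesis using that by (metis continuous_at_imp_continuous_on isCont_def order_tendstoD(2) tendsto_at_iff_tendsto_nhds)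
    qed
    from this[OF zneg(1)] this[OF zneg(2)] obtain r1 r2 where
      "r1 > 0" "\<And>x. \<bar>x - x1\<bar> < r1 \<Longrightarrow> z x < 0" "r2 > 0" "\<And>x. \<bar>x - (x1 + L)\<bar> < r2 \<Longrightarrow> z x < 0"
      unfolding eventually_nhds_metric dist_real_def by blast
    then show ?thesis using that[of "min r1 r2"] by auto
  qed
  obtain Bz where Bz: "Bz > 0" "\<And>x. x \<in> {x1..x1 + L} \<Longrightarrow> \<bar>z x\<bar> \<le> Bz" "\<And>x. x \<in> {x1..x1 + L} \<Longrightarrow> \<bar>z' x\<bar> \<le> Bz"
  proof -
    obtain B1 B2 where B12: "B1 > 0" "\<And>x. x \<in> {x1..x1 + L} \<Longrightarrow> \<bar>z x\<bar> \<le> B1" "B2 > 0" "\<And>x. x \<in> {x1..x1 + L} \<Longrightarrow> \<bar>z' x\<bar> \<le> B2"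
      using compact_imp_bounded[OF compact_continuous_image[OF zc(1) compact_Icc, of x1 "x1 + L"]]
        compact_imp_bounded[OF compact_continuous_image[OF zc(2) compact_Icc, of x1 "x1 + L"]]
      unfolding bounded_pos real_norm_def by (metis image_eqI)
    show ?thesis by (rule that[of "max B1 B2"]) (use B12 in \<open>auto simp: le_max_iff_disj\<close>)
  qed
  \<comment> \<open>With this value the smoothing error |q| (z \<zeta>' - \<zeta>) is at most
    \<delta> \<zeta>' / 2, half of the available gain.\<close>
  define \<kappa> where "\<kappa> = \<delta> / (4 * qm)"
  have \<kappa>: "\<kappa> > 0" using \<delta>(1) qm(1) by (simp add: \<kappa>_def)
  define w where "w x = smooth_pos \<kappa> (z x)" for x
  define w' where "w' x = smooth_pos' \<kappa> (z x) * z' x" for x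
  define w'' where "w'' x = smooth_pos'' \<kappa> (z x) * z' x * z' x + smooth_pos' \<kappa> (z x) * z'' x" for x
  have dw: "(w has_real_derivative w' x) (at x)" for x
    unfolding w_def[abs_def] w'_def by (rule DERIV_chain2[OF smooth_pos_deriv[OF \<kappa>] dz(1)])
  have dw': "(w' has_real_derivative w'' x) (at x)" for x
    unfolding w'_def[abs_def] w''_def
    by (auto intro!: derivative_eq_intros DERIV_chain2[OF smooth_pos'_deriv[OF \<kappa>] dz(1)] dz(2))
  have w''c: "continuous_on UNIV w''"
    unfolding w''_def
    by (intro continuous_intros zc z''c continuous_on_compose2[OF smooth_pos''_continuous[OF \<kappa>] zc(1)]
      continuous_on_compose2[OF has_real_derivative_continuous_on[OF smooth_pos'_deriv[OF \<kappa>]] zc(1)]) auto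
  have van: "w x = 0" "w' x = 0" "w'' x = 0" if "z x \<le> 0" for x
    using that by (simp_all add: w_def w'_def w''_def smooth_pos_eq_0)
  have w0: "w x \<ge> 0" for x
    using van(1)[of x] smooth_pos_props(1)[OF \<kappa>, of "z x"] by (cases "z x \<le> 0") (auto simp: w_def)
  \<comment> \<open>The terms on the left of the final inequality total at most 3 \<mu> Bz \<zeta>'
    = \<delta> \<zeta>' / 2, the other half of the gain.\<close>
  define \<mu> where "\<mu> = \<delta> / (6 * Bz)"
  have \<mu>: "\<mu> > 0" using \<delta>(1) Bz(1) by (simp add: \<mu>_def)
  \<comment> \<open>For w = \<zeta>(z) the operator gives \<zeta>'(z) times its value at z, plus the
    nonnegative \<zeta>''(z) z'^2, plus the error q (\<zeta>(z) - z \<zeta>'(z)).\<close>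
  have ineq: "\<mu> * w x + \<mu> * (\<bar>w' x\<bar> + w x) \<le> w'' x - a x * w' x + q x * w x" if x: "x \<in> {x1..x1 + L}" for x
  proof (cases "z x \<le> 0")
    case True
    then show ?thesis by (simp add: van)
  next
    case False
    then have zx: "z x > 0" by simp
    let ?s = "smooth_pos \<kappa> (z x)" and ?s' = "smooth_pos' \<kappa> (z x)" and ?s'' = "smooth_pos'' \<kappa> (z x)"
    note sp = smooth_pos_props[OF \<kappa> zx]
    have "\<mu> * w x + \<mu> * (\<bar>w' x\<bar> + w x) = \<mu> * (2 * ?s + ?s' * \<bar>z' x\<bar>)"
      using sp(2) by (simp add: w_def w'_def abs_mult algebra_simps)
    also have "\<dots> \<le> \<mu> * (2 * (Bz * ?s') + ?s' * Bz)"
    proof (intro mult_left_mono add_mono)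
      have "z x * ?s' \<le> Bz * ?s'" using Bz(2)[OF x] sp(2) by (intro mult_right_mono) auto
      then show "?s \<le> Bz * ?s'" using sp(4) by linarith
    qed (use \<mu> sp(2) Bz(3)[OF x] in auto)
    also have "\<dots> = ?s' * (\<delta> / 2)"
      using Bz(1) by (simp add: \<mu>_def field_simps)
    also have "\<dots> = ?s' * \<delta> - qm * (2 * \<kappa> * ?s')"
      using qm(1) by (simp add: \<kappa>_def field_simps)
    also have "\<dots> \<le> ?s' * (z'' x - a x * z' x + q x * z x) + q x * (?s - z x * ?s')"
    proof -
      have "?s' * \<delta> \<le> ?s' * (z'' x - a x * z' x + q x * z x)"
        using sub[of x] x sp(2) by (intro mult_left_mono) auto
      moreover have "\<bar>q x * (?s - z x * ?s')\<bar> \<le> qm * (2 * \<kappa> * ?s')"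
        unfolding abs_mult using sp(4,5) qm by (intro mult_mono) auto
      ultimately show ?thesis by linarith
    qed
    also have "\<dots> \<le> ?s'' * (z' x * z' x) + (?s' * (z'' x - a x * z' x + q x * z x) + q x * (?s - z x * ?s'))"
      using sp(3) by simp
    also have "\<dots> = w'' x - a x * w' x + q x * w x"
      by (simp add: w_def w'_def w''_def algebra_simps)
    finally show ?thesis .
  qed
  note rv = r(2)[THEN less_imp_le] r(3)[THEN less_imp_le]
  \<comment> \<open>Unlike exp A, the coefficients are periodic, so the inequality on the window
    carries over to the continuation.\<close>
  have a_shift: "a (x - of_int n * L) = a x" "q (x - of_int n * L) = q x" for x n
    using periodic_shift_int[OF ap, of "x - of_int n * L" n] periodic_shift_int[OF qp, of "x - of_int n * L" n] by simp_all
  show ?thesis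
  proof (rule that[of "periodize x1 L w" "periodize x1 L w'" "periodize x1 L w''" \<mu>])
    show "(periodize x1 L w has_real_derivative periodize x1 L w' x) (at x)" for x
      by (rule periodize_deriv[OF L_pos r(1) _ _ dw]) (use rv van in auto)
    show "(periodize x1 L w' has_real_derivative periodize x1 L w'' x) (at x)" for x
      by (rule periodize_deriv[OF L_pos r(1) _ _ dw']) (use rv van in auto)
    show "continuous_on UNIV (periodize x1 L w'')"
      by (rule periodize_continuous[OF L_pos r(1) _ _ w''c]) (use rv van in auto)
    show "periodic L (periodize x1 L w)" by (rule periodic_periodize[OF L_pos])
    show "periodize x1 L w x \<ge> 0" for x by (simp add: periodize_def w0)
    show "\<exists>x. periodize x1 L w x > 0"
    proof -
      have "\<phi>' (x2 - of_int \<lfloor>(x2 - x1) / L\<rfloor> * L) = \<phi>' x2"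
        using periodic_shift_int[OF \<phi>'_per, of "x2 - of_int \<lfloor>(x2 - x1) / L\<rfloor> * L" "\<lfloor>(x2 - x1) / L\<rfloor>"] by simp
      then have "z (x2 - of_int \<lfloor>(x2 - x1) / L\<rfloor> * L) > 0" using zpos x2 by simp
      then show ?thesis
        using smooth_pos_props(1)[OF \<kappa>] by (auto simp: periodize_def w_def)
    qed
    show "\<mu> > 0" by (rule \<mu>)
    show "\<mu> * periodize x1 L w x + \<mu> * (\<bar>periodize x1 L w' x\<bar> + periodize x1 L w x)
       \<le> periodize x1 L w'' x - (c - f' (\<phi> x)) * periodize x1 L w' x + g' (\<phi> x) * periodize x1 L w x" for x
      using ineq[of "x - of_int \<lfloor>(x - x1) / L\<rfloor> * L"] floor_shift_in_window[OF L_pos, of x x1]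
      unfolding a_shift by (simp add: periodize_def a_def q_def)
  qed
qed

end

section \<open>Instability of periodic waves with a fundamental period\<close>

lemma periodic_nondecreasing_imp_constant:
  fixes h :: "real \<Rightarrow> real"
  assumes L: "L > 0" and per: "periodic L h" and h: "\<And>x. (h has_real_derivative h' x) (at x)" "\<And>x. h' x \<ge> 0"
  shows "h x = h y"
proof -
  have mono: "h u \<le> h v" if "u \<le> v" for u v
    using that h by (metis DERIV_nonneg_imp_nondecreasing)
  have "h u \<le> h v" for u v
  proof -
    obtain n :: nat where "(u - v) / L \<le> real n" using real_arch_simple by blast
    then have "u \<le> v + real n * L" using L by (simp add: field_simps)
    then show ?thesis using mono periodic_shift_nat[OF per, of v n] by metis
  qed
  then show ?thesis by (metis antisym)
qed

text \<open>Half of the fundamental period is not a period, so h is not constant, whereas a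
  derivative of one sign would make it so.\<close>

lemma fundamental_period_deriv_signs:
  fixes h :: "real \<Rightarrow> real"
  assumes fp: "fundamental_period L h" and h: "\<And>x. (h has_real_derivative h' x) (at x)"
  shows "\<exists>x. h' x < 0" "\<exists>x. h' x > 0"
proof -
  have L: "L > 0" and per: "periodic L h" and nc: "\<not> periodic (L / 2) h"
    using fp by (auto simp: fundamental_period_def)
  obtain x where x: "h (x + L / 2) \<noteq> h x" using nc by (auto simp: periodic_def)
  show "\<exists>x. h' x < 0"
  proof (rule ccontr)
    assume "\<not> (\<exists>x. h' x < 0)"
    then show False using periodic_nondecreasing_imp_constant[OF L per h] x by (metis not_less)
  qed
  show "\<exists>x. h' x > 0"
  proof (rule ccontr)
    assume "\<not> (\<exists>x. h' x > 0)"
    then have "- h' x \<ge> 0" for x by (metis neg_0_le_iff_le not_less)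
    moreover have "periodic L (\<lambda>x. - h x)" using per by (simp add: periodic_def)
    ultimately have "- h (x + L / 2) = - h x"
      using periodic_nondecreasing_imp_constant[OF L, of "\<lambda>x. - h x" "\<lambda>x. - h' x"] h by (metis DERIV_minus)
    then show False using x by simp
  qed
qed

lemma Hs_norm_const:
  assumes L: "L > 0"
  shows "Hs_norm 2 L (\<lambda>x. r) = sqrt L * \<bar>r\<bar>"
proof -
  have fc: "fourier_coeff L (\<lambda>x. r) k = (if k = 0 then of_real r else 0)" for k
    using L integral_trig_monomial[OF L, of "- k"] unfolding fourier_coeff_per_M
    by (simp only: integral_mult_right_zero) simp
  have "((\<lambda>k::int. (1 + \<bar>of_int k\<bar>\<^sup>2) powr 2 * (cmod (fourier_coeff L (\<lambda>x. r) k))\<^sup>2) has_sum r\<^sup>2) UNIV"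
    by (rule has_sum_finite_neutralI[of "{0}"]) (auto simp: fc)
  then show ?thesis unfolding Hs_norm_def by (simp add: infsumI real_sqrt_mult)
qed

lemma orbit_dist_nonneg: "L > 0 \<Longrightarrow> orbit_dist L \<phi> w \<ge> 0"
  unfolding orbit_dist_def by (intro cINF_greatest Hs_norm_nonneg) auto

lemma orbit_dist_le: "L > 0 \<Longrightarrow> orbit_dist L \<phi> w \<le> Hs_norm 2 L (\<lambda>x. w x - \<phi> (x + r))"
  unfolding orbit_dist_def by (intro cINF_lower bdd_belowI2[of _ 0] Hs_norm_nonneg) auto

lemma orbit_dist_lessD: "orbit_dist L \<phi> w < d \<Longrightarrow> \<exists>r. Hs_norm 2 L (\<lambda>x. w x - \<phi> (x + r)) < d"
  unfolding orbit_dist_def using cInf_lessD[of "range (\<lambda>r. Hs_norm 2 L (\<lambda>x. w x - \<phi> (x + r)))" d] by auto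

context periodic_wave
begin

text \<open>The two parameters cover the wave, its translates and the perturbed initial
  datum.\<close>

lemma profile_in_Hs2: "(\<lambda>x. \<phi> (x + r) + \<rho>) \<in> Hs_per 2 L"
proof (rule C2_periodic_in_Hs2[OF L_pos])
  show "periodic L (\<lambda>x. \<phi> (x + r) + \<rho>)"
    using \<phi>_per unfolding periodic_def by (metis add.commute add.left_commute)
  show "((\<lambda>x. \<phi> (x + r) + \<rho>) has_real_derivative \<phi>' (x + r)) (at x)" for x
    using DERIV_add[OF shift_has_derivative[OF \<phi>_deriv, of "- r"] DERIV_const, of \<rho> x] by simp
  show "((\<lambda>x. \<phi>' (x + r)) has_real_derivative \<phi>'' (x + r)) (at x)" for x
    using shift_has_derivative[OF \<phi>'_deriv, of "- r" x] by simp
  show "continuous_on UNIV (\<lambda>x. \<phi>'' (x + r))"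
    using continuous_shift[OF \<phi>''_cont, of UNIV "- r"] by simp
qed

text \<open>The order of the constants carries the argument: the margin \<mu> of the weight fixes
  the size \<delta> allowed for V, then the distance e to the orbit; stability answers with d0, and
  only then is the perturbation \<rho> chosen.\<close>

theorem orbitally_unstable_periodic_wave:
  assumes fp: "fundamental_period L \<phi>"
  shows "orbitally_unstable f g L \<phi>"
proof -
  have inH: "\<phi> \<in> Hs_per 2 L"
    using profile_in_Hs2[of 0 0] by simp
  have "\<not> orbitally_stable f g L \<phi>"
  proof
    assume stable: "orbitally_stable f g L \<phi>"
    obtain x1 x2 where "\<phi>' x1 < 0" "\<phi>' x2 > 0"
      using fundamental_period_deriv_signs[OF fp \<phi>_deriv] by blast
    then obtain Z Z' Z'' \<mu> where
      Z: "\<And>x. (Z has_real_derivative Z' x) (at x)" "\<And>x. (Z' has_real_derivative Z'' x) (at x)"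
        "continuous_on UNIV Z''" "periodic L Z" "\<And>x. Z x \<ge> 0" "\<exists>x. Z x > 0" and \<mu>: "\<mu> > 0"
      and sub: "\<And>x. \<mu> * Z x + \<mu> * (\<bar>Z' x\<bar> + Z x) \<le> Z'' x - (c - f' (\<phi> x)) * Z' x + g' (\<phi> x) * Z x"
      using subsolution_weight[of x1 x2] by blast
    have Zc: "continuous_on S Z" for S using Z(1) by (auto intro: has_real_derivative_continuous_on)
    obtain B where B: "B > 0" "\<And>x. \<bar>\<phi> x\<bar> \<le> B"
      using periodic_bounded[OF L_pos \<phi>_per \<phi>_cont] by blast
    obtain df where df: "df > 0" "\<And>y v. \<bar>y\<bar> \<le> B \<Longrightarrow> 0 \<le> v \<Longrightarrow> v \<le> df \<Longrightarrow> \<bar>f (y + v) - f y - f' y * v\<bar> \<le> \<mu> * v"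
      using C1_uniform_linearization[OF f_deriv f'_cont \<mu>, of B] by blast
    obtain dg where dg: "dg > 0" "\<And>y v. \<bar>y\<bar> \<le> B \<Longrightarrow> 0 \<le> v \<Longrightarrow> v \<le> dg \<Longrightarrow> \<bar>g (y + v) - g y - g' y * v\<bar> \<le> \<mu> * v"
      using C1_uniform_linearization[OF g_deriv g'_cont \<mu>, of B] by blast
    define \<delta> where "\<delta> = min df dg"
    have \<delta>: "\<delta> > 0" "\<delta> \<le> df" "\<delta> \<le> dg" using df(1) dg(1) by (auto simp: \<delta>_def)
    then have "\<delta> / 2 > 0" by simp
    then obtain d where d: "d > 0" "\<And>r x. (\<And>x. \<phi> x \<le> \<phi> (x + r) + d) \<Longrightarrow> \<phi> (x + r) - \<phi> x \<le> \<delta> / 2"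
      using translate_above_imp_close by blast
    define \<epsilon> where "\<epsilon> = min d (\<delta> / 2)"
    have \<epsilon>: "\<epsilon> > 0" "\<epsilon> \<le> d" "\<epsilon> \<le> \<delta> / 2" using d(1) \<delta>(1) by (auto simp: \<epsilon>_def)
    \<comment> \<open>Converts the uniform distance \<epsilon> into a distance in H^2; the summand 1
      keeps the denominator positive.\<close>
    define e where "e = \<epsilon> / (sobolev_const L + 1)"
    have sc0: "sobolev_const L \<ge> 0"
      unfolding sobolev_const_def using L_pos
      by (intro real_sqrt_ge_zero divide_nonneg_pos infsum_nonneg) (auto simp: add_pos_nonneg)
    have e: "e > 0" "sobolev_const L * e \<le> \<epsilon>"
      using \<epsilon>(1) sc0 by (auto simp: e_def field_simps add_nonneg_pos)
    obtain d0 where d0: "d0 > 0" "\<And>\<psi>. \<psi> \<in> Hs_per 2 L \<Longrightarrow> orbit_dist L \<phi> \<psi> < d0 \<Longrightarrow>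
        \<exists>u. H2_global_solution f g L \<psi> u \<and> (SUP t\<in>{0<..}. ennreal (orbit_dist L \<phi> (u t))) < ennreal e"
      using stable e(1) unfolding orbitally_stable_def by blast
    \<comment> \<open>A constant \<rho> has H^2 norm sqrt L times \<rho>, here half of d0.\<close>
    define \<rho> where "\<rho> = d0 / (2 * sqrt L)"
    have \<rho>: "\<rho> > 0" "sqrt L * \<rho> < d0" using d0(1) L_pos by (auto simp: \<rho>_def)
    define \<psi> where "\<psi> x = \<phi> x + \<rho>" for x
    have \<psi>c: "continuous_on S \<psi>" for S unfolding \<psi>_def by (intro continuous_intros \<phi>_cont)
    have "\<psi> \<in> Hs_per 2 L" using profile_in_Hs2[of 0 \<rho>] by (simp add: \<psi>_def[abs_def])
    moreover have "orbit_dist L \<phi> \<psi> < d0"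
      using orbit_dist_le[OF L_pos, of \<phi> \<psi> 0] Hs_norm_const[OF L_pos, of \<rho>] \<rho> by (simp add: \<psi>_def)
    ultimately obtain u where sol: "H2_global_solution f g L \<psi> u"
      and sup: "(SUP t\<in>{0<..}. ennreal (orbit_dist L \<phi> (u t))) < ennreal e"
      using d0(2) by blast
    obtain U Q where reg: "regular_solution f g L U Q"
      and uH: "\<And>t. t \<ge> 0 \<Longrightarrow> u t \<in> Hs_per 2 L" and uU: "\<And>t. t \<ge> 0 \<Longrightarrow> AE x in per_M L. u t x = U t x"
      using H2_global_solution_regular[OF L_pos f_cont g_cont sol] by blast
    interpret pw: perturbed_wave f g f' g' \<phi> \<phi>' \<phi>'' c L U Q
      by unfold_locales (rule reg)
    \<comment> \<open>The translate may depend on t in any manner: each time is treated on its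
      own.\<close>
    have close: "\<exists>r. \<forall>x. \<bar>U t x - \<phi> (x + r)\<bar> \<le> \<epsilon>" if t: "t > 0" for t
    proof -
      have t0: "t \<ge> 0" using t by simp
      have "ennreal (orbit_dist L \<phi> (u t)) \<le> (SUP t\<in>{0<..}. ennreal (orbit_dist L \<phi> (u t)))"
        using t by (intro SUP_upper) auto
      then have "ennreal (orbit_dist L \<phi> (u t)) < ennreal e" using sup by (rule le_less_trans)
      then have "orbit_dist L \<phi> (u t) < e"
        by (simp add: ennreal_less_iff orbit_dist_nonneg[OF L_pos])
      then obtain r where r: "Hs_norm 2 L (\<lambda>x. u t x - \<phi> (x + r)) < e"
        using orbit_dist_lessD by blast
      have sh: "continuous_on S (\<lambda>x. \<phi> (x + r))" for S
        using continuous_shift[OF \<phi>_cont, of S "- r"] by simp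
      have win: "\<bar>U t x - \<phi> (x + r)\<bar> \<le> \<epsilon>" if x: "x \<in> {0..L}" for x
      proof -
        have "\<bar>U t x - \<phi> (x + r)\<bar> \<le> sobolev_const L * Hs_norm 2 L (\<lambda>x. u t x - \<phi> (x + r))"
        proof (rule sobolev_sup_bound[OF L_pos _ _ _ x])
          show "(\<lambda>x. u t x - \<phi> (x + r)) \<in> Hs_per 2 L"
            using Hs_per_diff[OF uH[OF t0] profile_in_Hs2[of r 0]] by simp
          show "continuous_on {0..L} (\<lambda>x. U t x - \<phi> (x + r))"
            by (intro continuous_intros pw.U_cont t0 sh)
          show "AE x in per_M L. u t x - \<phi> (x + r) = U t x - \<phi> (x + r)"
            using uU[OF t0] by eventually_elim simp
        qed
        also have "\<dots> \<le> sobolev_const L * e" using r sc0 by (intro mult_left_mono) auto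
        finally show ?thesis using e(2) by simp
      qed
      have perD: "periodic L (\<lambda>x. U t x - \<phi> (x + r))"
        using pw.U_per[OF t0] \<phi>_per unfolding periodic_def by (metis add.commute add.left_commute)
      have "\<bar>U t x - \<phi> (x + r)\<bar> \<le> \<epsilon>" for x
        by (rule periodic_reduce[OF L_pos perD, of 0 x]) (use win in auto)
      then show ?thesis by blast
    qed
    have U0: "U 0 x = \<psi> x" if "x \<in> {0..L}" for x
    proof (rule continuous_AE_eq_imp_eq[OF L_pos pw.U_cont[OF order_refl] \<psi>c _ that])
      have "AE x in lborel. u 0 x = \<psi> x"
        using sol unfolding H2_global_solution_def H2_solution_def by (meson zero_less_one)
      then have "AE x in per_M L. u 0 x = \<psi> x"
        by (rule AE_per_M)
      then show "AE x in per_M L. U 0 x = \<psi> x"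
        using uU[OF order_refl] by eventually_elim simp
    qed
    have V0: "pw.V 0 x = \<rho>" if "x \<in> {0..L}" for x
      using U0[OF that] by (simp add: pw.V_def \<psi>_def)
    have Ub: "\<bar>U t x\<bar> \<le> B + \<epsilon>" if t: "t > 0" for t x
    proof -
      obtain r where "\<bar>U t x - \<phi> (x + r)\<bar> \<le> \<epsilon>" using close[OF t] by blast
      then show ?thesis using B(2)[of "x + r"] by linarith
    qed
    have V_nonneg: "pw.V t x \<ge> 0" if "t \<ge> 0" "x \<in> {0..L}" for t x
      by (rule pw.comparison[OF Ub _ that]) (use V0 \<rho>(1) in auto)
    have V_small: "0 \<le> pw.V t x \<and> pw.V t x \<le> \<delta>" if t: "t > 0" and x: "x \<in> {0..L}" for t x
    proof -
      have t0: "t \<ge> 0" using t by simp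
      obtain r where r: "\<And>x. \<bar>U t x - \<phi> (x + r)\<bar> \<le> \<epsilon>" using close[OF t] by blast
      have V_all: "pw.V t x \<ge> 0" for x
        by (rule periodic_reduce[OF L_pos pw.V_per[OF t0], of 0 x]) (use V_nonneg[OF t0] in auto)
      \<comment> \<open>U lies above the moving wave and within \<epsilon> of the translate; r + c t
        is the displacement between the two in the moving frame.\<close>
      have above: "\<phi> y \<le> \<phi> (y + (r + c * t)) + d" for y
        using V_all[of "y + c * t"] r[of "y + c * t"] \<epsilon>(2) by (simp add: pw.V_def add_ac)
      have "\<phi> (x - c * t + (r + c * t)) - \<phi> (x - c * t) \<le> \<delta> / 2"
        by (rule d(2)[OF above])
      then have "pw.V t x \<le> \<delta>"
        using r[of x] \<epsilon>(3) by (simp add: pw.V_def)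
      then show ?thesis using V_all by blast
    qed
    define I where "I = integral {0..L} Z"
    have "I > 0"
    proof -
      obtain x0 where "Z x0 > 0" using Z(6) by blast
      then obtain y where y: "y \<in> {0..L}" "Z y > 0"
        using periodic_reduce[OF L_pos Z(4), of 0 x0] by (metis add_0 atLeastAtMost_iff atLeastLessThan_iff less_imp_le)
      have "I \<ge> 0" unfolding I_def by (intro Henstock_Kurzweil_Integration.integral_nonneg integrable_continuous_interval Zc) (use Z(5) in auto)
      moreover have "I \<noteq> 0"
      proof
        assume "I = 0"
        then have "(Z has_integral 0) (cbox 0 L)"
          using integrable_integral[OF integrable_continuous_interval[OF Zc]] unfolding I_def by (metis cbox_interval)
        then have "Z y = 0"
          using has_integral_0_cbox_imp_0[of 0 L Z y] Zc Z(5) L_pos y(1) by simp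
        then show False using y(2) by simp
      qed
      ultimately show ?thesis by simp
    qed
    obtain BZ where BZ: "BZ > 0" "\<And>x. \<bar>Z x\<bar> \<le> BZ"
      using periodic_bounded[OF L_pos Z(4) Zc] by blast
    \<comment> \<open>At this time the linear lower bound \<rho> I \<mu> T for the growth already
      equals the upper bound, and exp z \<ge> 1 + z leaves the surplus \<rho> I.\<close>
    define T where "T = \<delta> * BZ * L / (\<rho> * I * \<mu>)"
    have T: "T \<ge> 0" using \<delta>(1) BZ(1) L_pos \<rho>(1) \<open>I > 0\<close> \<mu> by (simp add: T_def)
    have T': "T > 0" using \<delta>(1) BZ(1) L_pos \<rho>(1) \<open>I > 0\<close> \<mu> by (simp add: T_def)
    have "integral {0..L} (\<lambda>x. pw.V 0 x * Z (x - c * 0)) * exp (\<mu> * T) \<le> integral {0..L} (\<lambda>x. pw.V T x * Z (x - c * T))"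
    proof (rule pw.weighted_integral_growth[OF Z(1-5) sub _ _ V_small T])
      show "\<bar>f (\<phi> y + v) - f (\<phi> y) - f' (\<phi> y) * v\<bar> \<le> \<mu> * v" if "0 \<le> v" "v \<le> \<delta>" for y v
        using df(2)[OF B(2)] that \<delta>(2) by simp
      show "\<bar>g (\<phi> y + v) - g (\<phi> y) - g' (\<phi> y) * v\<bar> \<le> \<mu> * v" if "0 \<le> v" "v \<le> \<delta>" for y v
        using dg(2)[OF B(2)] that \<delta>(3) by simp
    qed
    also have "integral {0..L} (\<lambda>x. pw.V 0 x * Z (x - c * 0)) = integral {0..L} (\<lambda>x. \<rho> * Z x)"
      by (intro Henstock_Kurzweil_Integration.integral_cong) (simp add: V0)
    also have "\<dots> = \<rho> * I" by (simp add: I_def)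
    also have "integral {0..L} (\<lambda>x. pw.V T x * Z (x - c * T)) \<le> \<delta> * BZ * L"
    proof -
      have "\<bar>pw.V T x * Z (x - c * T)\<bar> \<le> \<delta> * BZ" if "x \<in> {0..L}" for x
        unfolding abs_mult using V_small[OF T' that] BZ(2) by (intro mult_mono) auto
      then have "\<bar>integral {0..L} (\<lambda>x. pw.V T x * Z (x - c * T))\<bar> \<le> \<delta> * BZ * L"
        by (intro integral_abs_le L_pos continuous_intros pw.V_cont T continuous_shift[OF Zc])
      then show ?thesis by simp
    qed
    finally have "\<rho> * I * exp (\<mu> * T) \<le> \<delta> * BZ * L" .
    moreover have "\<rho> * I * exp (\<mu> * T) \<ge> \<rho> * I * (1 + \<mu> * T)"
      using \<rho>(1) \<open>I > 0\<close> by (intro mult_left_mono exp_ge_add_one_self) auto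
    moreover have "\<rho> * I * (\<mu> * T) = \<delta> * BZ * L"
      using \<rho>(1) \<open>I > 0\<close> \<mu> by (simp add: T_def)
    moreover have "\<rho> * I > 0" using \<rho>(1) \<open>I > 0\<close> by simp
    ultimately show False by (simp add: distrib_left)
  qed
  then show ?thesis using inH by (simp add: orbitally_unstable_def)
qed

end

section \<open>From the wave family to the profile equation\<close>

lemma C_k_deriv:
  assumes "C_k k h" "j < k"
  shows "((deriv ^^ j) h has_real_derivative (deriv ^^ Suc j) h x) (at x)"
  using assms unfolding C_k_def by (simp add: DERIV_deriv_iff_real_differentiable)

theorem theorem5p12:
  fixes f g :: "real \<Rightarrow> real" and us \<epsilon>1 :: real
    and L :: "real \<Rightarrow> real" and \<phi> :: "real \<Rightarrow> real \<Rightarrow> real"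
  assumes A1: "C_k 4 f"
    and A2: "C_k 3 g" "g 0 = 0" "g 1 = 0" "deriv g 0 > 0" "deriv g 1 < 0"
      "\<And>u. 0 < u \<Longrightarrow> u < 1 \<Longrightarrow> g u > 0" "\<And>u. u < 0 \<Longrightarrow> g u < 0"
    and A3: "us < 0" "integral {us..0} g + integral {0..1} g = 0"
    and A5: "integral {us..1} (gam g)
               * integral {us..1} (\<lambda>s. deriv f s * sqrt (1 + (deriv (gam g) s)\<^sup>2))
             \<noteq> integral {us..1} (\<lambda>s. sqrt (1 + (deriv (gam g) s)\<^sup>2))
               * integral {us..1} (\<lambda>s. deriv f s * gam g s)"
    and A6: "deriv f 1 * integral {us..1} (gam g) \<noteq> integral {us..1} (\<lambda>s. deriv f s * gam g s)"
    and eps1: "\<epsilon>1 > 0"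
    and family: "large_period_family f g us \<epsilon>1 L \<phi>"
  shows "\<exists>\<epsilon>2. 0 < \<epsilon>2 \<and> \<epsilon>2 < \<epsilon>1 \<and>
           (\<forall>\<epsilon>\<in>{0<..<\<epsilon>2}. orbitally_unstable f g (L \<epsilon>) (\<phi> \<epsilon>))"
proof (intro exI[of _ "\<epsilon>1 / 2"] conjI ballI)
  \<comment> \<open>The instability theorem applies to every member of the family, so half of
    \<epsilon>1 serves as the threshold.\<close>
  fix \<epsilon> assume "\<epsilon> \<in> {0<..<\<epsilon>1 / 2}"
  then have "\<epsilon> \<in> {0<..<\<epsilon>1}" using eps1 by auto
  then have tw: "traveling_wave f g (wave_speed f g us \<epsilon>) (\<phi> \<epsilon>)" and fp: "fundamental_period (L \<epsilon>) (\<phi> \<epsilon>)"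
    using family by (auto simp: large_period_family_def)
  define c where "c = wave_speed f g us \<epsilon>"
  define \<Phi> where "\<Phi> = \<phi> \<epsilon>"
  have cs: "classical_solution f g (\<lambda>t x. \<Phi> (x - c * t))"
    using tw by (simp add: traveling_wave_def c_def \<Phi>_def)
  then have "C_k 2 (\<lambda>x. \<Phi> (x - c * 0))"
    unfolding classical_solution_def by blast
  then have C2: "C_k 2 \<Phi>" by simp
  have d1: "(\<Phi> has_real_derivative deriv \<Phi> x) (at x)" for x
    using C_k_deriv[OF C2, of 0 x] by simp
  have d2: "(deriv \<Phi> has_real_derivative deriv (deriv \<Phi>) x) (at x)" for x
    using C_k_deriv[OF C2, of 1 x] by simp
  have df: "(f has_real_derivative deriv f y) (at y)" "(deriv f has_real_derivative deriv (deriv f) y) (at y)" for y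
    using C_k_deriv[OF A1, of 0 y] C_k_deriv[OF A1, of 1 y] by simp_all
  have dg: "(g has_real_derivative deriv g y) (at y)" "(deriv g has_real_derivative deriv (deriv g) y) (at y)" for y
    using C_k_deriv[OF A2(1), of 0 y] C_k_deriv[OF A2(1), of 1 y] by simp_all
  interpret periodic_wave f g "deriv f" "deriv g" \<Phi> "deriv \<Phi>" "deriv (deriv \<Phi>)" c "L \<epsilon>"
  proof
    show "L \<epsilon> > 0" "periodic (L \<epsilon>) \<Phi>"
      using fp by (auto simp: fundamental_period_def \<Phi>_def)
    show "continuous_on UNIV (deriv f)" "continuous_on UNIV (deriv g)"
      using df(2) dg(2) by (auto intro: has_real_derivative_continuous_on)
    show "continuous_on UNIV (deriv (deriv \<Phi>))"
      using C2 by (simp add: C_k_def numeral_2_eq_2)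
    show "deriv (deriv \<Phi>) x + (c - deriv f (\<Phi> x)) * deriv \<Phi> x + g (\<Phi> x) = 0" for x
    proof -
      \<comment> \<open>At time 0 the equation for the travelling wave is the profile
        equation.\<close>
      have "((\<lambda>\<tau>. \<Phi> (x - c * \<tau>)) has_real_derivative deriv \<Phi> (x - c * 0) * (- c)) (at 0)"
        by (rule DERIV_chain2[OF d1]) (auto intro!: derivative_eq_intros)
      then have 1: "deriv (\<lambda>\<tau>. \<Phi> (x - c * \<tau>)) 0 = - c * deriv \<Phi> x"
        by (auto dest: DERIV_imp_deriv)
      have 2: "deriv (\<lambda>y. f (\<Phi> y)) x = deriv f (\<Phi> x) * deriv \<Phi> x"
        by (rule DERIV_imp_deriv[OF DERIV_chain2[OF df(1) d1]])
      have "deriv (\<lambda>\<tau>. \<Phi> (x - c * \<tau>)) 0 + deriv (\<lambda>y. f (\<Phi> (y - c * 0))) x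
          = deriv (deriv (\<lambda>x. \<Phi> (x - c * 0))) x + g (\<Phi> (x - c * 0))"
        using cs unfolding classical_solution_def by blast
      then show ?thesis using 1 2 by (simp add: algebra_simps)
    qed
  qed (rule d1 d2 df(1) dg(1))+
  show "orbitally_unstable f g (L \<epsilon>) (\<phi> \<epsilon>)"
    using orbitally_unstable_periodic_wave fp by (simp add: \<Phi>_def)
qed (use eps1 in auto)

end
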